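(* Let $\Omega\subset\mathbb{R}^N$ be an open bounded set with Lipschitz boundary and let $A:\mathbb{R}^N\to\mathbb{R}^N$ be locally Lipschitz. Then $\Omega$ is an extension domain (with respect to $A$).
   Context: For an open set $\Omega\subset\mathbb{R}^N$ and $u\in L^1(\Omega,\mathbb{C})$, let $$C_{1,A,u}(\Omega):=\sup\Big\{\int_\Omega \Re u\,\mathrm{div}\,\varphi-A\cdot\varphi\,\Im u\,dx : \varphi\in C_c^\infty(\Omega,\mathbb{R}^N),\ \|\varphi\|_{L^\infty(\Omega)}\le1\Big\},$$ $$C_{2,A,u}(\Omega):=\sup\Big\{\int_\Omega \Im u\,\mathrm{div}\,\varphi+A\cdot\varphi\,\Re u\,dx : \varphi\in C_c^\infty(\Omega,\mathbb{R}^N),\ \|\varphi\|_{L^\infty(\Omega)}\le1\Big\},$$ $|Du|_A(\Omega):=C_{1,A,u}(\Omega)+C_{2,A,u}(\Omega)$, and $BV_A(\Omega):=\{u\in L^1(\Omega,\mathbb{C}):|Du|_A(\Omega)<\infty\}$, normed by $\|u\|_{BV_A(\Omega)}=\int_\Omega(|\Re u|+|\Im u|)\,dx+|Du|_A(\Omega)$. For a Borel set $E\subset\Omega$, $|Du|_A(E):=\inf\{C_{1,A,u}(U): E\subset U\subset\Omega,\ U\text{ open}\}+\inf\{C_{2,A,u}(U): E\subset U\subset\Omega,\ U\text{ open}\}$, where $C_{i,A,u}(U)$ is defined with test functions compactly supported in $U$. An open set $\Omega\subset\mathbb{R}^N$ is an extension domain if $\partial\Omega$ is bounded and for any open set $W\supset\overline\Omega$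 there is a linear continuous extension operator $E:BV_A(\Omega)\to BV_A(\mathbb{R}^N)$ (so $Eu=u$ a.e. in $\Omega$; these are real normed spaces) such that, for every $u\in BV_A(\Omega)$, $Eu=0$ a.e. in $\mathbb{R}^N\setminus W$ and $|DEu|_A(\partial\Omega)=0$. *)

theory Defs
  imports "HOL-Analysis.Analysis"
begin

text \<open>Test functions are total functions on the whole space; an element of
  \<open>C_c^\<infinity>(\<Omega>)\<close> is identified with its extension by zero.\<close>

primrec Ck_vf :: "nat \<Rightarrow> (real^'n \<Rightarrow> real^'n) \<Rightarrow> bool" where
  "Ck_vf 0 \<phi> \<longleftrightarrow> continuous_on UNIV \<phi>"
| "Ck_vf (Suc k) \<phi> \<longleftrightarrow> (\<forall>x. \<phi> differentiable (at x)) \<and>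
     (\<forall>i. Ck_vf k (\<lambda>x. frechet_derivative \<phi> (at x) (axis i 1)))"

definition test_fields :: "(real^'n) set \<Rightarrow> (real^'n \<Rightarrow> real^'n) set" where
  "test_fields \<Omega> = {\<phi>. (\<forall>k. Ck_vf k \<phi>) \<and>
     compact (closure {x. \<phi> x \<noteq> 0}) \<and> closure {x. \<phi> x \<noteq> 0} \<subseteq> \<Omega>}"

definition divergence :: "(real^'n \<Rightarrow> real^'n) \<Rightarrow> real^'n \<Rightarrow> real" where
  "divergence \<phi> x = (\<Sum>i\<in>UNIV. frechet_derivative \<phi> (at x) (axis i 1) $ i)"

text \<open>The condition \<open>\<parallel>\<phi>\<parallel> \<le> 1\<close> in \<open>L\<^sup>\<infinity>(\<Omega>)\<close> is taken with respect to the Euclidean norm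
  on the values of \<open>\<phi>\<close>.\<close>

definition C1 :: "(real^'n \<Rightarrow> real^'n) \<Rightarrow> (real^'n \<Rightarrow> complex) \<Rightarrow> (real^'n) set \<Rightarrow> ereal" where
  "C1 A u \<Omega> =
     (SUP \<phi> \<in> {\<phi> \<in> test_fields \<Omega>. AE x\<in>\<Omega> in lebesgue. norm (\<phi> x) \<le> 1}.
        ereal (LINT x:\<Omega>|lebesgue. Re (u x) * divergence \<phi> x - (A x \<bullet> \<phi> x) * Im (u x)))"

definition C2 :: "(real^'n \<Rightarrow> real^'n) \<Rightarrow> (real^'n \<Rightarrow> complex) \<Rightarrow> (real^'n) set \<Rightarrow> ereal" where
  "C2 A u \<Omega> =
     (SUP \<phi> \<in> {\<phi> \<in> test_fields \<Omega>. AE x\<in>\<Omega> in lebesgue. norm (\<phi> x) \<le> 1}.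
        ereal (LINT x:\<Omega>|lebesgue. Im (u x) * divergence \<phi> x + (A x \<bullet> \<phi> x) * Re (u x)))"

definition total_var :: "(real^'n \<Rightarrow> real^'n) \<Rightarrow> (real^'n \<Rightarrow> complex) \<Rightarrow> (real^'n) set \<Rightarrow> ereal" where
  "total_var A u \<Omega> = C1 A u \<Omega> + C2 A u \<Omega>"

text \<open>\<open>|Du|\<^sub>A(E)\<close> for a Borel subset \<open>E\<close> of the ambient open set \<open>\<Omega>\<close>.\<close>

definition var_measure ::
  "(real^'n \<Rightarrow> real^'n) \<Rightarrow> (real^'n) set \<Rightarrow> (real^'n \<Rightarrow> complex) \<Rightarrow> (real^'n) set \<Rightarrow> ereal" where
  "var_measure A \<Omega> u E =
     (INF U \<in> {U. open U \<and> E \<subseteq> U \<and> U \<subseteq> \<Omega>}. C1 A u U) +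
     (INF U \<in> {U. open U \<and> E \<subseteq> U \<and> U \<subseteq> \<Omega>}. C2 A u U)"

text \<open>Elements of \<open>BV\<^sub>A(\<Omega>)\<close> are represented by functions on the whole space whose values
  outside \<open>\<Omega>\<close> are irrelevant; equality in \<open>BV\<^sub>A(\<Omega>)\<close> is equality almost everywhere
  in \<open>\<Omega>\<close>.\<close>

definition BV :: "(real^'n \<Rightarrow> real^'n) \<Rightarrow> (real^'n) set \<Rightarrow> (real^'n \<Rightarrow> complex) set" where
  "BV A \<Omega> = {u. set_integrable lebesgue \<Omega> u \<and> total_var A u \<Omega> < \<infinity>}"

definition BV_norm :: "(real^'n \<Rightarrow> real^'n) \<Rightarrow> (real^'n) set \<Rightarrow> (real^'n \<Rightarrow> complex) \<Rightarrow> real" where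
  "BV_norm A \<Omega> u =
     (LINT x:\<Omega>|lebesgue. \<bar>Re (u x)\<bar> + \<bar>Im (u x)\<bar>) + real_of_ereal (total_var A u \<Omega>)"

text \<open>The second clause says that \<open>T\<close> is well defined on almost-everywhere classes; continuity
  is expressed by boundedness, as in \<open>bounded_linear\<close>.\<close>

definition extension_operator ::
  "(real^'n \<Rightarrow> real^'n) \<Rightarrow> (real^'n) set \<Rightarrow>
   ((real^'n \<Rightarrow> complex) \<Rightarrow> (real^'n \<Rightarrow> complex)) \<Rightarrow> bool" where
  "extension_operator A \<Omega> T \<longleftrightarrow>
     (\<forall>u\<in>BV A \<Omega>. T u \<in> BV A UNIV) \<and>
     (\<forall>u\<in>BV A \<Omega>. \<forall>v\<in>BV A \<Omega>. (AE x\<in>\<Omega> in lebesgue. u x = v x) \<longrightarrow>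
        (AE x in lebesgue. T u x = T v x)) \<and>
     (\<forall>u\<in>BV A \<Omega>. \<forall>v\<in>BV A \<Omega>. AE x in lebesgue. T (\<lambda>y. u y + v y) x = T u x + T v x) \<and>
     (\<forall>c::real. \<forall>u\<in>BV A \<Omega>. AE x in lebesgue. T (\<lambda>y. c *\<^sub>R u y) x = c *\<^sub>R T u x) \<and>
     (\<exists>K. \<forall>u\<in>BV A \<Omega>. BV_norm A UNIV (T u) \<le> K * BV_norm A \<Omega> u) \<and>
     (\<forall>u\<in>BV A \<Omega>. AE x\<in>\<Omega> in lebesgue. T u x = u x)"

definition extension_domain :: "(real^'n \<Rightarrow> real^'n) \<Rightarrow> (real^'n) set \<Rightarrow> bool" where
  "extension_domain A \<Omega> \<longleftrightarrow> open \<Omega> \<and> bounded (frontier \<Omega>) \<and>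
     (\<forall>W. open W \<longrightarrow> closure \<Omega> \<subseteq> W \<longrightarrow>
        (\<exists>T. extension_operator A \<Omega> T \<and>
             (\<forall>u\<in>BV A \<Omega>. (AE x in lebesgue. x \<notin> W \<longrightarrow> T u x = 0) \<and>
                          var_measure A UNIV (T u) (frontier \<Omega>) = 0)))"

definition locally_lipschitz :: "(real^'n \<Rightarrow> real^'n) \<Rightarrow> bool" where
  "locally_lipschitz A \<longleftrightarrow> (\<forall>x. \<exists>r>0. \<exists>L. L-lipschitz_on (ball x r) A)"

text \<open>Near each boundary point \<open>\<Omega>\<close> is the region on one side of the graph of a Lipschitz
  function. Instead of rotating the coordinates, the distinguished axis is given by a unit vector
  \<open>e\<close>, and the Lipschitz function \<open>\<gamma>\<close> lives on the hyperplane orthogonal to \<open>e\<close>.\<close>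

definition lipschitz_boundary :: "(real^'n) set \<Rightarrow> bool" where
  "lipschitz_boundary \<Omega> \<longleftrightarrow> (\<forall>x\<in>frontier \<Omega>. \<exists>r>0. \<exists>e. \<exists>\<gamma>::real^'n \<Rightarrow> real. \<exists>L.
     norm e = 1 \<and> L-lipschitz_on {y. y \<bullet> e = 0} \<gamma> \<and>
     \<Omega> \<inter> ball x r = {y \<in> ball x r. \<gamma> (y - (y \<bullet> e) *\<^sub>R e) < y \<bullet> e})"

end

theory Submission
  imports Defs
begin

text \<open>Since \<open>A\<close> is bounded near \<open>\<Omega>\<close>, bounding \<open>C1\<close> and \<open>C2\<close> amounts to bounding the variation of the real
  and imaginary parts. The variation of a function on an open set controls, and is controlled by, the
  \<open>L\<^sup>1\<close> norms of its difference quotients, so no traces and no differentiability of the boundary are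
  needed. Cut off by Lipschitz bumps, the function is reflected across each boundary graph; this
  reflection preserves Lebesgue measure. Differences across the graph are estimated by moving both
  points upwards into \<open>\<Omega>\<close> and averaging over the height. The estimate is local: the variation of the
  extension near the frontier is bounded by the variation and the mass of the given function on
  \<open>\<Omega>\<close> near the frontier, which tend to zero because test fields have compact support in \<open>\<Omega>\<close>.\<close>

text \<open>The obstacle is that variation on an open set controls an increment only along a segment
  that stays in the set, while a segment between two points of \<Omega> may leave it. Above an
  \<open>L\<close>-Lipschitz graph there is a cone of displacements that never leave the epigraph:
  those whose vertical part is at least \<open>L\<close> times the horizontal part. Every increment
  is therefore written as a difference of two increments in this cone with a common endpoint. The
  price is a constant factor, which is harmless: the operator has only to be bounded, and the
  variation on the frontier is an infimum over neighbourhoods, so it is enough that the constant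
  depends neither on the width \<rho> nor on the function. For that reason \<open>C\<close>,
  \<open>K\<close> and \<open>\<rho>\<^sub>0\<close> are chosen before both. The cut-offs are not
  normalised to a partition of unity: each boundary patch takes its share of what the earlier ones
  left, and the remainder vanishes near the frontier, so that it may be extended by zero.\<close>

section \<open>Smooth cut-off functions built from the flat exponential\<close>

definition flat_exp :: "nat \<Rightarrow> real \<Rightarrow> real" where
  "flat_exp n t = (if 0 < t then exp (- 1 / t) / t ^ n else 0)"

text \<open>Only \<open>t = 0\<close> needs an argument. From the right, the substitution s = 1/t
  turns the difference quotient into \<open>s ^ Suc n / exp s\<close>, which tends to 0.\<close>

lemma has_derivative_flat_exp:
  "(flat_exp n has_real_derivative flat_exp (n + 2) t - real n * flat_exp (Suc n) t) (at t)"
proof -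
  consider "0 < t" | "t < 0" | "t = 0" by linarith
  then show ?thesis
  proof cases
    case 1
    have "((\<lambda>t. exp (- 1 / t) / t ^ n) has_real_derivative
        flat_exp (n + 2) t - real n * flat_exp (Suc n) t) (at t)"
      using 1
      apply (auto intro!: derivative_eq_intros simp: flat_exp_def)
      apply (cases n)
       apply (simp_all add: field_simps power2_eq_square)
      done
    then show ?thesis
      by (rule has_field_derivative_transform_within[where d = t]) (use 1 in \<open>auto simp: flat_exp_def dist_real_def\<close>)
  next
    case 2
    have "((\<lambda>t. 0) has_real_derivative 0) (at t)" by simp
    then have "(flat_exp n has_real_derivative 0) (at t)"
      by (rule has_field_derivative_transform_within[where d = "- t"])
        (use 2 in \<open>auto simp: flat_exp_def dist_real_def\<close>)
    then show ?thesis using 2 by (simp add: flat_exp_def)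
  next
    case 3
    have l: "((\<lambda>y. (flat_exp n y - flat_exp n 0) / (y - 0)) \<longlongrightarrow> 0) (at_left 0)"
      by (rule tendsto_eventually)
        (auto simp: flat_exp_def eventually_at_filter)
    have "((\<lambda>s::real. s ^ Suc n / exp s) \<longlongrightarrow> 0) at_top" by (rule tendsto_power_div_exp_0)
    then have "((\<lambda>s::real. (flat_exp n (inverse s) - flat_exp n 0) / (inverse s - 0)) \<longlongrightarrow> 0) at_top"
      by (rule Lim_transform_eventually)
        (auto intro!: eventually_mono[OF eventually_gt_at_top[of 0]]
          simp: flat_exp_def exp_minus field_simps)
    then have r: "((\<lambda>y. (flat_exp n y - flat_exp n 0) / (y - 0)) \<longlongrightarrow> 0) (at_right 0)"
      by (simp add: filterlim_at_right_to_top)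
    show ?thesis
      using l r 3 unfolding has_field_derivative_iff
      by (simp add: filterlim_at_split flat_exp_def)
  qed
qed

text \<open>A class of smooth functions just large enough to contain cut-off functions: the powers
  \<open>t ^ n\<close> in the denominator make it closed under partial derivatives.\<close>

inductive smooth_fun :: "(real^'n \<Rightarrow> real) \<Rightarrow> bool" where
  const: "smooth_fun (\<lambda>x. c)"
| coord: "smooth_fun (\<lambda>x. x $ i - c)"
| add: "smooth_fun f \<Longrightarrow> smooth_fun g \<Longrightarrow> smooth_fun (\<lambda>x. f x + g x)"
| mult: "smooth_fun f \<Longrightarrow> smooth_fun g \<Longrightarrow> smooth_fun (\<lambda>x. f x * g x)"
| germ: "smooth_fun (\<lambda>x. flat_exp n (r - (x - a) \<bullet> (x - a)))"

lemma smooth_fun_sum: "finite I \<Longrightarrow> (\<And>i. i \<in> I \<Longrightarrow> smooth_fun (f i)) \<Longrightarrow> smooth_fun (\<lambda>x. \<Sum>i\<in>I. f i x)"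
  by (induction I rule: finite_induct) (auto intro: smooth_fun.intros)

lemma smooth_fun_power: "smooth_fun f \<Longrightarrow> smooth_fun (\<lambda>x. f x ^ n)"
  by (induction n) (auto intro: smooth_fun.intros)

lemma smooth_fun_diff: "smooth_fun f \<Longrightarrow> smooth_fun g \<Longrightarrow> smooth_fun (\<lambda>x. f x - g x)"
  using smooth_fun.add[OF _ smooth_fun.mult[OF smooth_fun.const[of "-1"]], of f g] by simp

lemma smooth_fun_cmult: "smooth_fun f \<Longrightarrow> smooth_fun (\<lambda>x. c * f x)"
  by (intro smooth_fun.intros)

lemma smooth_fun_shift: "smooth_fun f \<Longrightarrow> smooth_fun (\<lambda>x. f (x - b))"
proof (induction rule: smooth_fun.induct)
  case (coord i c)
  then show ?case using smooth_fun.coord[of i "c + b $ i"] by (simp add: algebra_simps)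
next
  case (germ n r a)
  have "x - b - a = x - (a + b)" for x :: "real^'a" by simp
  then show ?case using smooth_fun.germ[of n r "a + b"] by presburger
qed (auto intro: smooth_fun.intros)

lemma smooth_fun_has_derivative:
  fixes f :: "real^'n \<Rightarrow> real"
  assumes "smooth_fun f"
  shows "\<exists>D. (\<forall>i. smooth_fun (D i)) \<and>
    (\<forall>x. (f has_derivative (\<lambda>h. \<Sum>i\<in>UNIV. h $ i * D i x)) (at x))"
  using assms
proof (induction rule: smooth_fun.induct)
  case (const c)
  then show ?case by (intro exI[of _ "\<lambda>i x. 0"]) (auto intro: smooth_fun.intros)
next
  case (coord i c)
  have "((\<lambda>x::real^'n. x $ i - c) has_derivative (\<lambda>h. \<Sum>j\<in>UNIV. h $ j * (if j = i then 1 else 0))) (at x)" for x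
  proof -
    have e: "(\<Sum>j\<in>UNIV. h $ j * (if j = i then 1 else 0)) = h $ i" for h :: "real^'n"
      by (simp add: if_distrib cong: if_cong)
    show ?thesis unfolding e
      by (rule has_derivative_eq_rhs[OF has_derivative_diff[OF
            bounded_linear_imp_has_derivative[OF bounded_linear_vec_nth] has_derivative_const]]) auto
  qed
  then show ?case
    by (intro exI[of _ "\<lambda>j x. if j = i then 1 else 0"]) (auto intro: smooth_fun.intros)
next
  case (add f g)
  then obtain D E where D: "\<And>i. smooth_fun (D i)" "\<And>x. (f has_derivative (\<lambda>h. \<Sum>i\<in>UNIV. h $ i * D i x)) (at x)"
    and E: "\<And>i. smooth_fun (E i)" "\<And>x. (g has_derivative (\<lambda>h. \<Sum>i\<in>UNIV. h $ i * E i x)) (at x)" by blast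
  have "((\<lambda>x. f x + g x) has_derivative (\<lambda>h. \<Sum>i\<in>UNIV. h $ i * (D i x + E i x))) (at x)" for x
    by (rule has_derivative_eq_rhs[OF has_derivative_add[OF D(2) E(2)]])
      (simp add: distrib_left sum.distrib)
  then show ?case
    by (intro exI[of _ "\<lambda>i x. D i x + E i x"]) (auto intro: smooth_fun.intros D E)
next
  case (mult f g)
  then obtain D E where D: "\<And>i. smooth_fun (D i)" "\<And>x. (f has_derivative (\<lambda>h. \<Sum>i\<in>UNIV. h $ i * D i x)) (at x)"
    and E: "\<And>i. smooth_fun (E i)" "\<And>x. (g has_derivative (\<lambda>h. \<Sum>i\<in>UNIV. h $ i * E i x)) (at x)" by blast
  have "((\<lambda>x. f x * g x) has_derivative (\<lambda>h. \<Sum>i\<in>UNIV. h $ i * (f x * E i x + D i x * g x))) (at x)" for x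
    by (rule has_derivative_eq_rhs[OF has_derivative_mult[OF D(2) E(2)]])
      (simp add: distrib_left sum.distrib sum_distrib_left sum_distrib_right algebra_simps)
  then show ?case
    by (intro exI[of _ "\<lambda>i x. f x * E i x + D i x * g x"]) (auto intro!: smooth_fun.add smooth_fun.mult D(1) E(1) mult.hyps)
next
  case (germ n r a)
  define G where "G s = flat_exp (n + 2) s - real n * flat_exp (Suc n) s" for s
  define q where "q x = r - (x - a) \<bullet> (x - a)" for x :: "real^'n"
  have sG: "smooth_fun (\<lambda>x. G (q x))"
    unfolding G_def q_def by (intro smooth_fun_diff smooth_fun_cmult smooth_fun.germ)
  have q': "(q has_derivative (\<lambda>h. - 2 * ((x - a) \<bullet> h))) (at x)" for x
    unfolding q_def by (auto intro!: derivative_eq_intros simp: inner_commute)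
  have "((\<lambda>x. flat_exp n (q x)) has_derivative (\<lambda>h. \<Sum>i\<in>UNIV. h $ i * (G (q x) * (- 2 * (x $ i - a $ i))))) (at x)" for x
  proof -
    have "(flat_exp n has_derivative (*) (G (q x))) (at (q x))"
      using has_derivative_flat_exp unfolding G_def has_field_derivative_def by blast
    from has_derivative_compose[OF q' this] show ?thesis
      by (rule has_derivative_eq_rhs)
        (simp add: inner_vec_def sum_distrib_left algebra_simps)
  qed
  moreover have "smooth_fun (\<lambda>x. G (q x) * (- 2 * (x $ i - a $ i)))" for i
    by (rule smooth_fun.mult[OF sG smooth_fun.mult[OF smooth_fun.const smooth_fun.coord]])
  ultimately show ?case
    unfolding q_def[symmetric]
    by (intro exI[of _ "\<lambda>i x. G (q x) * (- 2 * (x $ i - a $ i))"]) blast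
qed

lemma smooth_fun_continuous: "smooth_fun f \<Longrightarrow> continuous_on A f"
  by (intro continuous_at_imp_continuous_on ballI)
    (use smooth_fun_has_derivative has_derivative_continuous in blast)

lemma Ck_vf_smooth_fun:
  fixes f :: "real^'n \<Rightarrow> real"
  shows "smooth_fun f \<Longrightarrow> Ck_vf k (\<lambda>x. f x *\<^sub>R v)"
proof (induction k arbitrary: f)
  case 0
  then show ?case by (simp add: smooth_fun_continuous continuous_on_scaleR)
next
  case (Suc k)
  obtain D where D: "\<And>i. smooth_fun (D i)"
    "\<And>x. (f has_derivative (\<lambda>h. \<Sum>i\<in>UNIV. h $ i * D i x)) (at x)"
    using smooth_fun_has_derivative[OF Suc.prems] by blast
  have d: "((\<lambda>x. f x *\<^sub>R v) has_derivative (\<lambda>h. (\<Sum>i\<in>UNIV. h $ i * D i x) *\<^sub>R v)) (at x)" for x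
    by (rule has_derivative_scaleR_left[OF D(2)])
  have "frechet_derivative (\<lambda>x. f x *\<^sub>R v) (at x) (axis i 1) = D i x *\<^sub>R v" for x i
  proof -
    have "(\<Sum>j\<in>UNIV. (axis i 1 :: real^'n) $ j * D j x) = (\<Sum>j\<in>UNIV. if j = i then D j x else 0)"
      by (intro sum.cong) (auto simp: axis_def)
    then show ?thesis by (simp add: frechet_derivative_at[OF d, symmetric])
  qed
  then show ?case
    using Suc.IH[OF D(1)] differentiableI[OF d] by simp
qed

text \<open>For a field of constant direction \<open>v\<close> the divergence is the derivative
  along \<open>v\<close>. This links test fields with translations.\<close>

lemma smooth_fun_directional:
  fixes f :: "real^'n \<Rightarrow> real"
  assumes f: "smooth_fun f"
  obtains D where "continuous_on UNIV D" "\<And>x. divergence (\<lambda>x. f x *\<^sub>R v) x = D x"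
    "\<And>x t. ((\<lambda>s. f (x + s *\<^sub>R v)) has_real_derivative D (x + t *\<^sub>R v)) (at t)"
proof -
  obtain D where D: "\<And>i. smooth_fun (D i)"
    "\<And>x. (f has_derivative (\<lambda>h. \<Sum>i\<in>UNIV. h $ i * D i x)) (at x)"
    using smooth_fun_has_derivative[OF f] by blast
  have d: "((\<lambda>x. f x *\<^sub>R v) has_derivative (\<lambda>h. (\<Sum>i\<in>UNIV. h $ i * D i x) *\<^sub>R v)) (at x)" for x
    by (rule has_derivative_scaleR_left[OF D(2)])
  have e: "frechet_derivative (\<lambda>x. f x *\<^sub>R v) (at x) (axis i 1) = D i x *\<^sub>R v" for x i
  proof -
    have "(\<Sum>j\<in>UNIV. (axis i 1 :: real^'n) $ j * D j x) = (\<Sum>j\<in>UNIV. if j = i then D j x else 0)"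
      by (intro sum.cong) (auto simp: axis_def)
    then show ?thesis by (simp add: frechet_derivative_at[OF d, symmetric])
  qed
  define E where "E x = (\<Sum>i\<in>UNIV. v $ i * D i x)" for x
  show ?thesis
  proof
    show "continuous_on UNIV E"
      unfolding E_def by (intro continuous_intros smooth_fun_continuous D)
    show "divergence (\<lambda>x. f x *\<^sub>R v) x = E x" for x
      by (simp add: divergence_def e E_def mult.commute)
    fix x t
    have "((\<lambda>s. x + s *\<^sub>R v) has_derivative (\<lambda>s. s *\<^sub>R v)) (at t)"
      by (auto intro!: derivative_eq_intros)
    from has_derivative_compose[OF this D(2)]
    show "((\<lambda>s. f (x + s *\<^sub>R v)) has_real_derivative E (x + t *\<^sub>R v)) (at t)"
      unfolding has_field_derivative_def
      by (rule has_derivative_eq_rhs) (auto simp: E_def sum_distrib_left sum_distrib_right mult_ac)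
  qed
qed

lemma smooth_fun_test_field:
  fixes f :: "real^'n \<Rightarrow> real"
  assumes "smooth_fun f" "compact (closure {x. f x \<noteq> 0})" "closure {x. f x \<noteq> 0} \<subseteq> S"
  shows "(\<lambda>x. f x *\<^sub>R v) \<in> test_fields S"
proof -
  have sub: "closure {x. f x *\<^sub>R v \<noteq> 0} \<subseteq> closure {x. f x \<noteq> 0}"
    by (intro closure_mono) auto
  then have "compact (closure {x. f x *\<^sub>R v \<noteq> 0})"
    using assms(2) by (metis closed_closure compact_closure compact_imp_bounded bounded_subset closure_closure)
  with sub assms show ?thesis
    by (auto simp: test_fields_def Ck_vf_smooth_fun)
qed

text \<open>The class \<open>smooth_fun\<close> has no quotients, so a sum of bumps cannot be
  normalised to equal 1 on \<open>K\<close>. A power replaces the division: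
  \<open>1 - (1 - \<sigma> x) ^ n\<close> vanishes where \<sigma> does and is uniformly close to 1
  on \<open>K\<close>, where \<sigma> is bounded below. Hence the error \<epsilon> in the
  statement.\<close>

lemma smooth_cutoff:
  fixes K :: "(real^'n) set"
  assumes "compact K" "open U" "K \<subseteq> U" "0 < \<epsilon>"
  obtains f where "smooth_fun f" "\<And>x. 0 \<le> f x" "\<And>x. f x \<le> 1" "\<And>x. x \<in> K \<Longrightarrow> 1 - \<epsilon> \<le> f x"
    "compact (closure {x. f x \<noteq> 0})" "closure {x. f x \<noteq> 0} \<subseteq> U"
proof (cases "K = {}")
  case True
  have "smooth_fun (\<lambda>x::real^'n. 0)" by (rule smooth_fun.const)
  then show ?thesis using that[of "\<lambda>x. 0"] True by simp
next
  case False
  have "\<exists>r>0. cball x r \<subseteq> U" if "x \<in> K" for x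
    using that assms(2,3) open_contains_cball by blast
  then obtain r where r: "\<And>x. x \<in> K \<Longrightarrow> 0 < r x" "\<And>x. x \<in> K \<Longrightarrow> cball x (r x) \<subseteq> U" by metis
  have "K \<subseteq> (\<Union>x\<in>K. ball x (r x))" using r(1) by force
  then obtain F where F: "F \<subseteq> K" "finite F" "K \<subseteq> (\<Union>x\<in>F. ball x (r x))"
    using compactE_image[OF assms(1), of K "\<lambda>x. ball x (r x)"] by auto
  define b where "b a x = flat_exp 0 ((r a)\<^sup>2 - (x - a) \<bullet> (x - a))" for a x :: "real^'n"
  \<comment> \<open>Dividing by \<open>card F + 1\<close> keeps \<sigma> at most 1, so that the
    powers of \<open>1 - \<sigma> x\<close> stay between 0 and 1.\<close>
  define \<sigma> where "\<sigma> x = (1 / (real (card F) + 1)) * (\<Sum>a\<in>F. b a x)" for x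
  have b01: "0 \<le> b a x" "b a x \<le> 1" for a x by (auto simp: b_def flat_exp_def)
  have bpos: "0 < b a x \<longleftrightarrow> dist a x < r a" if "a \<in> K" for a x
    using r(1)[OF that] by (auto simp: b_def flat_exp_def dist_norm norm_minus_commute
        power2_norm_eq_inner[symmetric] intro: power_less_imp_less_base power_strict_mono)
  have s\<sigma>: "smooth_fun \<sigma>" unfolding \<sigma>_def b_def
    by (intro smooth_fun_cmult smooth_fun_sum smooth_fun.germ F)
  have \<sigma>0: "0 \<le> \<sigma> x" for x unfolding \<sigma>_def by (simp add: sum_nonneg b01)
  have \<sigma>1: "\<sigma> x \<le> 1" for x
  proof -
    have "(\<Sum>a\<in>F. b a x) \<le> real (card F)"
      using sum_mono[of F "\<lambda>a. b a x" "\<lambda>_. 1"] b01 by simp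
    then show ?thesis by (simp add: \<sigma>_def)
  qed
  have \<sigma>pos: "0 < \<sigma> x" if "x \<in> K" for x
  proof -
    obtain a where a: "a \<in> F" "dist a x < r a" using F(3) \<open>x \<in> K\<close> by force
    then have "0 < (\<Sum>a\<in>F. b a x)"
      using F(1,2) bpos[of a x] by (intro sum_pos2[of F a]) (auto simp: b01)
    then show ?thesis unfolding \<sigma>_def by (intro mult_pos_pos) auto
  qed
  obtain z where z: "z \<in> K" "\<And>x. x \<in> K \<Longrightarrow> \<sigma> z \<le> \<sigma> x"
    using continuous_attains_inf[OF assms(1) False smooth_fun_continuous[OF s\<sigma>]] by blast
  obtain n where n: "(1 - \<sigma> z) ^ n < \<epsilon>"
    using real_arch_pow_inv[OF assms(4), of "1 - \<sigma> z"] \<sigma>pos[OF z(1)] by auto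
  define f where "f x = 1 - (1 - \<sigma> x) ^ n" for x
  have supp: "{x. f x \<noteq> 0} \<subseteq> (\<Union>a\<in>F. cball a (r a))"
  proof
    fix x assume "x \<in> {x. f x \<noteq> 0}"
    then have "\<sigma> x \<noteq> 0" by (auto simp: f_def)
    then obtain a where "a \<in> F" "b a x \<noteq> 0" unfolding \<sigma>_def by (metis mult_zero_right sum.neutral)
    then show "x \<in> (\<Union>a\<in>F. cball a (r a))" using bpos[of a x] b01[of a x] F(1) by force
  qed
  have cu: "compact (\<Union>a\<in>F. cball a (r a))" using F(2) by (intro compact_UN) auto
  have cs: "closure {x. f x \<noteq> 0} \<subseteq> (\<Union>a\<in>F. cball a (r a))"
    using closure_minimal[OF supp compact_imp_closed[OF cu]] .
  show ?thesis
  proof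
    show "smooth_fun f" unfolding f_def
      by (intro smooth_fun_diff smooth_fun_power smooth_fun.const s\<sigma>)
    show "0 \<le> f x" "f x \<le> 1" for x
      using \<sigma>0[of x] \<sigma>1[of x] by (auto simp: f_def power_le_one)
    show "1 - \<epsilon> \<le> f x" if "x \<in> K" for x
    proof -
      have "(1 - \<sigma> x) ^ n \<le> (1 - \<sigma> z) ^ n" using z(2)[OF that] \<sigma>1[of x] by (intro power_mono) auto
      with n show ?thesis by (simp add: f_def)
    qed
    show "compact (closure {x. f x \<noteq> 0})"
      using compact_Int_closed[OF cu closed_closure, of "{x. f x \<noteq> 0}"] cs by (simp add: Int_absorb1)
    show "closure {x. f x \<noteq> 0} \<subseteq> U" using cs r(2) F(1) by fast
  qed
qed

section \<open>Translations, inner regularity and duality for the L1 norm\<close>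

lemma nn_integral_lborel_shift:
  fixes f :: "'a::euclidean_space \<Rightarrow> ennreal"
  assumes [measurable]: "f \<in> borel_measurable borel"
  shows "(\<integral>\<^sup>+x. f (x + a) \<partial>lborel) = (\<integral>\<^sup>+x. f x \<partial>lborel)"
proof -
  have "(\<integral>\<^sup>+x. f x \<partial>lborel) = (\<integral>\<^sup>+x. f x \<partial>(distr lborel borel ((+) a)))"
    by (simp add: lborel_distr_plus)
  also have "\<dots> = (\<integral>\<^sup>+x. f (x + a) \<partial>lborel)"
    by (subst nn_integral_distr) (auto simp: add.commute)
  finally show ?thesis by simp
qed

lemma integral_lborel_shift:
  fixes f :: "'a::euclidean_space \<Rightarrow> real"
  assumes [measurable]: "f \<in> borel_measurable borel"
  shows "(\<integral>x. f (x + a) \<partial>lborel) = (\<integral>x. f x \<partial>lborel)"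
proof -
  have "(\<integral>x. f x \<partial>lborel) = (\<integral>x. f x \<partial>(distr lborel borel ((+) a)))"
    by (simp add: lborel_distr_plus)
  also have "\<dots> = (\<integral>x. f (x + a) \<partial>lborel)"
    by (subst integral_distr) (auto simp: add.commute)
  finally show ?thesis by simp
qed

lemma integrable_lborel_shift:
  fixes f :: "'a::euclidean_space \<Rightarrow> real"
  assumes f: "integrable lborel f"
  shows "integrable lborel (\<lambda>x. f (x + a))"
proof -
  have [measurable]: "f \<in> borel_measurable borel" using borel_measurable_integrable[OF f] by simp
  have "integrable (distr lborel borel ((+) a)) f"
    using f by (simp add: lborel_distr_plus)
  then show ?thesis
    by (subst (asm) integrable_distr_eq) (auto simp: add.commute)
qed

lemma integrable_mult_bounded:
  fixes g f :: "'a \<Rightarrow> real"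
  assumes g: "integrable M g" and [measurable]: "f \<in> borel_measurable M"
    and B: "\<And>x. \<bar>f x\<bar> \<le> B"
  shows "integrable M (\<lambda>x. g x * f x)"
proof (rule Bochner_Integration.integrable_bound)
  show "integrable M (\<lambda>x. B * g x)" using g by simp
  show "(\<lambda>x. g x * f x) \<in> borel_measurable M"
    using borel_measurable_integrable[OF g] by measurable
  have "\<bar>g x * f x\<bar> \<le> \<bar>B * g x\<bar>" for x
    using mult_right_mono[OF order_trans[OF B[of x] abs_ge_self[of B]], of "\<bar>g x\<bar>"]
    by (simp add: abs_mult mult.commute)
  then show "AE x in M. norm (g x * f x) \<le> norm (B * g x)" by simp
qed

lemma integrable_indicator_abs:
  fixes w :: "'a::euclidean_space \<Rightarrow> real"
  assumes "integrable lborel w" "B \<in> sets borel"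
  shows "integrable lborel (\<lambda>x. indicator B x * \<bar>w x\<bar>)"
  using integrable_mult_bounded[of lborel "\<lambda>x. \<bar>w x\<bar>" "indicator B" 1] assms
  by (simp add: mult.commute indicator_def)

text \<open>This is inner regularity of the finite Borel measure with density |w|.\<close>

lemma integrable_inner_compact:
  fixes w :: "'a::euclidean_space \<Rightarrow> real"
  assumes w: "integrable lborel w" and P: "P \<in> sets borel" and "0 < \<epsilon>"
  obtains K where "compact K" "K \<subseteq> P" "(\<integral>x. indicator (P - K) x * \<bar>w x\<bar> \<partial>lborel) \<le> \<epsilon>"
proof -
  have [measurable]: "w \<in> borel_measurable borel" using borel_measurable_integrable[OF w] by simp
  define \<mu> where "\<mu> = density lborel (\<lambda>x. ennreal \<bar>w x\<bar>)"
  note I = integrable_indicator_abs[OF w]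
  have em: "emeasure \<mu> B = ennreal (\<integral>x. indicator B x * \<bar>w x\<bar> \<partial>lborel)" if "B \<in> sets borel" for B
  proof -
    have "emeasure \<mu> B = (\<integral>\<^sup>+x. ennreal (indicator B x * \<bar>w x\<bar>) \<partial>lborel)"
      unfolding \<mu>_def using that
      by (subst emeasure_density) (auto intro!: nn_integral_cong simp: indicator_def)
    also have "\<dots> = ennreal (\<integral>x. indicator B x * \<bar>w x\<bar> \<partial>lborel)"
      by (rule nn_integral_eq_integral[OF I[OF that]]) auto
    finally show ?thesis .
  qed
  have sm: "sets \<mu> = sets borel" by (simp add: \<mu>_def)
  have "space \<mu> = UNIV" by (simp add: \<mu>_def)
  then have fin: "emeasure \<mu> (space \<mu>) \<noteq> \<infinity>" by (simp add: em)
  let ?m = "\<lambda>B. \<integral>x. indicator B x * \<bar>w x\<bar> \<partial>lborel"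
  have nonneg: "0 \<le> ?m B" for B by (intro integral_nonneg_AE) auto
  have SUP: "emeasure \<mu> P = (SUP K \<in> {K. K \<subseteq> P \<and> compact K}. emeasure \<mu> K)"
    using inner_regular[OF sm fin, of P] P sm by simp
  have "\<exists>K. K \<subseteq> P \<and> compact K \<and> ?m P \<le> ?m K + \<epsilon>"
  proof (rule ccontr)
    assume "\<not> ?thesis"
    then have *: "?m K \<le> ?m P - \<epsilon>" if "K \<subseteq> P" "compact K" for K using that by force
    have "emeasure \<mu> P \<le> ennreal (?m P - \<epsilon>)"
      unfolding SUP
    proof (rule SUP_least)
      fix K assume "K \<in> {K. K \<subseteq> P \<and> compact K}"
      then show "emeasure \<mu> K \<le> ennreal (?m P - \<epsilon>)"
        using *[of K] by (subst em) (auto simp: borel_compact intro: ennreal_leI)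
    qed
    then have "ennreal (?m P) \<le> ennreal (?m P - \<epsilon>)" using em[OF P] by simp
    moreover have "0 \<le> ?m P - \<epsilon>" using *[of "{}"] nonneg[of "{}"] by simp
    ultimately show False using \<open>0 < \<epsilon>\<close> by (simp add: ennreal_le_iff)
  qed
  then obtain K where K: "K \<subseteq> P" "compact K" "?m P \<le> ?m K + \<epsilon>" by blast
  have "?m (P - K) = (\<integral>x. indicator P x * \<bar>w x\<bar> - indicator K x * \<bar>w x\<bar> \<partial>lborel)"
    using K(1) by (intro Bochner_Integration.integral_cong) (auto simp: indicator_def)
  also have "\<dots> = ?m P - ?m K"
    by (intro Bochner_Integration.integral_diff I P borel_compact K)
  finally show ?thesis using that[of K] K by simp
qed

text \<open>An almost optimal dual function is close to 1 on most of {w > 0} and to -1 on most of {w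
  < 0}. Inner regularity supplies compact parts of both sets. Each cut-off is supported away from
  the other compact set, so that their difference has the right values on both.\<close>

lemma L1_norm_le_dual:
  fixes w :: "real^'n \<Rightarrow> real"
  assumes w: "integrable lborel w" and S: "open S"
    and dual: "\<And>f. smooth_fun f \<Longrightarrow> compact (closure {x. f x \<noteq> 0}) \<Longrightarrow> closure {x. f x \<noteq> 0} \<subseteq> S
      \<Longrightarrow> (\<And>x. \<bar>f x\<bar> \<le> 1) \<Longrightarrow> (\<integral>x. w x * f x \<partial>lborel) \<le> c"
  shows "(\<integral>x. indicator S x * \<bar>w x\<bar> \<partial>lborel) \<le> c"
proof (rule field_le_epsilon)
  fix \<epsilon> :: real assume "0 < \<epsilon>"
  have [measurable]: "w \<in> borel_measurable borel" using borel_measurable_integrable[OF w] by simp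
  have [measurable]: "S \<in> sets borel" using S by simp
  define W where "W = (\<integral>x. \<bar>w x\<bar> \<partial>lborel)"
  have W: "0 \<le> W" unfolding W_def by (intro integral_nonneg_AE) auto
  \<comment> \<open>The total error is \<open>\<delta> * W\<close>, from cut-offs that reach only
    \<open>1 - \<delta>\<close>, plus \<open>4 * \<delta>\<close>, from the two leftover sets, each
    of mass at most \<delta>, where |w| may exceed \<open>w x * f x\<close> by 2 |w|.\<close>
  define \<delta> where "\<delta> = \<epsilon> / (W + 4)"
  have \<delta>: "0 < \<delta>" using \<open>0 < \<epsilon>\<close> W by (simp add: \<delta>_def)
  define P where "P = {x \<in> S. 0 < w x}"
  define Q where "Q = {x \<in> S. w x < 0}"
  have [measurable]: "P \<in> sets borel" "Q \<in> sets borel" unfolding P_def Q_def by measurable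
  obtain K1 where K1: "compact K1" "K1 \<subseteq> P" "(\<integral>x. indicator (P - K1) x * \<bar>w x\<bar> \<partial>lborel) \<le> \<delta>"
    using integrable_inner_compact[OF w _ \<delta>, of P] by auto
  obtain K2 where K2: "compact K2" "K2 \<subseteq> Q" "(\<integral>x. indicator (Q - K2) x * \<bar>w x\<bar> \<partial>lborel) \<le> \<delta>"
    using integrable_inner_compact[OF w _ \<delta>, of Q] by auto
  have [measurable]: "K1 \<in> sets borel" "K2 \<in> sets borel" using K1 K2 by (auto intro: borel_compact)
  have PQ: "P \<inter> Q = {}" "P \<subseteq> S" "Q \<subseteq> S" by (auto simp: P_def Q_def)
  have "open (S - K2)" "K1 \<subseteq> S - K2" "open (S - K1)" "K2 \<subseteq> S - K1"
    using K1(1,2) K2(1,2) PQ S by (auto intro!: open_Diff compact_imp_closed)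
  then obtain f1 f2 where
    f1: "smooth_fun f1" "\<And>x. 0 \<le> f1 x" "\<And>x. f1 x \<le> 1" "\<And>x. x \<in> K1 \<Longrightarrow> 1 - \<delta> \<le> f1 x"
      "compact (closure {x. f1 x \<noteq> 0})" "closure {x. f1 x \<noteq> 0} \<subseteq> S - K2" and
    f2: "smooth_fun f2" "\<And>x. 0 \<le> f2 x" "\<And>x. f2 x \<le> 1" "\<And>x. x \<in> K2 \<Longrightarrow> 1 - \<delta> \<le> f2 x"
      "compact (closure {x. f2 x \<noteq> 0})" "closure {x. f2 x \<noteq> 0} \<subseteq> S - K1"
    using smooth_cutoff[OF K1(1) _ _ \<delta>] smooth_cutoff[OF K2(1) _ _ \<delta>] by metis
  define f where "f x = f1 x - f2 x" for x
  have sf: "smooth_fun f" unfolding f_def by (intro smooth_fun_diff f1 f2)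
  have "closure {x. f x \<noteq> 0} \<subseteq> closure ({x. f1 x \<noteq> 0} \<union> {x. f2 x \<noteq> 0})"
    by (intro closure_mono) (auto simp: f_def)
  then have cl: "closure {x. f x \<noteq> 0} \<subseteq> closure {x. f1 x \<noteq> 0} \<union> closure {x. f2 x \<noteq> 0}"
    by simp
  have fb: "\<bar>f x\<bar> \<le> 1" for x using f1(2,3)[of x] f2(2,3)[of x] by (auto simp: f_def)
  have le: "(\<integral>x. w x * f x \<partial>lborel) \<le> c"
  proof (rule dual[OF sf])
    show "compact (closure {x. f x \<noteq> 0})"
      using compact_Int_closed[OF compact_Un[OF f1(5) f2(5)] closed_closure, of "{x. f x \<noteq> 0}"] cl
      by (simp add: Int_absorb1)
    show "closure {x. f x \<noteq> 0} \<subseteq> S" using cl f1(6) f2(6) by blast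
  qed (rule fb)
  have z1: "f1 x = 0" if "x \<in> K2 \<or> x \<notin> S" for x
    using f1(6) closure_subset[of "{x. f1 x \<noteq> 0}"] that by blast
  have z2: "f2 x = 0" if "x \<in> K1 \<or> x \<notin> S" for x
    using f2(6) closure_subset[of "{x. f2 x \<noteq> 0}"] that by blast
  have pw: "indicator S x * \<bar>w x\<bar> \<le> w x * f x + \<delta> * \<bar>w x\<bar>
    + (2 * (indicator (P - K1) x * \<bar>w x\<bar>) + 2 * (indicator (Q - K2) x * \<bar>w x\<bar>))" for x
  proof -
    have b: "\<bar>w x * f x\<bar> \<le> \<bar>w x\<bar>" using mult_left_mono[OF fb[of x], of "\<bar>w x\<bar>"] by (simp add: abs_mult)
    have d: "0 \<le> \<delta> * \<bar>w x\<bar>" using \<delta> by simp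
    consider "x \<in> K1" | "x \<in> K2" | "x \<in> P - K1" | "x \<in> Q - K2" | "x \<in> S" "w x = 0" | "x \<notin> S"
      by (force simp: P_def Q_def)
    then show ?thesis
    proof cases
      case 1
      then have "0 < w x" "x \<in> P" "x \<in> S" "x \<notin> Q" using K1(2) by (auto simp: P_def Q_def)
      moreover have "w x * (1 - \<delta>) \<le> w x * f x"
        using f1(4)[OF 1] z2 1 \<open>0 < w x\<close> by (auto simp: f_def)
      ultimately show ?thesis using 1 by (simp add: algebra_simps)
    next
      case 2
      then have "w x < 0" "x \<in> Q" "x \<in> S" "x \<notin> P" using K2(2) by (auto simp: P_def Q_def)
      moreover have "w x * (\<delta> - 1) \<le> w x * f x"
        using f2(4)[OF 2] z1 2 \<open>w x < 0\<close>
        by (intro mult_left_mono_neg) (auto simp: f_def)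
      ultimately show ?thesis using 2 by (simp add: algebra_simps)
    next
      case 3 then show ?thesis using b d PQ by (auto simp: indicator_def)
    next
      case 4 then show ?thesis using b d PQ by (auto simp: indicator_def)
    next
      case 5 then show ?thesis by simp
    next
      case 6 then show ?thesis using z1 z2 d by (auto simp: f_def indicator_def)
    qed
  qed
  note I = integrable_indicator_abs[OF w]
  have If: "integrable lborel (\<lambda>x. w x * f x)"
    by (rule integrable_mult_bounded[OF w _ fb])
      (simp add: borel_measurable_continuous_onI smooth_fun_continuous sf)
  have "(\<integral>x. indicator S x * \<bar>w x\<bar> \<partial>lborel) \<le> (\<integral>x. w x * f x + \<delta> * \<bar>w x\<bar>
    + (2 * (indicator (P - K1) x * \<bar>w x\<bar>) + 2 * (indicator (Q - K2) x * \<bar>w x\<bar>)) \<partial>lborel)"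
    by (rule integral_mono) (use pw in \<open>auto intro!: Bochner_Integration.integrable_add integrable_mult_right I If w integrable_abs\<close>)
  also have "\<dots> = (\<integral>x. w x * f x \<partial>lborel) + \<delta> * W
    + (2 * (\<integral>x. indicator (P - K1) x * \<bar>w x\<bar> \<partial>lborel) + 2 * (\<integral>x. indicator (Q - K2) x * \<bar>w x\<bar> \<partial>lborel))"
    unfolding W_def using w
    by (simp add: I If Bochner_Integration.integral_add)
  also have "\<dots> \<le> c + \<delta> * W + (2 * \<delta> + 2 * \<delta>)"
    using le K1(3) K2(3) by linarith
  also have "\<dots> = c + \<delta> * (W + 4)" by (simp add: algebra_simps)
  also have "\<dots> = c + \<epsilon>" using W by (simp add: \<delta>_def)
  finally show "(\<integral>x. indicator S x * \<bar>w x\<bar> \<partial>lborel) \<le> c + \<epsilon>" .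
qed

text \<open>The translation acts on the smooth factor, so \<open>g\<close> may be merely integrable.
  The bound on the derivative \<open>D\<close> dominates the difference quotients by
  \<open>C\<close> times |g|.\<close>

lemma has_derivative_integral_shift:
  fixes g f D :: "real^'n \<Rightarrow> real"
  assumes g: "integrable lborel g"
    and f: "continuous_on UNIV f" "\<And>x. \<bar>f x\<bar> \<le> B"
    and D: "continuous_on UNIV D" "\<And>x. \<bar>D x\<bar> \<le> C"
    and deriv: "\<And>x t. ((\<lambda>s. f (x + s *\<^sub>R v)) has_real_derivative D (x + t *\<^sub>R v)) (at t)"
  shows "((\<lambda>s. \<integral>x. g x * f (x + s *\<^sub>R v) \<partial>lborel) has_real_derivative
    (\<integral>x. g x * D (x + t *\<^sub>R v) \<partial>lborel)) (at t)"
  unfolding has_field_derivative_iff tendsto_at_iff_sequentially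
proof (intro allI impI)
  fix X :: "nat \<Rightarrow> real" assume X: "\<forall>i. X i \<in> UNIV - {t}" "X \<longlonglongrightarrow> t"
  have [measurable]: "g \<in> borel_measurable borel" "f \<in> borel_measurable borel" "D \<in> borel_measurable borel"
    using borel_measurable_integrable[OF g] f D by (auto intro: borel_measurable_continuous_onI)
  let ?q = "\<lambda>i x. g x * ((f (x + X i *\<^sub>R v) - f (x + t *\<^sub>R v)) / (X i - t))"
  have int: "integrable lborel (\<lambda>x. g x * f (x + s *\<^sub>R v))" for s
    by (rule integrable_mult_bounded[OF g _ f(2)]) measurable
  have bound: "\<bar>f (x + X i *\<^sub>R v) - f (x + t *\<^sub>R v)\<bar> \<le> C * \<bar>X i - t\<bar>" for x i
    using field_differentiable_bound[of UNIV "\<lambda>s. f (x + s *\<^sub>R v)" "\<lambda>t. D (x + t *\<^sub>R v)" C "X i" t]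
      deriv D(2) by simp
  have "(\<lambda>i. \<integral>x. ?q i x \<partial>lborel) \<longlonglongrightarrow> (\<integral>x. g x * D (x + t *\<^sub>R v) \<partial>lborel)"
  proof (rule integral_dominated_convergence[where w = "\<lambda>x. \<bar>g x\<bar> * C"])
    show "integrable lborel (\<lambda>x. \<bar>g x\<bar> * C)" using g by simp
    show "AE x in lborel. (\<lambda>i. ?q i x) \<longlonglongrightarrow> g x * D (x + t *\<^sub>R v)"
    proof (intro AE_I2 tendsto_mult_left)
      fix x
      show "(\<lambda>i. (f (x + X i *\<^sub>R v) - f (x + t *\<^sub>R v)) / (X i - t)) \<longlonglongrightarrow> D (x + t *\<^sub>R v)"
        using deriv[of x t] X unfolding has_field_derivative_iff tendsto_at_iff_sequentially comp_def
        by blast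
    qed
    show "AE x in lborel. norm (?q i x) \<le> \<bar>g x\<bar> * C" for i
    proof (intro AE_I2)
      fix x
      have "\<bar>(f (x + X i *\<^sub>R v) - f (x + t *\<^sub>R v)) / (X i - t)\<bar> \<le> C"
        using bound[of x i] X(1) by (simp add: abs_divide divide_le_eq)
      then show "norm (?q i x) \<le> \<bar>g x\<bar> * C" unfolding real_norm_def abs_mult by (rule mult_left_mono) simp
    qed
  qed measurable
  moreover have "(\<integral>x. ?q i x \<partial>lborel) = ((\<integral>x. g x * f (x + X i *\<^sub>R v) \<partial>lborel)
      - (\<integral>x. g x * f (x + t *\<^sub>R v) \<partial>lborel)) / (X i - t)" for i
    by (subst Bochner_Integration.integral_diff[OF int int, symmetric],
        subst integral_divide_zero[symmetric]) (simp add: algebra_simps diff_divide_distrib)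
  ultimately show "((\<lambda>y. ((\<integral>x. g x * f (x + y *\<^sub>R v) \<partial>lborel)
      - (\<integral>x. g x * f (x + t *\<^sub>R v) \<partial>lborel)) / (y - t)) \<circ> X) \<longlonglongrightarrow> (\<integral>x. g x * D (x + t *\<^sub>R v) \<partial>lborel)"
    by (simp only: comp_def)
qed

lemma derivative_zero_outside_support:
  fixes f :: "'a::real_normed_vector \<Rightarrow> real"
  assumes d: "((\<lambda>s. f (x + s *\<^sub>R v)) has_real_derivative d) (at 0)"
    and x: "x \<notin> closure {x. f x \<noteq> 0}"
  shows "d = 0"
proof -
  have "open ((\<lambda>s. x + s *\<^sub>R v) -` (- closure {x. f x \<noteq> 0}))"
    by (intro open_vimage continuous_intros) auto
  moreover have "0 \<in> (\<lambda>s. x + s *\<^sub>R v) -` (- closure {x. f x \<noteq> 0})" using x by simp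
  ultimately have "\<forall>\<^sub>F s in nhds 0. s \<in> (\<lambda>s. x + s *\<^sub>R v) -` (- closure {x. f x \<noteq> 0})"
    by (rule eventually_nhds_in_open)
  then have "\<forall>\<^sub>F s in nhds 0. f (x + s *\<^sub>R v) = 0"
    by (rule eventually_mono) (use closure_subset in force)
  then have "((\<lambda>s. f (x + s *\<^sub>R v)) has_real_derivative d) (at 0) \<longleftrightarrow> ((\<lambda>s. 0) has_real_derivative d) (at 0)"
    by (intro DERIV_cong_ev) auto
  with d have "((\<lambda>s. 0) has_real_derivative d) (at (0::real))" by simp
  then show ?thesis using DERIV_unique[OF _ DERIV_const] by blast
qed

lemma bounded_of_compact_support:
  fixes D :: "'a::topological_space \<Rightarrow> real"
  assumes "continuous_on UNIV D" "compact K" "\<And>x. x \<notin> K \<Longrightarrow> D x = 0"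
  obtains B where "\<And>x. \<bar>D x\<bar> \<le> B"
proof -
  have "compact (D ` K)" using assms continuous_on_subset by (blast intro: compact_continuous_image)
  then obtain B where "\<And>y. y \<in> D ` K \<Longrightarrow> norm y \<le> B" using compact_imp_bounded bounded_iff by metis
  then have "\<bar>D x\<bar> \<le> \<bar>B\<bar>" for x using assms(3)[of x] by (cases "x \<in> K") force+
  then show ?thesis using that by blast
qed

section \<open>Variation versus difference quotients\<close>

text \<open>These are the base points at which variation inside \<open>V\<close> controls the
  increment by \<open>k\<close>. It is not enough that both endpoints lie in \<open>V\<close>: the
  whole segment must.\<close>

definition seg_core :: "'a::real_vector \<Rightarrow> 'a set \<Rightarrow> 'a set" where
  "seg_core k V = {y. \<forall>s\<in>{0..1}. y + s *\<^sub>R k \<in> V}"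

text \<open>The complement is the Minkowski difference of the closed set \<open>- V\<close> and a
  compact segment, hence closed.\<close>

lemma open_seg_core:
  fixes V :: "'a::euclidean_space set"
  assumes "open V"
  shows "open (seg_core k V)"
proof -
  have "compact ((\<lambda>s. s *\<^sub>R k) ` {0..1::real})"
    by (intro compact_continuous_image continuous_intros) auto
  then have "closed (\<Union>x\<in>- V. \<Union>y\<in>(\<lambda>s. s *\<^sub>R k) ` {0..1::real}. {x - y})"
    using assms by (intro closed_compact_differences) auto
  moreover have "- seg_core k V = (\<Union>x\<in>- V. \<Union>y\<in>(\<lambda>s. s *\<^sub>R k) ` {0..1::real}. {x - y})"
  proof (intro set_eqI iffI)
    fix y assume "y \<in> - seg_core k V"
    then obtain s where "s \<in> {0..1}" "y + s *\<^sub>R k \<notin> V" by (auto simp: seg_core_def)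
    then show "y \<in> (\<Union>x\<in>- V. \<Union>y\<in>(\<lambda>s. s *\<^sub>R k) ` {0..1::real}. {x - y})"
      by (intro UN_I[of "y + s *\<^sub>R k"] UN_I[of "s *\<^sub>R k"]) auto
  next
    fix y assume "y \<in> (\<Union>x\<in>- V. \<Union>y\<in>(\<lambda>s. s *\<^sub>R k) ` {0..1::real}. {x - y})"
    then obtain x s where "x \<notin> V" "s \<in> {0..1}" "y = x - s *\<^sub>R k" by auto
    then have "s \<in> {0..1} \<and> y + s *\<^sub>R k \<notin> V" by simp
    then show "y \<in> - seg_core k V" unfolding seg_core_def by blast
  qed
  ultimately have "closed (- seg_core k V)" by (simp only:)
  then show ?thesis by (simp only: open_closed)
qed

text \<open>By duality the increment is paired with a smooth \<open>f\<close> supported in the core.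
  Moving the translation onto \<open>f\<close> gives \<open>H l - H 0\<close>. The mean value
  theorem turns this into \<open>norm k\<close> times a single derivative, which is the pairing of
  \<open>g\<close> with the divergence of a translate of \<open>f x *\<^sub>R e\<close>, a test
  field in \<open>V\<close>.\<close>

lemma difference_bound_of_variation:
  fixes g :: "real^'n \<Rightarrow> real"
  assumes g: "integrable lborel g" and V: "open V"
    and var: "\<And>\<phi>. \<phi> \<in> test_fields V \<Longrightarrow> (\<And>x. norm (\<phi> x) \<le> 1) \<Longrightarrow>
      (\<integral>x. g x * divergence \<phi> x \<partial>lborel) \<le> c"
  shows "(\<integral>x. indicator (seg_core k V) x * \<bar>g (x + k) - g x\<bar> \<partial>lborel) \<le> c * norm k"
proof (cases "k = 0")
  case True
  then show ?thesis by simp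
next
  case False
  have [measurable]: "g \<in> borel_measurable borel" using borel_measurable_integrable[OF g] by simp
  \<comment> \<open>The sign is reversed because an increment of \<open>g\<close> by
    \<open>k\<close> becomes a translation of \<open>f\<close> by \<open>- k\<close>, that is by
    \<open>l *\<^sub>R e\<close>.\<close>
  define e where "e = - (k /\<^sub>R norm k)"
  define l where "l = norm k"
  have l: "0 < l" and ne: "norm e = 1" and k: "k = - l *\<^sub>R e"
    using False by (auto simp: l_def e_def)
  show ?thesis
  proof (rule L1_norm_le_dual)
    show "integrable lborel (\<lambda>x. g (x + k) - g x)"
      by (intro Bochner_Integration.integrable_diff g integrable_lborel_shift)
    show "open (seg_core k V)" by (rule open_seg_core[OF V])
    fix f :: "real^'n \<Rightarrow> real"
    assume sf: "smooth_fun f" and cs: "compact (closure {x. f x \<noteq> 0})"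
      and sub: "closure {x. f x \<noteq> 0} \<subseteq> seg_core k V" and f1: "\<And>x. \<bar>f x\<bar> \<le> 1"
    have cf: "continuous_on UNIV f" by (rule smooth_fun_continuous[OF sf])
    have [measurable]: "f \<in> borel_measurable borel" using cf by (rule borel_measurable_continuous_onI)
    obtain D where D: "continuous_on UNIV D"
      "\<And>x t. ((\<lambda>s. f (x + s *\<^sub>R e)) has_real_derivative D (x + t *\<^sub>R e)) (at t)"
      using smooth_fun_directional[OF sf] by metis
    have "D x = 0" if "x \<notin> closure {x. f x \<noteq> 0}" for x
      using derivative_zero_outside_support[OF _ that, of e "D x"] D(2)[of x 0] by simp
    then obtain C where C: "\<And>x. \<bar>D x\<bar> \<le> C"
      using bounded_of_compact_support[OF D(1) cs] by metis
    define H where "H s = (\<integral>x. g x * f (x + s *\<^sub>R e) \<partial>lborel)" for s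
    have H': "(H has_real_derivative (\<integral>x. g x * D (x + s *\<^sub>R e) \<partial>lborel)) (at s)" for s
      unfolding H_def by (rule has_derivative_integral_shift[OF g cf f1 D(1) C D(2)])
    obtain z where z: "0 < z" "z < l" "H l - H 0 = (l - 0) * (\<integral>x. g x * D (x + z *\<^sub>R e) \<partial>lborel)"
      using MVT2[OF l, of H "\<lambda>s. \<integral>x. g x * D (x + s *\<^sub>R e) \<partial>lborel"] H' by blast
    have sfz: "smooth_fun (\<lambda>x. f (x + z *\<^sub>R e))"
      using smooth_fun_shift[OF sf, of "- z *\<^sub>R e"] by simp
    obtain Dz where Dz: "\<And>x. divergence (\<lambda>x. f (x + z *\<^sub>R e) *\<^sub>R e) x = Dz x"
      "\<And>x t. ((\<lambda>s. f (x + s *\<^sub>R e + z *\<^sub>R e)) has_real_derivative Dz (x + t *\<^sub>R e)) (at t)"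
      by (rule smooth_fun_directional[OF sfz, of e]) blast
    have Dz_eq: "Dz x = D (x + z *\<^sub>R e)" for x
    proof -
      have "(\<lambda>s. f (x + s *\<^sub>R e + z *\<^sub>R e)) = (\<lambda>s. f (x + z *\<^sub>R e + s *\<^sub>R e))"
        by (simp add: add_ac)
      then have "((\<lambda>s. f (x + z *\<^sub>R e + s *\<^sub>R e)) has_real_derivative Dz x) (at 0)"
        using Dz(2)[of x 0] by (simp only: scaleR_zero_left add_0_right)
      moreover have "((\<lambda>s. f (x + z *\<^sub>R e + s *\<^sub>R e)) has_real_derivative D (x + z *\<^sub>R e)) (at 0)"
        using D(2)[of "x + z *\<^sub>R e" 0] by (simp only: scaleR_zero_left add_0_right)
      ultimately show ?thesis by (rule DERIV_unique)
    qed
    have cl: "closure {x. f (x + z *\<^sub>R e) \<noteq> 0} = (+) (- z *\<^sub>R e) ` closure {x. f x \<noteq> 0}"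
    proof -
      have "{x. f (x + z *\<^sub>R e) \<noteq> 0} = (+) (- z *\<^sub>R e) ` {x. f x \<noteq> 0}"
      proof (intro set_eqI iffI)
        fix x assume "x \<in> {x. f (x + z *\<^sub>R e) \<noteq> 0}"
        then show "x \<in> (+) (- z *\<^sub>R e) ` {x. f x \<noteq> 0}"
          by (intro image_eqI[of _ _ "x + z *\<^sub>R e"]) auto
      qed auto
      then show ?thesis using closure_translation[of "- z *\<^sub>R e" "{x. f x \<noteq> 0}"] by simp
    qed
    have "(\<integral>x. g x * divergence (\<lambda>x. f (x + z *\<^sub>R e) *\<^sub>R e) x \<partial>lborel) \<le> c"
    proof (rule var)
      show "(\<lambda>x. f (x + z *\<^sub>R e) *\<^sub>R e) \<in> test_fields V"
      proof (rule smooth_fun_test_field[OF sfz])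
        show "compact (closure {x. f (x + z *\<^sub>R e) \<noteq> 0})"
          unfolding cl using cs by (rule compact_translation)
        show "closure {x. f (x + z *\<^sub>R e) \<noteq> 0} \<subseteq> V"
        proof
          fix y assume "y \<in> closure {x. f (x + z *\<^sub>R e) \<noteq> 0}"
          then obtain x where x: "x \<in> seg_core k V" "y = - z *\<^sub>R e + x" unfolding cl using sub by auto
          \<comment> \<open>The support of \<open>f\<close> is displaced by the fraction
            \<open>z / l\<close> of \<open>k\<close>, hence along a segment that starts in the core
            and stays in \<open>V\<close>.\<close>
          have "z / l \<in> {0..1}" using z l by auto
          then have "x + (z / l) *\<^sub>R k \<in> V" using x(1) by (auto simp: seg_core_def)
          then show "y \<in> V" using l x(2) by (simp add: k)
        qed
      qed
      show "norm (f (x + z *\<^sub>R e) *\<^sub>R e) \<le> 1" for x using f1 by (simp add: ne)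
    qed
    then have "(\<integral>x. g x * D (x + z *\<^sub>R e) \<partial>lborel) \<le> c" unfolding Dz(1) Dz_eq .
    then have le: "H l - H 0 \<le> l * c" using z(3) l by simp
    have i1: "integrable lborel (\<lambda>x. g (x + k) * f x)"
      by (rule integrable_mult_bounded[OF integrable_lborel_shift[OF g] _ f1]) measurable
    have i2: "integrable lborel (\<lambda>x. g x * f x)"
      by (rule integrable_mult_bounded[OF g _ f1]) measurable
    have "(\<integral>x. (g (x + k) - g x) * f x \<partial>lborel) = (\<integral>x. g (x + k) * f x \<partial>lborel) - (\<integral>x. g x * f x \<partial>lborel)"
      by (simp add: left_diff_distrib i1 i2)
    also have "(\<integral>x. g (x + k) * f x \<partial>lborel) = (\<integral>x. g (x + k) * f ((x + k) + l *\<^sub>R e) \<partial>lborel)"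
      by (simp add: k)
    also have "\<dots> = H l"
      unfolding H_def by (rule integral_lborel_shift[of "\<lambda>x. g x * f (x + l *\<^sub>R e)"]) measurable
    finally show "(\<integral>x. (g (x + k) - g x) * f x \<partial>lborel) \<le> c * norm k"
      using le by (simp add: H_def l_def mult.commute)
  qed
qed

lemma test_field_partial:
  fixes \<phi> :: "real^'n \<Rightarrow> real^'n"
  assumes \<phi>: "\<phi> \<in> test_fields V"
  defines "D \<equiv> \<lambda>i x. frechet_derivative \<phi> (at x) (axis i 1) $ i"
  shows "continuous_on UNIV (D i)"
    and "((\<lambda>s. \<phi> (x + s *\<^sub>R axis i 1) $ i) has_real_derivative D i (x + t *\<^sub>R axis i 1)) (at t)"
    and "x \<notin> closure {x. \<phi> x \<noteq> 0} \<Longrightarrow> D i x = 0"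
proof -
  have "Ck_vf (Suc 0) \<phi>" using \<phi> by (simp add: test_fields_def)
  then have diff: "\<And>x. \<phi> differentiable (at x)"
    and cont: "continuous_on UNIV (\<lambda>x. frechet_derivative \<phi> (at x) (axis i 1))" by auto
  show "continuous_on UNIV (D i)" unfolding D_def by (intro continuous_intros cont)
  have d: "((\<lambda>s. \<phi> (x + s *\<^sub>R axis i 1) $ i) has_real_derivative D i (x + t *\<^sub>R axis i 1)) (at t)" for x t
  proof -
    let ?F = "frechet_derivative \<phi> (at (x + t *\<^sub>R axis i 1))"
    have "(\<phi> has_derivative ?F) (at (x + t *\<^sub>R axis i 1))" using diff frechet_derivative_works by blast
    moreover have "((\<lambda>s. x + s *\<^sub>R axis i 1) has_derivative (\<lambda>s. s *\<^sub>R axis i 1)) (at t)"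
      by (auto intro!: derivative_eq_intros)
    ultimately have "((\<lambda>s. \<phi> (x + s *\<^sub>R axis i 1)) has_derivative (\<lambda>s. ?F (s *\<^sub>R axis i 1))) (at t)"
      by (rule has_derivative_compose[rotated])
    then have "((\<lambda>s. \<phi> (x + s *\<^sub>R axis i 1) $ i) has_derivative (\<lambda>s. ?F (s *\<^sub>R axis i 1) $ i)) (at t)"
      by (rule bounded_linear.has_derivative[OF bounded_linear_vec_nth])
    moreover have "(\<lambda>s. ?F (s *\<^sub>R axis i 1) $ i) = (*) (?F (axis i 1) $ i)"
      using linear_scale[OF linear_frechet_derivative[OF diff]] by (auto simp: mult.commute)
    ultimately show ?thesis unfolding has_field_derivative_def D_def by simp
  qed
  then show "((\<lambda>s. \<phi> (x + s *\<^sub>R axis i 1) $ i) has_real_derivative D i (x + t *\<^sub>R axis i 1)) (at t)" .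
  assume "x \<notin> closure {x. \<phi> x \<noteq> 0}"
  moreover have "closure {x. \<phi> x $ i \<noteq> 0} \<subseteq> closure {x. \<phi> x \<noteq> 0}"
    by (intro closure_mono) auto
  ultimately have "x \<notin> closure {x. \<phi> x $ i \<noteq> 0}" by blast
  then show "D i x = 0"
    using derivative_zero_outside_support[of "\<lambda>x. \<phi> x $ i" x "axis i 1" "D i x"] d[of x 0] by simp
qed

lemma test_field_continuous: "\<phi> \<in> test_fields V \<Longrightarrow> continuous_on UNIV \<phi>"
  unfolding test_fields_def by (metis (no_types, lifting) Ck_vf.simps(1) mem_Collect_eq)

lemma test_field_zero: "\<phi> \<in> test_fields V \<Longrightarrow> x \<notin> V \<Longrightarrow> \<phi> x = 0"
  unfolding test_fields_def using closure_subset[of "{x. \<phi> x \<noteq> 0}"] by blast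

lemma test_field_bounded:
  fixes \<phi> :: "real^'n \<Rightarrow> real^'n"
  assumes \<phi>: "\<phi> \<in> test_fields V"
  obtains B where "\<And>x. norm (\<phi> x) \<le> B"
proof -
  have "compact (closure {x. \<phi> x \<noteq> 0})" using \<phi> by (simp add: test_fields_def)
  moreover have "continuous_on UNIV (\<lambda>x. norm (\<phi> x))"
    by (intro continuous_intros test_field_continuous[OF \<phi>])
  moreover have "norm (\<phi> x) = 0" if "x \<notin> closure {x. \<phi> x \<noteq> 0}" for x
    using that closure_subset[of "{x. \<phi> x \<noteq> 0}"] by auto
  ultimately obtain B where "\<And>x. \<bar>norm (\<phi> x)\<bar> \<le> B"
    using bounded_of_compact_support[of "\<lambda>x. norm (\<phi> x)" "closure {x. \<phi> x \<noteq> 0}"] by metis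
  then have "norm (\<phi> x) \<le> B" for x by simp
  then show ?thesis by (rule that)
qed

lemma test_field_divergence:
  fixes \<phi> :: "real^'n \<Rightarrow> real^'n"
  assumes \<phi>: "\<phi> \<in> test_fields V"
  shows "continuous_on UNIV (divergence \<phi>)"
    and "\<And>x. x \<notin> V \<Longrightarrow> divergence \<phi> x = 0"
    and "\<exists>B. \<forall>x. \<bar>divergence \<phi> x\<bar> \<le> B"
proof -
  have c: "compact (closure {x. \<phi> x \<noteq> 0})" "closure {x. \<phi> x \<noteq> 0} \<subseteq> V"
    using \<phi> by (auto simp: test_fields_def)
  show cont: "continuous_on UNIV (divergence \<phi>)"
    unfolding divergence_def[abs_def] by (intro continuous_on_sum test_field_partial[OF \<phi>])
  have z: "divergence \<phi> x = 0" if "x \<notin> closure {x. \<phi> x \<noteq> 0}" for x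
    unfolding divergence_def using test_field_partial(3)[OF \<phi> that] by simp
  show "\<And>x. x \<notin> V \<Longrightarrow> divergence \<phi> x = 0" using z c by blast
  show "\<exists>B. \<forall>x. \<bar>divergence \<phi> x\<bar> \<le> B"
    using bounded_of_compact_support[OF cont c(1) z] by metis
qed

text \<open>Each partial derivative of the field is a limit of difference quotients, and a change of
  variables moves the increment back onto \<open>g\<close>. Since the field vanishes off
  \<open>X\<close>, only base points in \<open>X\<close> count, whatever the segment does.
  Estimating the coordinates one by one costs the factor \<open>CARD('n)\<close>.\<close>

lemma integral_divergence_le:
  fixes g :: "real^'n \<Rightarrow> real"
  assumes g: "integrable lborel g" and \<phi>: "\<phi> \<in> test_fields X" and X: "X \<in> sets borel"
    and \<phi>1: "AE x in lborel. x \<in> X \<longrightarrow> norm (\<phi> x) \<le> 1" and "0 < \<delta>"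
    and diff: "\<And>h. norm h < \<delta> \<Longrightarrow> (\<integral>x. indicator X x * \<bar>g (x + h) - g x\<bar> \<partial>lborel) \<le> c * norm h"
  shows "(\<integral>x. g x * divergence \<phi> x \<partial>lborel) \<le> real CARD('n) * c"
proof -
  have [measurable]: "g \<in> borel_measurable borel" "X \<in> sets borel"
    using borel_measurable_integrable[OF g] X by auto
  define D where "D i x = frechet_derivative \<phi> (at x) (axis i 1) $ i" for i x
  have cs: "compact (closure {x. \<phi> x \<noteq> 0})" using \<phi> by (simp add: test_fields_def)
  have Dc: "continuous_on UNIV (D i)" for i
    using test_field_partial(1)[OF \<phi>] by (simp add: D_def[abs_def])
  have Dd: "((\<lambda>s. \<phi> (x + s *\<^sub>R axis i 1) $ i) has_real_derivative D i (x + t *\<^sub>R axis i 1)) (at t)" for i x t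
    using test_field_partial(2)[OF \<phi>] by (simp add: D_def)
  have "\<exists>C. \<forall>x. \<bar>D i x\<bar> \<le> C" for i
    using bounded_of_compact_support[OF Dc cs, of i] test_field_partial(3)[OF \<phi>, of _ i]
    by (metis D_def)
  then obtain C where C: "\<And>i x. \<bar>D i x\<bar> \<le> C i" by metis
  obtain B where B: "\<And>x. norm (\<phi> x) \<le> B" using test_field_bounded[OF \<phi>] by metis
  have \<phi>B: "\<bar>\<phi> x $ i\<bar> \<le> B" for x i using component_le_norm_cart[of "\<phi> x" i] B[of x] by linarith
  have \<phi>c: "continuous_on UNIV (\<lambda>x. \<phi> x $ i)" for i
    by (intro continuous_intros test_field_continuous[OF \<phi>])
  have [measurable]: "(\<lambda>x. \<phi> x $ i) \<in> borel_measurable borel" "D i \<in> borel_measurable borel" for i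
    using \<phi>c Dc by (auto intro: borel_measurable_continuous_onI)
  have le: "(\<integral>x. g x * D i x \<partial>lborel) \<le> c" for i
  proof -
    let ?e = "axis i 1 :: real^'n"
    define H where "H s = (\<integral>x. g x * \<phi> (x + s *\<^sub>R ?e) $ i \<partial>lborel)" for s
    have "(H has_real_derivative (\<integral>x. g x * D i (x + 0 *\<^sub>R ?e) \<partial>lborel)) (at 0)"
      unfolding H_def by (rule has_derivative_integral_shift[OF g \<phi>c \<phi>B Dc C Dd])
    then have lim: "((\<lambda>s. (H s - H 0) / (s - 0)) \<longlongrightarrow> (\<integral>x. g x * D i x \<partial>lborel)) (at_right 0)"
      unfolding has_field_derivative_iff by (simp add: filterlim_at_split)
    have H_le: "(H s - H 0) / (s - 0) \<le> c" if s: "0 < s" "s < \<delta>" for s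
    proof -
      let ?h = "- s *\<^sub>R ?e"
      have i1: "integrable lborel (\<lambda>x. g (x + ?h) * \<phi> x $ i)"
        by (rule integrable_mult_bounded[OF integrable_lborel_shift[OF g] _ \<phi>B]) measurable
      have i2: "integrable lborel (\<lambda>x. g x * \<phi> x $ i)"
        by (rule integrable_mult_bounded[OF g _ \<phi>B]) measurable
      have i3: "integrable lborel (\<lambda>x. \<bar>g (x + ?h) - g x\<bar> * indicator X x)"
        by (rule integrable_mult_bounded[of _ _ _ 1, OF integrable_abs[OF
                Bochner_Integration.integrable_diff[OF integrable_lborel_shift[OF g] g]]])
          (simp_all add: indicator_def)
      have "H s = (\<integral>x. g (x + ?h) * \<phi> x $ i \<partial>lborel)"
        unfolding H_def
        using integral_lborel_shift[of "\<lambda>x. g x * \<phi> (x + s *\<^sub>R ?e) $ i" ?h] by simp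
      then have "H s - H 0 = (\<integral>x. (g (x + ?h) - g x) * \<phi> x $ i \<partial>lborel)"
        by (simp add: H_def left_diff_distrib Bochner_Integration.integral_diff[OF i1 i2] del: scaleR_minus_left)
      also have "\<dots> \<le> (\<integral>x. \<bar>g (x + ?h) - g x\<bar> * indicator X x \<partial>lborel)"
      proof (rule integral_mono_AE)
        show "integrable lborel (\<lambda>x. (g (x + ?h) - g x) * \<phi> x $ i)"
          using Bochner_Integration.integrable_diff[OF i1 i2] by (simp add: left_diff_distrib)
        show "AE x in lborel. (g (x + ?h) - g x) * \<phi> x $ i \<le> \<bar>g (x + ?h) - g x\<bar> * indicator X x"
          using \<phi>1
        proof eventually_elim
          case (elim x)
          show ?case
          proof (cases "x \<in> X")
            case True
            then have "\<bar>\<phi> x $ i\<bar> \<le> 1" using elim component_le_norm_cart[of "\<phi> x" i] by simp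
            then have "\<bar>g (x + ?h) - g x\<bar> * \<bar>\<phi> x $ i\<bar> \<le> \<bar>g (x + ?h) - g x\<bar> * 1"
              by (rule mult_left_mono) simp
            then show ?thesis using True abs_ge_self[of "(g (x + ?h) - g x) * \<phi> x $ i"]
              by (simp add: abs_mult)
          qed (simp add: test_field_zero[OF \<phi>])
        qed
      qed (rule i3)
      also have "\<dots> \<le> c * norm ?h" using diff[of ?h] s by (simp add: mult.commute)
      finally show ?thesis using s by (simp add: divide_le_eq)
    qed
    show ?thesis
      by (rule tendsto_upperbound[OF lim _ trivial_limit_at_right_real])
        (auto simp: eventually_at_right_field intro!: exI[of _ \<delta>] H_le[simplified] \<open>0 < \<delta>\<close>)
  qed
  have "(\<integral>x. g x * divergence \<phi> x \<partial>lborel) = (\<integral>x. (\<Sum>i\<in>UNIV. g x * D i x) \<partial>lborel)"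
    by (simp add: divergence_def D_def sum_distrib_left)
  also have "\<dots> = (\<Sum>i\<in>UNIV. \<integral>x. g x * D i x \<partial>lborel)"
    by (rule Bochner_Integration.integral_sum) (auto intro!: integrable_mult_bounded[OF g _ C])
  also have "\<dots> \<le> (\<Sum>i\<in>(UNIV::'n set). c)" by (rule sum_mono) (rule le)
  finally show ?thesis by simp
qed

section \<open>Integration along lines and reflection across a Lipschitz graph\<close>

text \<open>Fubini in the direction \<open>e\<close> without a choice of basis: the slab in which
  \<open>z \<bullet> e\<close> lies between 0 and 1 replaces the hyperplane orthogonal to
  \<open>e\<close>. Each point \<open>x\<close> is counted with weight 1, the length of the set of
  \<open>s\<close> for which \<open>x - s *\<^sub>R e\<close> lies in the slab.\<close>

lemma nn_integral_lines:
  fixes e :: "'a::euclidean_space" and F :: "'a \<Rightarrow> ennreal"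
  assumes e: "norm e = 1" and [measurable]: "F \<in> borel_measurable borel"
  shows "(\<integral>\<^sup>+z. indicator {0..1} (z \<bullet> e) * (\<integral>\<^sup>+s. F (z + s *\<^sub>R e) \<partial>lborel) \<partial>lborel) = (\<integral>\<^sup>+x. F x \<partial>lborel)"
proof -
  have ee: "e \<bullet> e = 1" using e by (simp add: norm_eq_1)
  have ind: "indicator {0..1} (z \<bullet> e - s) = indicator {z \<bullet> e - 1..z \<bullet> e} s" for z s
    by (auto simp: indicator_def)
  have "(\<integral>\<^sup>+z. indicator {0..1} (z \<bullet> e) * (\<integral>\<^sup>+s. F (z + s *\<^sub>R e) \<partial>lborel) \<partial>lborel)
    = (\<integral>\<^sup>+z. (\<integral>\<^sup>+s. indicator {0..1} (z \<bullet> e) * F (z + s *\<^sub>R e) \<partial>lborel) \<partial>lborel)"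
    by (intro nn_integral_cong nn_integral_cmult[symmetric]) measurable
  also have "\<dots> = (\<integral>\<^sup>+s. (\<integral>\<^sup>+z. indicator {0..1} (z \<bullet> e) * F (z + s *\<^sub>R e) \<partial>lborel) \<partial>lborel)"
    by (rule lborel_pair.Fubini'[symmetric]) measurable
  also have "\<dots> = (\<integral>\<^sup>+s. (\<integral>\<^sup>+z. indicator {0..1} (z \<bullet> e - s) * F z \<partial>lborel) \<partial>lborel)"
  proof (rule nn_integral_cong)
    fix s :: real
    show "(\<integral>\<^sup>+z. indicator {0..1} (z \<bullet> e) * F (z + s *\<^sub>R e) \<partial>lborel)
      = (\<integral>\<^sup>+z. indicator {0..1} (z \<bullet> e - s) * F z \<partial>lborel)"
      using nn_integral_lborel_shift[of "\<lambda>z. indicator {0..1} (z \<bullet> e - s) * F z" "s *\<^sub>R e"]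
      by (simp add: inner_add_left ee)
  qed
  also have "\<dots> = (\<integral>\<^sup>+z. (\<integral>\<^sup>+s. indicator {0..1} (z \<bullet> e - s) * F z \<partial>lborel) \<partial>lborel)"
    by (rule lborel_pair.Fubini') measurable
  also have "\<dots> = (\<integral>\<^sup>+z. F z \<partial>lborel)"
    by (intro nn_integral_cong) (simp add: nn_integral_multc ind)
  finally show ?thesis .
qed

text \<open>The substitution \<open>2 * h - s\<close> maps the left half-line onto the right one;
  the point \<open>h\<close> is a null set.\<close>

lemma nn_integral_reflect_halfline:
  fixes f :: "real \<Rightarrow> ennreal"
  assumes [measurable]: "f \<in> borel_measurable borel"
  shows "(\<integral>\<^sup>+s. f (h + \<bar>s - h\<bar>) \<partial>lborel) = 2 * (\<integral>\<^sup>+s. indicator {h<..} s * f s \<partial>lborel)"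
proof -
  have "(\<integral>\<^sup>+s. f (h + \<bar>s - h\<bar>) \<partial>lborel)
    = (\<integral>\<^sup>+s. indicator {h<..} s * f s + indicator {h<..} (2 * h + - 1 * s) * f (2 * h + - 1 * s) \<partial>lborel)"
  proof (rule nn_integral_cong_AE)
    show "AE s in lborel. f (h + \<bar>s - h\<bar>) = indicator {h<..} s * f s
        + indicator {h<..} (2 * h + - 1 * s) * f (2 * h + - 1 * s)"
      using AE_lborel_singleton[of h] by eventually_elim (auto simp: indicator_def abs_if)
  qed
  also have "\<dots> = (\<integral>\<^sup>+s. indicator {h<..} s * f s \<partial>lborel)
      + (\<integral>\<^sup>+s. indicator {h<..} (2 * h + - 1 * s) * f (2 * h + - 1 * s) \<partial>lborel)"
    by (rule nn_integral_add) measurable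
  also have "(\<integral>\<^sup>+s. indicator {h<..} (2 * h + - 1 * s) * f (2 * h + - 1 * s) \<partial>lborel)
      = (\<integral>\<^sup>+s. indicator {h<..} s * f s \<partial>lborel)"
    using nn_integral_real_affine[of "\<lambda>s. indicator {h<..} s * f s" "-1" "2 * h"] by simp
  finally show ?thesis by (simp add: mult_2)
qed

locale lipschitz_graph =
  fixes e :: "'a::euclidean_space" and \<gamma> :: "'a \<Rightarrow> real" and L :: real
  assumes norm_e: "norm e = 1" and lip: "L-lipschitz_on {y. y \<bullet> e = 0} \<gamma>"
begin

text \<open>The signed vertical distance from \<open>y\<close> up to the graph: negative above the
  graph, positive below it.\<close>

definition depth :: "'a \<Rightarrow> real" where
  "depth y = \<gamma> (y - (y \<bullet> e) *\<^sub>R e) - y \<bullet> e"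

text \<open>The vertical reflection of the region below the graph onto the region above it, and the
  identity above.\<close>

definition fold_up :: "'a \<Rightarrow> 'a" where
  "fold_up y = y + (2 * max 0 (depth y)) *\<^sub>R e"

lemma e_e: "e \<bullet> e = 1"
  using norm_e by (simp add: norm_eq_1)

lemma L_nonneg: "0 \<le> L"
  using lip by (rule lipschitz_on_nonneg)

lemma norm_proj_le: "norm (y - (y \<bullet> e) *\<^sub>R e) \<le> norm y"
proof -
  have "(y - (y \<bullet> e) *\<^sub>R e) \<bullet> (y - (y \<bullet> e) *\<^sub>R e) = y \<bullet> y - (y \<bullet> e)\<^sup>2"
    by (simp add: inner_diff_left inner_diff_right e_e inner_commute power2_eq_square)
  then show ?thesis by (simp add: norm_eq_sqrt_inner)
qed

text \<open>The horizontal part of \<open>k\<close> is charged to the Lipschitz constant, while the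
  vertical part is counted exactly. A displacement in the upward cone, where
  \<open>L * norm (k - (k \<bullet> e) *\<^sub>R e)\<close> is at most \<open>k \<bullet> e\<close>,
  therefore never increases the depth.\<close>

lemma depth_add_le: "depth (y + k) \<le> depth y + L * norm (k - (k \<bullet> e) *\<^sub>R e) - k \<bullet> e"
proof -
  let ?p = "\<lambda>y. y - (y \<bullet> e) *\<^sub>R e"
  have "?p (y + k) - ?p y = ?p k" by (simp add: inner_add_left algebra_simps)
  moreover have mem: "?p y \<in> {y. y \<bullet> e = 0}" for y by (simp add: inner_diff_left e_e)
  ultimately have "dist (\<gamma> (?p (y + k))) (\<gamma> (?p y)) \<le> L * norm (?p k)"
    using lipschitz_onD[OF lip mem mem, of "y + k" y] by (simp only: dist_norm)
  then show ?thesis unfolding depth_def dist_real_def by (simp add: inner_add_left abs_le_iff)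
qed

lemma depth_le: "depth z \<le> depth y + (L + 1) * norm (z - y)"
proof -
  have "depth z \<le> depth y + L * norm (z - y - ((z - y) \<bullet> e) *\<^sub>R e) - (z - y) \<bullet> e"
    using depth_add_le[of y "z - y"] by simp
  moreover have "L * norm (z - y - ((z - y) \<bullet> e) *\<^sub>R e) \<le> L * norm (z - y)"
    by (intro mult_left_mono norm_proj_le L_nonneg)
  moreover have "- ((z - y) \<bullet> e) \<le> norm (z - y)"
    using Cauchy_Schwarz_ineq2[of "z - y" e] norm_e by simp
  ultimately show ?thesis by (simp add: algebra_simps)
qed

lemma depth_dist: "\<bar>depth z - depth y\<bar> \<le> (L + 1) * norm (z - y)"
  using depth_le[of z y] depth_le[of y z] by (simp add: norm_minus_commute abs_le_iff)

lemma depth_shift: "depth (y + s *\<^sub>R e) = depth y - s"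
  by (simp add: depth_def inner_add_left e_e algebra_simps)

lemma continuous_depth: "continuous_on A depth"
proof -
  have "(L + 1)-lipschitz_on A depth"
    using depth_dist L_nonneg by (intro lipschitz_onI) (auto simp: dist_norm)
  then show ?thesis by (rule lipschitz_on_continuous_on)
qed

lemma continuous_fold_up: "continuous_on A fold_up"
  unfolding fold_up_def by (intro continuous_intros continuous_depth)

lemma measurable_depth[measurable]: "depth \<in> borel_measurable borel"
  by (intro borel_measurable_continuous_onI continuous_depth)

lemma measurable_fold_up[measurable]: "fold_up \<in> borel_measurable borel"
  by (intro borel_measurable_continuous_onI continuous_fold_up)

lemma depth_fold_up: "depth (fold_up y) = - \<bar>depth y\<bar>"
  by (simp add: fold_up_def depth_shift max_def)

lemma fold_up_id: "depth y \<le> 0 \<Longrightarrow> fold_up y = y"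
  by (simp add: fold_up_def)

text \<open>Folding commutes with a translation up to a correction that depends on \<open>x\<close>
  but is vertical and bounded by a multiple of \<open>norm h\<close>. A correction of this kind can
  be absorbed by an average over vertical lifts.\<close>

lemma fold_up_add:
  obtains t where "fold_up (x + h) = fold_up x + h + t *\<^sub>R e" "\<bar>t\<bar> \<le> 2 * (L + 1) * norm h"
proof
  let ?t = "2 * max 0 (depth (x + h)) - 2 * max 0 (depth x)"
  show "fold_up (x + h) = fold_up x + h + ?t *\<^sub>R e"
    by (simp add: fold_up_def algebra_simps)
  show "\<bar>?t\<bar> \<le> 2 * (L + 1) * norm h"
  proof -
    have "\<bar>2 * max 0 a - 2 * max 0 b\<bar> \<le> 2 * \<bar>a - b\<bar>" for a b :: real by (auto simp: max_def abs_if)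
    then have "\<bar>?t\<bar> \<le> 2 * \<bar>depth (x + h) - depth x\<bar>" .
    then show ?thesis using depth_dist[of "x + h" x] unfolding add_diff_cancel_left' by linarith
  qed
qed

lemma fold_up_dist: "norm (fold_up z - fold_up y) \<le> (2 * L + 3) * norm (z - y)"
proof -
  obtain t where t: "fold_up (y + (z - y)) = fold_up y + (z - y) + t *\<^sub>R e" "\<bar>t\<bar> \<le> 2 * (L + 1) * norm (z - y)"
    by (rule fold_up_add)
  have "norm (fold_up z - fold_up y) = norm ((z - y) + t *\<^sub>R e)" using t(1) by simp
  also have "\<dots> \<le> norm (z - y) + \<bar>t\<bar>" using norm_triangle_ineq[of "z - y" "t *\<^sub>R e"] norm_e by simp
  finally show ?thesis using t(2) by (simp add: algebra_simps)
qed

text \<open>Folding preserves the absolute value of the depth. The height to be undone is therefore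
  the distance of \<open>fold_up x\<close> from the graph along \<open>e\<close>, which is
  controlled by its distance from the graph point \<open>p\<close>.\<close>

lemma norm_unfold_le:
  assumes "depth p = 0"
  shows "norm (x - p) \<le> (2 * L + 3) * norm (fold_up x - p)"
proof -
  have "\<bar>depth x\<bar> = \<bar>depth (fold_up x) - depth p\<bar>" using assms by (simp add: depth_fold_up)
  also have "\<dots> \<le> (L + 1) * norm (fold_up x - p)" by (rule depth_dist)
  finally have d: "\<bar>depth x\<bar> \<le> (L + 1) * norm (fold_up x - p)" .
  have "norm (x - p) = norm ((fold_up x - p) - (2 * max 0 (depth x)) *\<^sub>R e)"
    by (simp add: fold_up_def)
  also have "\<dots> \<le> norm (fold_up x - p) + norm ((2 * max 0 (depth x)) *\<^sub>R e)" by (rule norm_triangle_ineq4)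
  also have "norm ((2 * max 0 (depth x)) *\<^sub>R e) \<le> 2 * \<bar>depth x\<bar>" using norm_e by (simp add: max_def)
  finally show ?thesis using d by (simp add: algebra_simps)
qed

text \<open>On each vertical line folding is the reflection of a half-line. The factor 2 counts the
  two preimages of a point above the graph.\<close>

lemma nn_integral_fold_up:
  assumes [measurable]: "F \<in> borel_measurable borel"
  shows "(\<integral>\<^sup>+x. F (fold_up x) \<partial>lborel) = 2 * (\<integral>\<^sup>+x. indicator {x. depth x < 0} x * F x \<partial>lborel)"
proof -
  have line: "fold_up (z + s *\<^sub>R e) = z + (depth z + \<bar>s - depth z\<bar>) *\<^sub>R e" for z s
  proof -
    have "fold_up (z + s *\<^sub>R e) = z + (s + 2 * max 0 (depth z - s)) *\<^sub>R e"
      by (simp add: fold_up_def depth_shift scaleR_left_distrib)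
    also have "s + 2 * max 0 (depth z - s) = depth z + \<bar>s - depth z\<bar>" by (simp add: max_def abs_if)
    finally show ?thesis .
  qed
  have ind: "indicator {x. depth x < 0} (z + s *\<^sub>R e) = (indicator {depth z<..} s :: ennreal)" for z s
    by (auto simp: indicator_def depth_shift)
  have "(\<integral>\<^sup>+x. F (fold_up x) \<partial>lborel)
    = (\<integral>\<^sup>+z. indicator {0..1} (z \<bullet> e) * (\<integral>\<^sup>+s. F (fold_up (z + s *\<^sub>R e)) \<partial>lborel) \<partial>lborel)"
    by (rule nn_integral_lines[OF norm_e, symmetric]) measurable
  also have "\<dots> = (\<integral>\<^sup>+z. indicator {0..1} (z \<bullet> e) *
      (2 * (\<integral>\<^sup>+s. indicator {depth z<..} s * F (z + s *\<^sub>R e) \<partial>lborel)) \<partial>lborel)"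
    unfolding line by (subst nn_integral_reflect_halfline[of "\<lambda>s. F (_ + s *\<^sub>R e)"]) auto
  also have "\<dots> = 2 * (\<integral>\<^sup>+z. indicator {0..1} (z \<bullet> e) *
      (\<integral>\<^sup>+s. indicator {x. depth x < 0} (z + s *\<^sub>R e) * F (z + s *\<^sub>R e) \<partial>lborel) \<partial>lborel)"
    unfolding ind[symmetric]
    by (subst nn_integral_cmult[symmetric]) (auto simp: mult.left_commute)
  also have "\<dots> = 2 * (\<integral>\<^sup>+x. indicator {x. depth x < 0} x * F x \<partial>lborel)"
    by (subst nn_integral_lines[OF norm_e]) auto
  finally show ?thesis .
qed

text \<open>Folding pulls null sets back to null sets, so composition with it is well defined on
  almost-everywhere classes.\<close>

lemma AE_fold_up:
  assumes "AE x in lborel. P x"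
  shows "AE x in lborel. P (fold_up x)"
proof -
  obtain N where N: "{x. \<not> P x} \<subseteq> N" "emeasure lborel N = 0" "N \<in> sets borel"
    using AE_E[OF assms] by auto
  have [measurable]: "N \<in> sets borel" by (rule N)
  have "(\<integral>\<^sup>+x. indicator {x. depth x < 0} x * indicator N x \<partial>lborel) \<le> (\<integral>\<^sup>+x. indicator N x \<partial>lborel)"
    by (intro nn_integral_mono) (auto simp: indicator_def)
  then have "(\<integral>\<^sup>+x. indicator N (fold_up x) \<partial>lborel) = 0"
    using nn_integral_fold_up[of "indicator N"] N(2) by simp
  then have "AE x in lborel. (indicator N (fold_up x) :: ennreal) = 0"
    by (subst (asm) nn_integral_0_iff_AE) auto
  then show ?thesis by eventually_elim (use N(1) in \<open>auto simp: indicator_def split: if_splits\<close>)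
qed

text \<open>Only displacements in the upward cone are available in \<open>diff\<close>. From
  \<open>fold_up (x + h)\<close> the lifted point is reached vertically. From
  \<open>fold_up x\<close> it is reached by \<open>h\<close> plus a vertical lift, which lies in the
  cone once the lift is at least \<open>(L + 1) * norm h\<close>. The longest displacement is
  \<open>norm h + 4 * d\<close>, whence \<open>8 * L + 9\<close>.\<close>

lemma fold_up_difference:
  fixes w :: "'a \<Rightarrow> real"
  assumes [measurable]: "w \<in> borel_measurable borel" "N \<in> sets borel" and "0 \<le> c"
    and diff: "\<And>k. norm k < \<delta> \<Longrightarrow> L * norm (k - (k \<bullet> e) *\<^sub>R e) \<le> k \<bullet> e \<Longrightarrow>
      (\<integral>\<^sup>+y. indicator {y \<in> N. depth y < 0} y * ennreal \<bar>w (y + k) - w y\<bar> \<partial>lborel) \<le> ennreal (c * norm k)"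
    and h: "(8 * L + 9) * norm h < \<delta>"
  shows "(\<integral>\<^sup>+x. indicator {x. fold_up x \<in> N \<and> fold_up (x + h) \<in> N} x *
      ennreal \<bar>w (fold_up (x + h)) - w (fold_up x)\<bar> \<partial>lborel) \<le> ennreal ((60 * L + 66) * c * norm h)"
proof (cases "h = 0")
  case True
  then show ?thesis by simp
next
  case False
  \<comment> \<open>This bounds the vertical correction \<open>t\<close> of
    \<open>fold_up_add\<close>. For \<tau> between \<open>2 * d\<close> and \<open>3 * d\<close> the
    corrected height \<sigma> = t + \<tau> stays between \<open>d\<close> and \<open>4 * d\<close>,
    which is enough for the cone.\<close>
  define d where "d = 2 * (L + 1) * norm h"
  have d: "0 < d" using False L_nonneg by (simp add: d_def)
  define J where "J x = indicator {x. fold_up x \<in> N \<and> fold_up (x + h) \<in> N} x *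
      ennreal \<bar>w (fold_up (x + h)) - w (fold_up x)\<bar>" for x
  \<comment> \<open>\<open>A\<close> is the step from a folded point straight up by \<tau>, and
    \<open>B\<close> is the step from \<open>fold_up x\<close> to the lift of the other folded
    point. Both are cut off only at their starting point, as in \<open>diff\<close>.\<close>
  define A where "A x \<tau> = indicator N (fold_up x) * ennreal \<bar>w (fold_up x + \<tau> *\<^sub>R e) - w (fold_up x)\<bar>" for x \<tau>
  define B where "B x \<sigma> = indicator N (fold_up x) * ennreal \<bar>w (fold_up x + h + \<sigma> *\<^sub>R e) - w (fold_up x)\<bar>" for x \<sigma>
  have [measurable]: "J \<in> borel_measurable borel" unfolding J_def by measurable
  have mA[measurable]: "case_prod A \<in> borel_measurable (borel \<Otimes>\<^sub>M borel)"
    unfolding A_def by measurable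
  have mB[measurable]: "case_prod B \<in> borel_measurable (borel \<Otimes>\<^sub>M borel)"
    unfolding B_def by measurable
  have fold_le: "(\<integral>\<^sup>+x. indicator N (fold_up x) * ennreal \<bar>w (fold_up x + k) - w (fold_up x)\<bar> \<partial>lborel)
      \<le> 2 * ennreal (c * norm k)"
    if k: "norm k < \<delta>" "L * norm (k - (k \<bullet> e) *\<^sub>R e) \<le> k \<bullet> e" for k
  proof -
    have "(\<integral>\<^sup>+x. indicator N (fold_up x) * ennreal \<bar>w (fold_up x + k) - w (fold_up x)\<bar> \<partial>lborel)
      = 2 * (\<integral>\<^sup>+y. indicator {y. depth y < 0} y * (indicator N y * ennreal \<bar>w (y + k) - w y\<bar>) \<partial>lborel)"
      by (rule nn_integral_fold_up) measurable
    also have "(\<integral>\<^sup>+y. indicator {y. depth y < 0} y * (indicator N y * ennreal \<bar>w (y + k) - w y\<bar>) \<partial>lborel)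
      = (\<integral>\<^sup>+y. indicator {y \<in> N. depth y < 0} y * ennreal \<bar>w (y + k) - w y\<bar> \<partial>lborel)"
      by (intro nn_integral_cong) (auto simp: indicator_def)
    also have "\<dots> \<le> ennreal (c * norm k)" by (rule diff[OF k])
    finally show ?thesis by (simp add: mult_left_mono)
  qed
  have nd: "norm h \<le> d" using L_nonneg by (simp add: d_def algebra_simps)
  have h\<delta>: "norm h + 4 * d < \<delta>" using h by (simp add: d_def algebra_simps)
  have A_le: "(\<integral>\<^sup>+x. A x \<tau> \<partial>lborel) \<le> 2 * ennreal (c * (3 * d))" if "\<tau> \<in> {2 * d..3 * d}" for \<tau>
  proof -
    have "\<tau> < \<delta>" using that d h\<delta> norm_ge_zero[of h] unfolding atLeastAtMost_iff by linarith
    have "(\<integral>\<^sup>+x. A x \<tau> \<partial>lborel) \<le> 2 * ennreal (c * norm (\<tau> *\<^sub>R e))"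
      unfolding A_def by (rule fold_le) (use that d \<open>\<tau> < \<delta>\<close> in \<open>auto simp: norm_e e_e\<close>)
    also have "\<dots> \<le> 2 * ennreal (c * (3 * d))"
      using that d \<open>0 \<le> c\<close> by (intro mult_left_mono ennreal_leI) (auto simp: norm_e)
    finally show ?thesis .
  qed
  have B_le: "(\<integral>\<^sup>+x. B x \<sigma> \<partial>lborel) \<le> 2 * ennreal (c * (norm h + 4 * d))" if "\<sigma> \<in> {d..4 * d}" for \<sigma>
  proof -
    have n: "norm (h + \<sigma> *\<^sub>R e) \<le> norm h + 4 * d"
      using norm_triangle_ineq[of h "\<sigma> *\<^sub>R e"] that d by (simp add: norm_e)
    have up: "L * norm ((h + \<sigma> *\<^sub>R e) - ((h + \<sigma> *\<^sub>R e) \<bullet> e) *\<^sub>R e) \<le> (h + \<sigma> *\<^sub>R e) \<bullet> e"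
    proof -
      have eq: "(h + \<sigma> *\<^sub>R e) - ((h + \<sigma> *\<^sub>R e) \<bullet> e) *\<^sub>R e = h - (h \<bullet> e) *\<^sub>R e"
        by (simp add: inner_add_left e_e algebra_simps)
      have "(h + \<sigma> *\<^sub>R e) \<bullet> e = h \<bullet> e + \<sigma>" by (simp add: inner_add_left e_e)
      moreover have "L * norm (h - (h \<bullet> e) *\<^sub>R e) \<le> L * norm h"
        by (intro mult_left_mono norm_proj_le L_nonneg)
      moreover have "- (h \<bullet> e) \<le> norm h" using Cauchy_Schwarz_ineq2[of h e] norm_e by simp
      moreover have "L * norm h + norm h \<le> \<sigma>"
        using that L_nonneg by (simp add: d_def algebra_simps)
      ultimately show ?thesis unfolding eq by linarith
    qed
    have "(\<integral>\<^sup>+x. B x \<sigma> \<partial>lborel) \<le> 2 * ennreal (c * norm (h + \<sigma> *\<^sub>R e))"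
      unfolding B_def using fold_le[OF _ up] n h\<delta> by (simp add: add.assoc)
    also have "\<dots> \<le> 2 * ennreal (c * (norm h + 4 * d))"
      using n \<open>0 \<le> c\<close> by (intro mult_left_mono ennreal_leI) auto
    finally show ?thesis .
  qed
  text \<open>The vertical displacement of \<open>fold_up\<close> depends on \<open>x\<close>; averaging over \<open>\<tau>\<close> turns it into
    a translation of the averaging variable.\<close>
  have pw: "ennreal d * J x \<le> (\<integral>\<^sup>+\<tau>. indicator {2 * d..3 * d} \<tau> * A (x + h) \<tau> \<partial>lborel)
      + (\<integral>\<^sup>+\<sigma>. indicator {d..4 * d} \<sigma> * B x \<sigma> \<partial>lborel)" for x
  proof -
    obtain t where t: "fold_up (x + h) = fold_up x + h + t *\<^sub>R e" "\<bar>t\<bar> \<le> d"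
      unfolding d_def by (rule fold_up_add)
    have "ennreal d * J x = (\<integral>\<^sup>+\<tau>. indicator {2 * d..3 * d} \<tau> * J x \<partial>lborel)"
      using d by (simp add: nn_integral_multc)
    also have "\<dots> \<le> (\<integral>\<^sup>+\<tau>. indicator {2 * d..3 * d} \<tau> * A (x + h) \<tau>
        + indicator {d..4 * d} (t + 1 * \<tau>) * B x (t + 1 * \<tau>) \<partial>lborel)"
    proof (rule nn_integral_mono)
      fix \<tau>
      let ?y = "fold_up (x + h) + \<tau> *\<^sub>R e"
      have y: "?y = fold_up x + h + (t + 1 * \<tau>) *\<^sub>R e" using t(1) by (simp add: algebra_simps)
      have "J x \<le> A (x + h) \<tau> + B x (t + 1 * \<tau>)"
      proof (cases "fold_up x \<in> N \<and> fold_up (x + h) \<in> N")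
        case True
        have "\<bar>w (fold_up (x + h)) - w (fold_up x)\<bar>
          \<le> \<bar>w ?y - w (fold_up (x + h))\<bar> + \<bar>w ?y - w (fold_up x)\<bar>" by linarith
        then have "ennreal \<bar>w (fold_up (x + h)) - w (fold_up x)\<bar>
          \<le> ennreal \<bar>w ?y - w (fold_up (x + h))\<bar> + ennreal \<bar>w ?y - w (fold_up x)\<bar>"
          by (simp add: ennreal_plus[symmetric] ennreal_leI del: ennreal_plus)
        then show ?thesis using True unfolding J_def A_def B_def y[symmetric] by simp
      qed (simp add: J_def)
      then show "indicator {2 * d..3 * d} \<tau> * J x
        \<le> indicator {2 * d..3 * d} \<tau> * A (x + h) \<tau> + indicator {d..4 * d} (t + 1 * \<tau>) * B x (t + 1 * \<tau>)"
        using t(2) by (auto simp: indicator_def)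
    qed
    also have "\<dots> = (\<integral>\<^sup>+\<tau>. indicator {2 * d..3 * d} \<tau> * A (x + h) \<tau> \<partial>lborel)
      + (\<integral>\<^sup>+\<tau>. indicator {d..4 * d} (t + 1 * \<tau>) * B x (t + 1 * \<tau>) \<partial>lborel)"
      by (rule nn_integral_add) measurable
    also have "(\<integral>\<^sup>+\<tau>. indicator {d..4 * d} (t + 1 * \<tau>) * B x (t + 1 * \<tau>) \<partial>lborel)
      = (\<integral>\<^sup>+\<sigma>. indicator {d..4 * d} \<sigma> * B x \<sigma> \<partial>lborel)"
      using nn_integral_real_affine[of "\<lambda>\<sigma>. indicator {d..4 * d} \<sigma> * B x \<sigma>" 1 t] by simp
    finally show ?thesis .
  qed
  have IA: "(\<integral>\<^sup>+x. (\<integral>\<^sup>+\<tau>. indicator {2 * d..3 * d} \<tau> * A (x + h) \<tau> \<partial>lborel) \<partial>lborel)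
    \<le> ennreal d * (2 * ennreal (c * (3 * d)))"
  proof -
    have "(\<integral>\<^sup>+x. (\<integral>\<^sup>+\<tau>. indicator {2 * d..3 * d} \<tau> * A (x + h) \<tau> \<partial>lborel) \<partial>lborel)
      = (\<integral>\<^sup>+x. (\<integral>\<^sup>+\<tau>. indicator {2 * d..3 * d} \<tau> * A x \<tau> \<partial>lborel) \<partial>lborel)"
      by (rule nn_integral_lborel_shift) measurable
    also have "\<dots> = (\<integral>\<^sup>+\<tau>. (\<integral>\<^sup>+x. indicator {2 * d..3 * d} \<tau> * A x \<tau> \<partial>lborel) \<partial>lborel)"
      by (rule lborel_pair.Fubini'[symmetric]) measurable
    also have "\<dots> \<le> (\<integral>\<^sup>+\<tau>. indicator {2 * d..3 * d} \<tau> * (2 * ennreal (c * (3 * d))) \<partial>lborel)"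
      by (intro nn_integral_mono) (auto simp: indicator_def A_le)
    also have "\<dots> = ennreal d * (2 * ennreal (c * (3 * d)))"
      using d by (simp add: nn_integral_multc)
    finally show ?thesis .
  qed
  have IB: "(\<integral>\<^sup>+x. (\<integral>\<^sup>+\<sigma>. indicator {d..4 * d} \<sigma> * B x \<sigma> \<partial>lborel) \<partial>lborel)
    \<le> ennreal (3 * d) * (2 * ennreal (c * (norm h + 4 * d)))"
  proof -
    have "(\<integral>\<^sup>+x. (\<integral>\<^sup>+\<sigma>. indicator {d..4 * d} \<sigma> * B x \<sigma> \<partial>lborel) \<partial>lborel)
      = (\<integral>\<^sup>+\<sigma>. (\<integral>\<^sup>+x. indicator {d..4 * d} \<sigma> * B x \<sigma> \<partial>lborel) \<partial>lborel)"
      by (rule lborel_pair.Fubini'[symmetric]) measurable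
    also have "\<dots> \<le> (\<integral>\<^sup>+\<sigma>. indicator {d..4 * d} \<sigma> * (2 * ennreal (c * (norm h + 4 * d))) \<partial>lborel)"
      by (intro nn_integral_mono) (auto simp: indicator_def B_le)
    also have "\<dots> = ennreal (3 * d) * (2 * ennreal (c * (norm h + 4 * d)))"
      using d by (simp add: nn_integral_multc)
    finally show ?thesis .
  qed
  have "ennreal d * (\<integral>\<^sup>+x. J x \<partial>lborel) = (\<integral>\<^sup>+x. ennreal d * J x \<partial>lborel)"
    by (rule nn_integral_cmult[symmetric]) measurable
  also have "\<dots> \<le> (\<integral>\<^sup>+x. (\<integral>\<^sup>+\<tau>. indicator {2 * d..3 * d} \<tau> * A (x + h) \<tau> \<partial>lborel)
      + (\<integral>\<^sup>+\<sigma>. indicator {d..4 * d} \<sigma> * B x \<sigma> \<partial>lborel) \<partial>lborel)"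
    by (intro nn_integral_mono pw)
  also have "\<dots> = (\<integral>\<^sup>+x. (\<integral>\<^sup>+\<tau>. indicator {2 * d..3 * d} \<tau> * A (x + h) \<tau> \<partial>lborel) \<partial>lborel)
      + (\<integral>\<^sup>+x. (\<integral>\<^sup>+\<sigma>. indicator {d..4 * d} \<sigma> * B x \<sigma> \<partial>lborel) \<partial>lborel)"
    by (rule nn_integral_add) measurable
  also have "\<dots> \<le> ennreal d * (2 * ennreal (c * (3 * d))) + ennreal (3 * d) * (2 * ennreal (c * (norm h + 4 * d)))"
    by (intro add_mono IA IB)
  also have "\<dots> = ennreal (d * (2 * (c * (3 * d))) + 3 * d * (2 * (c * (norm h + 4 * d))))"
  proof -
    have two: "2 * ennreal a = ennreal (2 * a)" if "0 \<le> a" for a using that by (simp add: ennreal_mult)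
    have *: "ennreal a * (2 * ennreal b) = ennreal (a * (2 * b))" if "0 \<le> a" "0 \<le> b" for a b
      using that by (simp add: two ennreal_mult[of a "2 * b"])
    have "0 \<le> c * (3 * d)" "0 \<le> c * (norm h + 4 * d)" "0 \<le> d" "0 \<le> 3 * d" using d \<open>0 \<le> c\<close> by auto
    then show ?thesis by (simp only: * ennreal_plus mult_nonneg_nonneg zero_le_numeral)
  qed
  \<comment> \<open>The two terms sum to \<open>6 * c * d * (5 * d + norm h)\<close>. Inserting
    \<open>d = 2 * (L + 1) * norm h\<close> into the bracket gives
    \<open>60 * L + 66\<close>.\<close>
  also have "d * (2 * (c * (3 * d))) + 3 * d * (2 * (c * (norm h + 4 * d))) = d * ((60 * L + 66) * c * norm h)"
    by (simp add: d_def algebra_simps)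
  also have "ennreal (d * ((60 * L + 66) * c * norm h)) = ennreal d * ennreal ((60 * L + 66) * c * norm h)"
    using d \<open>0 \<le> c\<close> L_nonneg by (intro ennreal_mult) auto
  finally have "(\<integral>\<^sup>+x. J x \<partial>lborel) \<le> ennreal ((60 * L + 66) * c * norm h)"
    using d by (subst (asm) ennreal_mult_le_mult_iff) auto
  then show ?thesis unfolding J_def .
qed

end

text \<open>The flag \<open>b\<close> treats the whole space and small neighbourhoods of \<open>S\<close> simultaneously.\<close>

definition near :: "'a::metric_space set \<Rightarrow> bool \<Rightarrow> real \<Rightarrow> 'a set" where
  "near S b q = {x. b \<or> (\<exists>p\<in>S. dist x p < q)}"

lemma open_near: "open (near S b q)"
proof (cases b)
  case False
  then have "near S b q = (\<Union>p\<in>S. ball p q)" by (auto simp: near_def dist_commute)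
  then show ?thesis by auto
qed (simp add: near_def)

lemma near_step: "x \<in> near S b q \<Longrightarrow> dist y x \<le> r \<Longrightarrow> y \<in> near S b (q + r)"
proof -
  assume x: "x \<in> near S b q" and r: "dist y x \<le> r"
  show ?thesis
  proof (cases b)
    case False
    then obtain p where "p \<in> S" "dist x p < q" using x by (auto simp: near_def)
    then have "p \<in> S" "dist y p < q + r" using dist_triangle[of y p x] r by auto
    then show ?thesis by (auto simp: near_def)
  qed (simp add: near_def)
qed

lemma near_mono: "q \<le> q' \<Longrightarrow> near S b q \<subseteq> near S b q'"
  unfolding near_def by fastforce

lemma seg_core_mono: "V \<subseteq> V' \<Longrightarrow> seg_core k V \<subseteq> seg_core k V'"
  unfolding seg_core_def by blast

lemma seg_core_self: "y \<in> seg_core k V \<Longrightarrow> y \<in> V"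
  unfolding seg_core_def by (drule CollectD, drule bspec[of _ _ 0]) auto

text \<open>The discrete product rule, arranged so that the increment of the cut-off falls on the
  value of the function at the base point.\<close>

lemma mult_difference_le:
  fixes a a' g g' l :: real
  assumes "\<bar>a'\<bar> \<le> 1" "\<bar>a' - a\<bar> \<le> l"
  shows "ennreal \<bar>a' * g' - a * g\<bar> \<le> ennreal \<bar>g' - g\<bar> + ennreal l * ennreal \<bar>g\<bar>"
proof -
  have "\<bar>a' * g' - a * g\<bar> = \<bar>a' * (g' - g) + (a' - a) * g\<bar>" by (simp add: algebra_simps)
  also have "\<dots> \<le> \<bar>a'\<bar> * \<bar>g' - g\<bar> + \<bar>a' - a\<bar> * \<bar>g\<bar>"
    using abs_triangle_ineq[of "a' * (g' - g)" "(a' - a) * g"] by (simp only: abs_mult)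
  also have "\<dots> \<le> 1 * \<bar>g' - g\<bar> + l * \<bar>g\<bar>" using assms by (intro add_mono mult_right_mono) auto
  finally have "\<bar>a' * g' - a * g\<bar> \<le> \<bar>g' - g\<bar> + l * \<bar>g\<bar>" by simp
  moreover have "0 \<le> l" using assms(2) by linarith
  ultimately show ?thesis
    by (simp add: ennreal_mult[symmetric] ennreal_plus[symmetric] ennreal_leI del: ennreal_plus)
qed

lemma nn_integral_combine:
  assumes "\<And>y. F y \<le> F1 y + ennreal a * F2 y"
    and [measurable]: "F1 \<in> borel_measurable M" "F2 \<in> borel_measurable M"
    and "(\<integral>\<^sup>+y. F1 y \<partial>M) \<le> ennreal x" "(\<integral>\<^sup>+y. F2 y \<partial>M) \<le> ennreal m" "0 \<le> a" "0 \<le> x" "0 \<le> m"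
  shows "(\<integral>\<^sup>+y. F y \<partial>M) \<le> ennreal (x + a * m)"
proof -
  have "(\<integral>\<^sup>+y. F y \<partial>M) \<le> (\<integral>\<^sup>+y. F1 y + ennreal a * F2 y \<partial>M)" by (intro nn_integral_mono assms)
  also have "\<dots> = (\<integral>\<^sup>+y. F1 y \<partial>M) + ennreal a * (\<integral>\<^sup>+y. F2 y \<partial>M)"
    by (simp add: nn_integral_add nn_integral_cmult)
  also have "\<dots> \<le> ennreal x + ennreal a * ennreal m"
    using assms by (intro add_mono mult_left_mono) auto
  also have "\<dots> = ennreal (x + a * m)" using assms by (simp add: ennreal_mult ennreal_plus)
  finally show ?thesis .
qed

section \<open>Lipschitz cut-offs and the reflected piece of one boundary patch\<close>

text \<open>It is 1 at distance less than \<open>q / 2\<close> from \<open>p\<close> and 0 from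
  distance \<open>q\<close> on, with slope at most \<open>2 / q\<close>. A Lipschitz cut-off
  suffices because it enters the estimates only through differences.\<close>

definition bump :: "'a::metric_space \<Rightarrow> real \<Rightarrow> 'a \<Rightarrow> real" where
  "bump p q x = max 0 (min 1 (2 - 2 * dist x p / q))"

lemma bump_bounds: "0 \<le> bump p q x" "bump p q x \<le> 1"
  by (auto simp: bump_def)

lemma bump_eq_1: "0 < q \<Longrightarrow> dist x p < q / 2 \<Longrightarrow> bump p q x = 1"
  by (simp add: bump_def field_simps)

lemma bump_eq_0: "0 < q \<Longrightarrow> q \<le> dist x p \<Longrightarrow> bump p q x = 0"
  by (simp add: bump_def field_simps)

lemma bump_dist:
  assumes "0 < q" shows "\<bar>bump p q y - bump p q x\<bar> \<le> 2 / q * dist y x"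
proof -
  have "\<bar>bump p q y - bump p q x\<bar> \<le> \<bar>(2 - 2 * dist y p / q) - (2 - 2 * dist x p / q)\<bar>"
    unfolding bump_def by (auto simp: max_def min_def abs_if)
  also have "\<dots> = 2 / q * \<bar>dist y p - dist x p\<bar>"
    using assms by (simp add: abs_if field_simps)
  also have "\<dots> \<le> 2 / q * dist y x"
    using assms abs_dist_diff_le[of y p x] by (intro mult_left_mono) (auto simp: dist_commute)
  finally show ?thesis .
qed

lemma bump_measurable[measurable]: "bump p q \<in> borel_measurable borel"
  unfolding bump_def[abs_def]
  by (intro borel_measurable_continuous_onI) (auto simp: divide_inverse intro!: continuous_intros)

text \<open>A point whose folded image is within \<open>q\<close> of \<open>p\<close> lies within
  \<open>(2 * L + 3) * q\<close> of \<open>p\<close>. The remaining \<open>2 * q\<close> in the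
  radius make room for a step \<open>h\<close> and for a frontier point nearby.\<close>

locale boundary_patch = lipschitz_graph e \<gamma> L
  for e :: "'a::euclidean_space" and \<gamma> L +
  fixes \<Omega> W :: "'a set" and p :: 'a and q :: real
  assumes open_\<Omega>: "open \<Omega>" and q: "0 < q" and p: "p \<in> frontier \<Omega>"
    and local_graph: "\<Omega> \<inter> ball p ((2 * L + 5) * q)
      = {y \<in> ball p ((2 * L + 5) * q). \<gamma> (y - (y \<bullet> e) *\<^sub>R e) < y \<bullet> e}"
    and ball_W: "ball p ((2 * L + 5) * q) \<subseteq> W"
begin

lemma Omega_iff: "dist y p < (2 * L + 5) * q \<Longrightarrow> y \<in> \<Omega> \<longleftrightarrow> depth y < 0"
proof -
  assume "dist y p < (2 * L + 5) * q"
  then have y: "y \<in> ball p ((2 * L + 5) * q)" by (simp add: dist_commute)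
  then have "y \<in> \<Omega> \<longleftrightarrow> y \<in> \<Omega> \<inter> ball p ((2 * L + 5) * q)" by simp
  also have "\<dots> \<longleftrightarrow> depth y < 0" unfolding local_graph using y by (simp add: depth_def)
  finally show ?thesis .
qed

text \<open>A frontier point is not in the open set \<Omega>, so its depth is at least 0. Positive
  depth is an open condition that excludes \<Omega> from a neighbourhood. Depth 0 means that folding
  fixes the point.\<close>

lemma frontier_depth:
  assumes z: "z \<in> frontier \<Omega>" "dist z p < (2 * L + 5) * q"
  shows "depth z = 0"
proof (rule ccontr)
  assume "depth z \<noteq> 0"
  moreover have "z \<notin> \<Omega>" using z(1) open_\<Omega> by (simp add: frontier_def interior_open)
  ultimately have "0 < depth z" using Omega_iff[OF z(2)] by simp
  have "open ({y. 0 < depth y} \<inter> ball p ((2 * L + 5) * q))"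
    by (intro open_Int open_Collect_less continuous_depth continuous_intros) auto
  moreover have "z \<in> {y. 0 < depth y} \<inter> ball p ((2 * L + 5) * q)"
    using z(2) \<open>0 < depth z\<close> by (simp add: dist_commute)
  moreover have "z \<in> closure \<Omega>" using z(1) by (simp add: frontier_def)
  ultimately have "({y. 0 < depth y} \<inter> ball p ((2 * L + 5) * q)) \<inter> \<Omega> \<noteq> {}"
    using open_Int_closure_eq_empty by blast
  then obtain y where "y \<in> \<Omega>" "0 < depth y" "dist y p < (2 * L + 5) * q" by (auto simp: dist_commute)
  then show False using Omega_iff[of y] by simp
qed

lemma center_depth: "depth p = 0"
  using frontier_depth[OF p] q L_nonneg by simp

lemma unfold_dist:
  assumes "dist (fold_up x) p < q"
  shows "dist x p < (2 * L + 3) * q"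
proof -
  have "dist x p \<le> (2 * L + 3) * dist (fold_up x) p"
    using norm_unfold_le[OF center_depth, of x] by (simp add: dist_norm)
  also have "\<dots> < (2 * L + 3) * q" using assms L_nonneg by (intro mult_strict_left_mono) auto
  finally show ?thesis .
qed

text \<open>The cut-off is folded together with \<open>g\<close>, so the piece is the reflection of
  the product \<open>bump p q y * g y\<close> as a whole and depends only on its values on and above
  the graph.\<close>

definition piece :: "('a \<Rightarrow> real) \<Rightarrow> 'a \<Rightarrow> real" where
  "piece g x = bump p q (fold_up x) * g (fold_up x)"

lemma piece_measurable[measurable]:
  assumes [measurable]: "g \<in> borel_measurable borel"
  shows "piece g \<in> borel_measurable borel"
  unfolding piece_def by measurable

lemma piece_outside:
  assumes "x \<notin> W" shows "piece g x = 0"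
proof -
  have "\<not> dist x p < (2 * L + 5) * q" using assms ball_W by (auto simp: dist_commute)
  moreover have "(2 * L + 3) * q \<le> (2 * L + 5) * q" using q by simp
  ultimately have "q \<le> dist (fold_up x) p" using unfold_dist[of x] by linarith
  then show ?thesis by (simp add: piece_def bump_eq_0[OF q])
qed

text \<open>Far from \<open>p\<close> the graph says nothing about \<Omega>, and folding may move
  points of \<Omega>; there both cut-off values are 0.\<close>

lemma piece_inside:
  assumes "x \<in> \<Omega>" shows "piece g x = bump p q x * g x"
proof (cases "dist x p < (2 * L + 5) * q")
  case True
  then show ?thesis using Omega_iff assms by (simp add: piece_def fold_up_id)
next
  case False
  moreover have "(2 * L + 3) * q \<le> (2 * L + 5) * q" using q by simp
  ultimately have "q \<le> dist (fold_up x) p" using unfold_dist[of x] by linarith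
  moreover have "1 * q \<le> (2 * L + 5) * q" using q L_nonneg by (intro mult_right_mono) auto
  then have "q \<le> dist x p" using False by simp
  ultimately show ?thesis by (simp add: piece_def bump_eq_0[OF q])
qed

text \<open>A frontier point near the patch is fixed by folding, and folding has Lipschitz constant
  \<open>2 * L + 3\<close>. Both \<open>x\<close> and \<open>x + h\<close> lie within
  \<open>2 * \<rho>\<close> of such a point, whence \<open>4 * L + 6\<close>. The assumption
  \<open>cl\<close> places \<open>x\<close> close enough to the patch for the graph to describe the
  frontier.\<close>

lemma fold_up_near:
  assumes x: "x \<in> near (frontier \<Omega>) b \<rho>" and \<rho>: "b \<or> \<rho> \<le> q / 2" and h: "norm h \<le> \<rho>" "norm h \<le> q"
    and cl: "dist (fold_up x) p < q \<or> dist (fold_up (x + h)) p < q"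
  shows "fold_up x \<in> near (frontier \<Omega>) b ((4 * L + 6) * \<rho>)"
    and "fold_up (x + h) \<in> near (frontier \<Omega>) b ((4 * L + 6) * \<rho>)"
proof -
  have "fold_up x \<in> near (frontier \<Omega>) b ((4 * L + 6) * \<rho>) \<and> fold_up (x + h) \<in> near (frontier \<Omega>) b ((4 * L + 6) * \<rho>)"
  proof (cases b)
    case True
    then show ?thesis by (simp add: near_def)
  next
    case False
    then obtain z where z: "z \<in> frontier \<Omega>" "dist x z < \<rho>" using x by (auto simp: near_def)
    have "dist x p < (2 * L + 3) * q + norm h"
    proof (cases "dist (fold_up x) p < q")
      case True
      then show ?thesis using unfold_dist[of x] norm_ge_zero[of h] by linarith
    next
      case False
      then have "dist (x + h) p < (2 * L + 3) * q" using unfold_dist cl by blast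
      then show ?thesis using dist_triangle[of x p "x + h"] by (simp add: dist_norm)
    qed
    then have "dist z p < (2 * L + 3) * q + norm h + \<rho>"
      using dist_triangle[of z p x] z(2) by (simp add: dist_commute)
    also have "\<dots> \<le> (2 * L + 5) * q" using h \<rho> False q by (simp add: algebra_simps)
    finally have "depth z = 0" using frontier_depth z(1) by blast
    then have fz: "fold_up z = z" by (simp add: fold_up_id)
    have "dist (fold_up y) z < (4 * L + 6) * \<rho>" if "dist y z < 2 * \<rho>" for y
    proof -
      have "dist (fold_up y) z \<le> (2 * L + 3) * dist y z" using fold_up_dist[of y z] fz by (simp add: dist_norm)
      also have "\<dots> < (2 * L + 3) * (2 * \<rho>)" using that L_nonneg by (intro mult_strict_left_mono) auto
      finally show ?thesis by (simp add: algebra_simps)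
    qed
    moreover have "dist x z < 2 * \<rho>" using z(2) zero_le_dist[of x z] by linarith
    moreover have "dist (x + h) z < 2 * \<rho>"
      using dist_triangle[of "x + h" z x] z(2) h(1) by (simp add: dist_norm)
    ultimately show ?thesis using z(1) by (auto simp: near_def)
  qed
  then show "fold_up x \<in> near (frontier \<Omega>) b ((4 * L + 6) * \<rho>)"
    "fold_up (x + h) \<in> near (frontier \<Omega>) b ((4 * L + 6) * \<rho>)" by auto
qed

lemma piece_L1:
  fixes g :: "'a \<Rightarrow> real"
  assumes [measurable]: "g \<in> borel_measurable borel" and zero: "\<And>x. x \<notin> \<Omega> \<Longrightarrow> g x = 0"
    and \<rho>: "0 < \<rho>" "b \<or> \<rho> \<le> q / 2"
    and L1: "(\<integral>\<^sup>+y. indicator (\<Omega> \<inter> near (frontier \<Omega>) b ((4 * L + 7) * \<rho>)) y * ennreal \<bar>g y\<bar> \<partial>lborel) \<le> ennreal m"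
  shows "(\<integral>\<^sup>+x. indicator (near (frontier \<Omega>) b \<rho>) x * ennreal \<bar>piece g x\<bar> \<partial>lborel) \<le> 2 * ennreal m"
proof -
  define V where "V = \<Omega> \<inter> near (frontier \<Omega>) b ((4 * L + 7) * \<rho>)"
  have [measurable]: "V \<in> sets borel" unfolding V_def by (intro borel_open open_Int open_\<Omega> open_near)
  have "(\<integral>\<^sup>+x. indicator (near (frontier \<Omega>) b \<rho>) x * ennreal \<bar>piece g x\<bar> \<partial>lborel)
    \<le> (\<integral>\<^sup>+x. indicator V (fold_up x) * ennreal \<bar>g (fold_up x)\<bar> \<partial>lborel)"
  proof (rule nn_integral_mono)
    fix x
    have "ennreal \<bar>piece g x\<bar> \<le> indicator V (fold_up x) * ennreal \<bar>g (fold_up x)\<bar>"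
      if x: "x \<in> near (frontier \<Omega>) b \<rho>"
    proof (cases "dist (fold_up x) p < q \<and> fold_up x \<in> \<Omega>")
      case True
      then have "fold_up x \<in> near (frontier \<Omega>) b ((4 * L + 6) * \<rho>)"
        using fold_up_near(1)[OF x \<rho>(2), of 0] \<rho>(1) q by simp
      then have "fold_up x \<in> V" using True near_mono[of "(4 * L + 6) * \<rho>" "(4 * L + 7) * \<rho>"] \<rho>(1)
        by (auto simp: V_def)
      moreover have "\<bar>piece g x\<bar> \<le> \<bar>g (fold_up x)\<bar>"
        using mult_right_mono[OF bump_bounds(2)[of p q "fold_up x"], of "\<bar>g (fold_up x)\<bar>"]
        by (simp add: piece_def abs_mult bump_bounds)
      ultimately show ?thesis by (simp add: ennreal_leI)
    next
      case False
      then have "piece g x = 0" using zero by (auto simp: piece_def bump_eq_0[OF q] not_less)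
      then show ?thesis by simp
    qed
    then show "indicator (near (frontier \<Omega>) b \<rho>) x * ennreal \<bar>piece g x\<bar>
      \<le> indicator V (fold_up x) * ennreal \<bar>g (fold_up x)\<bar>"
      by (auto simp: indicator_def[of "near _ _ _"])
  qed
  also have "\<dots> = 2 * (\<integral>\<^sup>+x. indicator {x. depth x < 0} x * (indicator V x * ennreal \<bar>g x\<bar>) \<partial>lborel)"
    by (rule nn_integral_fold_up) measurable
  also have "\<dots> \<le> 2 * (\<integral>\<^sup>+x. indicator V x * ennreal \<bar>g x\<bar> \<partial>lborel)"
    by (intro mult_left_mono nn_integral_mono) (auto simp: indicator_def)
  also have "\<dots> \<le> 2 * ennreal m" using L1 by (intro mult_left_mono) (auto simp: V_def)
  finally show ?thesis .
qed

text \<open>This is \<open>fold_up_difference\<close> for the product of \<open>bump\<close> and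
  \<open>g\<close>. From a point of \<Omega> near \<open>p\<close>, a short upward displacement
  keeps the whole segment in \<Omega>, so the hypothesis on \<open>seg_core\<close> applies. The
  segment can leave the neighbourhood of width \<open>(4 * L + 6) * \<rho>\<close> by at most
  \<rho>, whence \<open>4 * L + 7\<close>.\<close>

lemma piece_difference:
  fixes g :: "'a \<Rightarrow> real"
  assumes [measurable]: "g \<in> borel_measurable borel"
    and \<rho>: "0 < \<rho>" "b \<or> \<rho> \<le> q / 2" and "0 \<le> c" "0 \<le> m"
    and diff: "\<And>k. (\<integral>\<^sup>+y. indicator (seg_core k (\<Omega> \<inter> near (frontier \<Omega>) b ((4 * L + 7) * \<rho>))) y
      * ennreal \<bar>g (y + k) - g y\<bar> \<partial>lborel) \<le> ennreal (c * norm k)"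
    and L1: "(\<integral>\<^sup>+y. indicator (\<Omega> \<inter> near (frontier \<Omega>) b ((4 * L + 7) * \<rho>)) y * ennreal \<bar>g y\<bar> \<partial>lborel) \<le> ennreal m"
  obtains \<delta> where "0 < \<delta>" "\<And>h. norm h < \<delta> \<Longrightarrow>
    (\<integral>\<^sup>+x. indicator (near (frontier \<Omega>) b \<rho>) x * ennreal \<bar>piece g (x + h) - piece g x\<bar> \<partial>lborel)
      \<le> ennreal ((60 * L + 66) * (c + 2 / q * m) * norm h)"
proof -
  define V where "V = \<Omega> \<inter> near (frontier \<Omega>) b ((4 * L + 7) * \<rho>)"
  define N where "N = near (frontier \<Omega>) b ((4 * L + 6) * \<rho>)"
  define w where "w y = bump p q y * g y" for y
  define \<delta>1 where "\<delta>1 = min q \<rho>"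
  have oV: "open V" unfolding V_def by (intro open_Int open_\<Omega> open_near)
  then have [measurable]: "V \<in> sets borel" "seg_core k V \<in> sets borel" for k
    using open_seg_core[of V k] by auto
  have [measurable]: "N \<in> sets borel" unfolding N_def by (intro borel_open open_near)
  have [measurable]: "w \<in> borel_measurable borel" unfolding w_def by measurable
  have w_diff: "(\<integral>\<^sup>+y. indicator {y \<in> N. depth y < 0} y * ennreal \<bar>w (y + k) - w y\<bar> \<partial>lborel)
      \<le> ennreal ((c + 2 / q * m) * norm k)"
    if k: "norm k < \<delta>1" "L * norm (k - (k \<bullet> e) *\<^sub>R e) \<le> k \<bullet> e" for k
  proof -
    have "(\<integral>\<^sup>+y. indicator {y \<in> N. depth y < 0} y * ennreal \<bar>w (y + k) - w y\<bar> \<partial>lborel)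
        \<le> ennreal (c * norm k + (2 / q * norm k) * m)"
    proof (rule nn_integral_combine)
      fix y
      show "indicator {y \<in> N. depth y < 0} y * ennreal \<bar>w (y + k) - w y\<bar>
        \<le> indicator (seg_core k V) y * ennreal \<bar>g (y + k) - g y\<bar>
          + ennreal (2 / q * norm k) * (indicator V y * ennreal \<bar>g y\<bar>)"
      \<comment> \<open>Within \<open>2 * q\<close> of \<open>p\<close> the segment stays in the
        ball where \<Omega> is the epigraph. Beyond that distance the cut-off vanishes at both
        endpoints, since \<open>norm k\<close> is less than \<open>q\<close>.\<close>
      proof (cases "y \<in> N \<and> depth y < 0 \<and> dist y p < 2 * q")
        case True
        have "y + s *\<^sub>R k \<in> V" if s: "s \<in> {0..1}" for s
        proof -
          have sk: "norm (s *\<^sub>R k) \<le> norm k" using s mult_right_mono[of s 1 "norm k"] by simp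
          have "dist (y + s *\<^sub>R k) p < 3 * q"
            using norm_triangle_ineq[of "y - p" "s *\<^sub>R k"] True sk k(1)
            by (simp add: dist_norm \<delta>1_def algebra_simps)
          also have "3 * q \<le> (2 * L + 5) * q" using L_nonneg q by (intro mult_right_mono) auto
          finally have d: "dist (y + s *\<^sub>R k) p < (2 * L + 5) * q" .
          have "s *\<^sub>R k - (s *\<^sub>R k \<bullet> e) *\<^sub>R e = s *\<^sub>R (k - (k \<bullet> e) *\<^sub>R e)" by (simp add: algebra_simps)
          then have "norm (s *\<^sub>R k - (s *\<^sub>R k \<bullet> e) *\<^sub>R e) = s * norm (k - (k \<bullet> e) *\<^sub>R e)" using s by simp
          then have "depth (y + s *\<^sub>R k) \<le> depth y + L * (s * norm (k - (k \<bullet> e) *\<^sub>R e)) - s * (k \<bullet> e)"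
            using depth_add_le[of y "s *\<^sub>R k"] by simp
          then have "depth (y + s *\<^sub>R k) \<le> depth y + s * (L * norm (k - (k \<bullet> e) *\<^sub>R e) - k \<bullet> e)"
            by (simp add: right_diff_distrib mult.left_commute)
          moreover have "s * (L * norm (k - (k \<bullet> e) *\<^sub>R e) - k \<bullet> e) \<le> 0"
            using s k(2) by (intro mult_nonneg_nonpos) auto
          ultimately have "y + s *\<^sub>R k \<in> \<Omega>" using Omega_iff[OF d] True by linarith
          moreover have "y + s *\<^sub>R k \<in> near (frontier \<Omega>) b ((4 * L + 6) * \<rho> + \<rho>)"
            using True sk k(1) unfolding N_def
            by (intro near_step[of y]) (auto simp: dist_norm \<delta>1_def)
          ultimately show ?thesis by (simp add: V_def algebra_simps)
        qed
        then have "y \<in> seg_core k V" by (simp add: seg_core_def)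
        moreover from this have "y \<in> V" by (rule seg_core_self)
        moreover have "ennreal \<bar>w (y + k) - w y\<bar> \<le> ennreal \<bar>g (y + k) - g y\<bar> + ennreal (2 / q * norm k) * ennreal \<bar>g y\<bar>"
          unfolding w_def using bump_dist[OF q, of p "y + k" y] bump_bounds[of p q]
          by (intro mult_difference_le) (auto simp: dist_norm)
        ultimately show ?thesis using True by simp
      next
        case False
        show ?thesis
        proof (cases "dist y p < 2 * q")
          case True
          then have "y \<notin> {y \<in> N. depth y < 0}" using False by blast
          then show ?thesis by simp
        next
          case far: False
          then have "q \<le> dist (y + k) p"
            using dist_triangle[of y p "y + k"] k(1) by (simp add: dist_norm \<delta>1_def)
          then have "w (y + k) = 0" "w y = 0" using far q by (auto simp: w_def bump_eq_0[OF q])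
          then show ?thesis by simp
        qed
      qed
    qed (use diff[of k] L1 q \<open>0 \<le> c\<close> \<open>0 \<le> m\<close> in \<open>auto simp: V_def[symmetric]\<close>)
    then show ?thesis by (simp add: algebra_simps)
  qed
  define \<delta> where "\<delta> = \<delta>1 / (8 * L + 9)"
  have \<delta>1: "0 < \<delta>1" using q \<rho> by (simp add: \<delta>1_def)
  have \<delta>: "0 < \<delta>" using \<delta>1 L_nonneg by (simp add: \<delta>_def)
  show ?thesis
  proof (rule that[OF \<delta>])
    fix h :: 'a assume "norm h < \<delta>"
    then have h: "(8 * L + 9) * norm h < \<delta>1" using L_nonneg by (simp add: \<delta>_def field_simps)
    moreover have "1 * norm h \<le> (8 * L + 9) * norm h" using L_nonneg by (intro mult_right_mono) auto
    ultimately have hn: "norm h \<le> \<rho>" "norm h \<le> q" by (auto simp: \<delta>1_def)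
    have "(\<integral>\<^sup>+x. indicator (near (frontier \<Omega>) b \<rho>) x * ennreal \<bar>piece g (x + h) - piece g x\<bar> \<partial>lborel)
      \<le> (\<integral>\<^sup>+x. indicator {x. fold_up x \<in> N \<and> fold_up (x + h) \<in> N} x *
          ennreal \<bar>w (fold_up (x + h)) - w (fold_up x)\<bar> \<partial>lborel)"
    proof (rule nn_integral_mono)
      fix x
      show "indicator (near (frontier \<Omega>) b \<rho>) x * ennreal \<bar>piece g (x + h) - piece g x\<bar>
        \<le> indicator {x. fold_up x \<in> N \<and> fold_up (x + h) \<in> N} x * ennreal \<bar>w (fold_up (x + h)) - w (fold_up x)\<bar>"
      proof (cases "x \<in> near (frontier \<Omega>) b \<rho> \<and> (dist (fold_up x) p < q \<or> dist (fold_up (x + h)) p < q)")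
        case True
        then have "fold_up x \<in> N" "fold_up (x + h) \<in> N"
          using fold_up_near[OF _ \<rho>(2) hn, of x] by (auto simp: N_def)
        then show ?thesis using True by (simp add: w_def piece_def)
      next
        case False
        then show ?thesis by (auto simp: piece_def indicator_def not_less bump_eq_0[OF q])
      qed
    qed
    also have "\<dots> \<le> ennreal ((60 * L + 66) * (c + 2 / q * m) * norm h)"
      using w_diff h q \<open>0 \<le> c\<close> \<open>0 \<le> m\<close> by (intro fold_up_difference[where \<delta> = \<delta>1]) auto
    finally show "(\<integral>\<^sup>+x. indicator (near (frontier \<Omega>) b \<rho>) x * ennreal \<bar>piece g (x + h) - piece g x\<bar> \<partial>lborel)
      \<le> ennreal ((60 * L + 66) * (c + 2 / q * m) * norm h)" .
  qed
qed

end

section \<open>Gluing the pieces of finitely many patches\<close>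

text \<open>The form required of the extension: small increments in every direction from base points
  in \<open>X\<close>, with no condition on the segment. This is what
  \<open>integral_divergence_le\<close> consumes.\<close>

definition diff_bound :: "('a::euclidean_space \<Rightarrow> real) \<Rightarrow> 'a set \<Rightarrow> real \<Rightarrow> bool" where
  "diff_bound f X c \<longleftrightarrow> (\<exists>\<delta>>0. \<forall>h. norm h < \<delta> \<longrightarrow>
    (\<integral>\<^sup>+x. indicator X x * ennreal \<bar>f (x + h) - f x\<bar> \<partial>lborel) \<le> ennreal (c * norm h))"

text \<open>The form available for the given function: increments of any length along segments
  inside \<open>V\<close>, together with the mass in \<open>V\<close>.\<close>

definition bv_bound :: "('a::euclidean_space \<Rightarrow> real) \<Rightarrow> 'a set \<Rightarrow> real \<Rightarrow> real \<Rightarrow> bool" where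
  "bv_bound g V c m \<longleftrightarrow> g \<in> borel_measurable borel \<and> 0 \<le> c \<and> 0 \<le> m \<and>
    (\<forall>k. (\<integral>\<^sup>+y. indicator (seg_core k V) y * ennreal \<bar>g (y + k) - g y\<bar> \<partial>lborel) \<le> ennreal (c * norm k)) \<and>
    (\<integral>\<^sup>+y. indicator V y * ennreal \<bar>g y\<bar> \<partial>lborel) \<le> ennreal m"

lemma nn_integral_indicator_mono:
  assumes "A \<subseteq> B"
  shows "(\<integral>\<^sup>+y. indicator A y * f y \<partial>M) \<le> (\<integral>\<^sup>+y. indicator B y * f y \<partial>M)"
  using assms by (intro nn_integral_mono mult_right_mono) (auto simp: indicator_def)

lemma bv_bound_mono: "bv_bound g V' c m \<Longrightarrow> V \<subseteq> V' \<Longrightarrow> bv_bound g V c m"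
  unfolding bv_bound_def
  by (auto intro: order_trans[OF nn_integral_indicator_mono] order_trans[OF nn_integral_indicator_mono[OF seg_core_mono]])

lemma diff_bound_mono:
  assumes "diff_bound f X c" "c \<le> c'" shows "diff_bound f X c'"
proof -
  have "ennreal (c * norm h) \<le> ennreal (c' * norm h)" for h :: 'a
    using assms(2) by (intro ennreal_leI mult_right_mono) auto
  then show ?thesis using assms(1) unfolding diff_bound_def by (meson order_trans)
qed

lemma diff_bound_add:
  assumes f: "diff_bound f X c" and g: "diff_bound g X d"
    and [measurable]: "f \<in> borel_measurable borel" "g \<in> borel_measurable borel" "X \<in> sets borel"
    and nonneg: "0 \<le> c" "0 \<le> d"
  shows "diff_bound (\<lambda>x. f x + g x) X (c + d)"
proof -
  let ?I = "\<lambda>f h. \<integral>\<^sup>+x. indicator X x * ennreal \<bar>f (x + h) - f x\<bar> \<partial>lborel"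
  obtain \<delta> where \<delta>: "0 < \<delta>" "\<And>h. norm h < \<delta> \<Longrightarrow> ?I f h \<le> ennreal (c * norm h)"
    using f unfolding diff_bound_def by blast
  obtain \<delta>' where \<delta>': "0 < \<delta>'" "\<And>h. norm h < \<delta>' \<Longrightarrow> ?I g h \<le> ennreal (d * norm h)"
    using g unfolding diff_bound_def by blast
  have "?I (\<lambda>x. f x + g x) h \<le> ennreal ((c + d) * norm h)" if h: "norm h < min \<delta> \<delta>'" for h
  proof -
    have "?I (\<lambda>x. f x + g x) h \<le> ennreal (c * norm h + 1 * (d * norm h))"
    proof (rule nn_integral_combine)
      show "indicator X x * ennreal \<bar>f (x + h) + g (x + h) - (f x + g x)\<bar>
        \<le> indicator X x * ennreal \<bar>f (x + h) - f x\<bar> + ennreal 1 * (indicator X x * ennreal \<bar>g (x + h) - g x\<bar>)" for x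
      proof -
        have "ennreal \<bar>f (x + h) + g (x + h) - (f x + g x)\<bar> \<le> ennreal \<bar>f (x + h) - f x\<bar> + ennreal \<bar>g (x + h) - g x\<bar>"
          by (simp add: ennreal_plus[symmetric] ennreal_leI del: ennreal_plus)
        then show ?thesis by (simp add: indicator_def)
      qed
    qed (use \<delta>(2)[of h] \<delta>'(2)[of h] h nonneg in auto)
    then show ?thesis by (simp add: algebra_simps)
  qed
  then show ?thesis unfolding diff_bound_def using \<delta>(1) \<delta>'(1) by (intro exI[of _ "min \<delta> \<delta>'"]) auto
qed

lemma bv_bound_bump:
  assumes g: "bv_bound g V c m" and V: "open V" and q: "0 < q"
  shows "bv_bound (\<lambda>y. (1 - bump p q y) * g y) V (c + 2 / q * m) m"
proof -
  have [measurable]: "g \<in> borel_measurable borel" and nonneg: "0 \<le> c" "0 \<le> m" using g by (auto simp: bv_bound_def)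
  have [measurable]: "V \<in> sets borel" "seg_core k V \<in> sets borel" for k
    using V open_seg_core[OF V] by auto
  let ?\<theta> = "\<lambda>y. 1 - bump p q y"
  have "(\<integral>\<^sup>+y. indicator (seg_core k V) y * ennreal \<bar>?\<theta> (y + k) * g (y + k) - ?\<theta> y * g y\<bar> \<partial>lborel)
    \<le> ennreal ((c + 2 / q * m) * norm k)" for k
  proof -
    have "(\<integral>\<^sup>+y. indicator (seg_core k V) y * ennreal \<bar>?\<theta> (y + k) * g (y + k) - ?\<theta> y * g y\<bar> \<partial>lborel)
      \<le> ennreal (c * norm k + (2 / q * norm k) * m)"
    proof (rule nn_integral_combine)
      fix y
      show "indicator (seg_core k V) y * ennreal \<bar>?\<theta> (y + k) * g (y + k) - ?\<theta> y * g y\<bar>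
        \<le> indicator (seg_core k V) y * ennreal \<bar>g (y + k) - g y\<bar>
          + ennreal (2 / q * norm k) * (indicator V y * ennreal \<bar>g y\<bar>)"
      proof (cases "y \<in> seg_core k V")
        case True
        have "ennreal \<bar>?\<theta> (y + k) * g (y + k) - ?\<theta> y * g y\<bar>
          \<le> ennreal \<bar>g (y + k) - g y\<bar> + ennreal (2 / q * norm k) * ennreal \<bar>g y\<bar>"
          using bump_dist[OF q, of p "y + k" y] bump_bounds[of p q "y + k"]
          by (intro mult_difference_le) (auto simp: dist_norm abs_minus_commute)
        then show ?thesis using True seg_core_self[OF True] by simp
      qed simp
    qed (use g q nonneg in \<open>auto simp: bv_bound_def\<close>)
    then show ?thesis by (simp add: algebra_simps)
  qed
  moreover have "(\<integral>\<^sup>+y. indicator V y * ennreal \<bar>?\<theta> y * g y\<bar> \<partial>lborel) \<le> ennreal m"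
  proof -
    have "\<bar>?\<theta> y * g y\<bar> \<le> \<bar>g y\<bar>" for y
      using mult_right_mono[of "?\<theta> y" 1 "\<bar>g y\<bar>"] bump_bounds[of p q y] by (simp add: abs_mult)
    then have "(\<integral>\<^sup>+y. indicator V y * ennreal \<bar>?\<theta> y * g y\<bar> \<partial>lborel) \<le> (\<integral>\<^sup>+y. indicator V y * ennreal \<bar>g y\<bar> \<partial>lborel)"
      by (intro nn_integral_mono mult_left_mono ennreal_leI) auto
    then show ?thesis using g unfolding bv_bound_def by (blast intro: order_trans)
  qed
  ultimately show ?thesis unfolding bv_bound_def using nonneg q by auto
qed

lemma (in boundary_patch) piece_bound:
  assumes g: "bv_bound g (\<Omega> \<inter> near (frontier \<Omega>) b ((4 * L + 7) * \<rho>)) c m"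
    and zero: "\<And>x. x \<notin> \<Omega> \<Longrightarrow> g x = 0" and \<rho>: "0 < \<rho>" "b \<or> \<rho> \<le> q / 2"
  shows "diff_bound (piece g) (near (frontier \<Omega>) b \<rho>) ((60 * L + 66) * (c + 2 / q * m))"
    and "(\<integral>\<^sup>+x. indicator (near (frontier \<Omega>) b \<rho>) x * ennreal \<bar>piece g x\<bar> \<partial>lborel) \<le> ennreal (2 * m)"
proof -
  have [measurable]: "g \<in> borel_measurable borel" and nonneg: "0 \<le> c" "0 \<le> m" using g by (auto simp: bv_bound_def)
  show "diff_bound (piece g) (near (frontier \<Omega>) b \<rho>) ((60 * L + 66) * (c + 2 / q * m))"
    by (rule piece_difference[of g \<rho> b c m])
      (use \<rho> nonneg g in \<open>auto simp: bv_bound_def diff_bound_def\<close>)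
  show "(\<integral>\<^sup>+x. indicator (near (frontier \<Omega>) b \<rho>) x * ennreal \<bar>piece g x\<bar> \<partial>lborel) \<le> ennreal (2 * m)"
    using piece_L1[of g \<rho> b m] zero \<rho> nonneg g unfolding bv_bound_def
    by (simp add: ennreal_mult)
qed

type_synonym 'a patch = "'a \<times> ('a \<Rightarrow> real) \<times> real \<times> 'a \<times> real"

definition is_patch :: "'a::euclidean_space set \<Rightarrow> 'a set \<Rightarrow> 'a patch \<Rightarrow> bool" where
  "is_patch \<Omega> W = (\<lambda>(e, \<gamma>, L, p, q). boundary_patch e \<gamma> L \<Omega> W p q)"

text \<open>Each patch reflects the share \<open>bump\<close> of what the earlier patches left. The
  last term is \<open>g\<close> times the product of all \<open>1 - bump\<close>, kept unreflected;
  it vanishes near the frontier once the balls of radius \<open>q / 2\<close> cover a neighbourhood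
  of it.\<close>

primrec extend :: "'a::euclidean_space patch list \<Rightarrow> ('a \<Rightarrow> real) \<Rightarrow> 'a \<Rightarrow> real" where
  "extend [] g = g"
| "extend (P # Ps) g = (case P of (e, \<gamma>, L, p, q) \<Rightarrow>
     (\<lambda>x. boundary_patch.piece e \<gamma> p q g x + extend Ps (\<lambda>y. (1 - bump p q y) * g y) x))"

lemma extend_measurable:
  assumes "\<forall>P\<in>set Ps. is_patch \<Omega> W P" "g \<in> borel_measurable borel"
  shows "extend Ps g \<in> borel_measurable borel"
  using assms
proof (induction Ps arbitrary: g)
  case (Cons P Ps)
  obtain e \<gamma> L p q where P: "P = (e, \<gamma>, L, p, q)" by (cases P)
  interpret boundary_patch e \<gamma> L \<Omega> W p q using Cons.prems(1) by (simp add: P is_patch_def)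
  have [measurable]: "g \<in> borel_measurable borel" by (rule Cons.prems)
  have [measurable]: "extend Ps (\<lambda>y. (1 - bump p q y) * g y) \<in> borel_measurable borel"
    by (rule Cons.IH) (use Cons.prems in auto)
  show ?case by (simp add: P)
qed simp

lemma extend_outside:
  assumes "\<forall>P\<in>set Ps. is_patch \<Omega> W P" "x \<notin> W" "\<Omega> \<subseteq> W" "\<forall>x. x \<notin> \<Omega> \<longrightarrow> g x = 0"
  shows "extend Ps g x = 0"
  using assms
proof (induction Ps arbitrary: g)
  case (Cons P Ps)
  obtain e \<gamma> L p q where P: "P = (e, \<gamma>, L, p, q)" by (cases P)
  interpret boundary_patch e \<gamma> L \<Omega> W p q using Cons.prems(1) by (simp add: P is_patch_def)
  have "extend Ps (\<lambda>y. (1 - bump p q y) * g y) x = 0"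
    by (rule Cons.IH) (use Cons.prems in auto)
  then show ?case using Cons.prems by (simp add: P piece_outside)
qed auto

lemma extend_inside:
  assumes "\<forall>P\<in>set Ps. is_patch \<Omega> W P" "x \<in> \<Omega>"
  shows "extend Ps g x = g x"
  using assms
proof (induction Ps arbitrary: g)
  case (Cons P Ps)
  obtain e \<gamma> L p q where P: "P = (e, \<gamma>, L, p, q)" by (cases P)
  interpret boundary_patch e \<gamma> L \<Omega> W p q using Cons.prems(1) by (simp add: P is_patch_def)
  have "extend Ps (\<lambda>y. (1 - bump p q y) * g y) x = (1 - bump p q x) * g x"
    by (rule Cons.IH) (use Cons.prems in auto)
  then show ?case using Cons.prems by (simp add: P piece_inside algebra_simps)
qed auto

lemma extend_add:
  assumes "\<forall>P\<in>set Ps. is_patch \<Omega> W P"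
  shows "extend Ps (\<lambda>x. f x + g x) x = extend Ps f x + extend Ps g x"
  using assms
proof (induction Ps arbitrary: f g)
  case (Cons P Ps)
  obtain e \<gamma> L p q where P: "P = (e, \<gamma>, L, p, q)" by (cases P)
  interpret boundary_patch e \<gamma> L \<Omega> W p q using Cons.prems by (simp add: P is_patch_def)
  show ?case using Cons by (simp add: P piece_def distrib_left)
qed auto

lemma extend_cmult:
  assumes "\<forall>P\<in>set Ps. is_patch \<Omega> W P"
  shows "extend Ps (\<lambda>x. c * f x) x = c * extend Ps f x"
  using assms
proof (induction Ps arbitrary: f)
  case (Cons P Ps)
  obtain e \<gamma> L p q where P: "P = (e, \<gamma>, L, p, q)" by (cases P)
  interpret boundary_patch e \<gamma> L \<Omega> W p q using Cons.prems by (simp add: P is_patch_def)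
  have "(\<lambda>y. (1 - bump p q y) * (c * f y)) = (\<lambda>y. c * ((1 - bump p q y) * f y))" by (simp add: mult.left_commute)
  moreover have "extend Ps (\<lambda>y. c * ((1 - bump p q y) * f y)) x = c * extend Ps (\<lambda>y. (1 - bump p q y) * f y) x"
    by (rule Cons.IH) (use Cons.prems in auto)
  ultimately show ?case by (simp add: P piece_def distrib_left mult.left_commute)
qed auto

lemma extend_AE:
  assumes "\<forall>P\<in>set Ps. is_patch \<Omega> W P" "AE x in lborel. f x = g x"
  shows "AE x in lborel. extend Ps f x = extend Ps g x"
  using assms
proof (induction Ps arbitrary: f g)
  case (Cons P Ps)
  obtain e \<gamma> L p q where P: "P = (e, \<gamma>, L, p, q)" by (cases P)
  interpret boundary_patch e \<gamma> L \<Omega> W p q using Cons.prems(1) by (simp add: P is_patch_def)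
  have "AE x in lborel. extend Ps (\<lambda>y. (1 - bump p q y) * f y) x = extend Ps (\<lambda>y. (1 - bump p q y) * g y) x"
  proof (rule Cons.IH)
    show "AE x in lborel. (1 - bump p q x) * f x = (1 - bump p q x) * g x"
      using Cons.prems(2) by eventually_elim simp
  qed (use Cons.prems in auto)
  moreover have "AE x in lborel. f (fold_up x) = g (fold_up x)" by (rule AE_fold_up[OF Cons.prems(2)])
  ultimately show ?case by eventually_elim (simp add: P piece_def)
qed auto

text \<open>If a short step starts or ends in \<Omega> and its segment leaves \<Omega>, the segment
  meets the frontier. Both endpoints are then within \<epsilon> of the frontier, where
  \<open>g\<close> vanishes. Extension by zero thus creates no jump.\<close>

lemma diff_bound_of_zero_near_frontier:
  fixes g :: "'a::euclidean_space \<Rightarrow> real"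
  assumes g: "bv_bound g (\<Omega> \<inter> near (frontier \<Omega>) b (2 * \<rho>)) c m" and "0 < \<rho>" "0 < \<epsilon>"
    and zero: "\<And>x. x \<notin> \<Omega> \<Longrightarrow> g x = 0" "\<And>x. x \<in> near (frontier \<Omega>) False \<epsilon> \<Longrightarrow> g x = 0"
  shows "diff_bound g (near (frontier \<Omega>) b \<rho>) c"
  unfolding diff_bound_def
proof (intro exI[of _ "min \<epsilon> \<rho>"] conjI allI impI)
  fix h :: 'a assume h: "norm h < min \<epsilon> \<rho>"
  define V where "V = \<Omega> \<inter> near (frontier \<Omega>) b (2 * \<rho>)"
  have "(\<integral>\<^sup>+x. indicator (near (frontier \<Omega>) b \<rho>) x * ennreal \<bar>g (x + h) - g x\<bar> \<partial>lborel)
    \<le> (\<integral>\<^sup>+x. indicator (seg_core h V) x * ennreal \<bar>g (x + h) - g x\<bar> \<partial>lborel)"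
  proof (rule nn_integral_mono)
    fix x
    have "g x = 0 \<and> g (x + h) = 0" if x: "x \<in> near (frontier \<Omega>) b \<rho>" "x \<notin> seg_core h V"
    proof (cases "x \<in> \<Omega> \<or> x + h \<in> \<Omega>")
      case True
      obtain s where s: "s \<in> {0..1}" "x + s *\<^sub>R h \<notin> V" using x(2) by (auto simp: seg_core_def)
      have sh: "norm (s *\<^sub>R h) \<le> norm h" if "s \<in> {0..1}" for s
        using that mult_right_mono[of s 1 "norm h"] by simp
      \<comment> \<open>Nearness to the frontier survives along the segment, so that leaving
        \<open>V\<close> means leaving \<Omega>.\<close>
      have "x + s *\<^sub>R h \<in> near (frontier \<Omega>) b (\<rho> + \<rho>)"
        using x(1) sh[OF s(1)] h by (intro near_step) (auto simp: dist_norm)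
      then have out: "x + s *\<^sub>R h \<notin> \<Omega>" using s(2) by (simp add: V_def)
      let ?S = "(\<lambda>s. x + s *\<^sub>R h) ` {0..1}"
      have "connected ?S" by (intro connected_continuous_image continuous_intros) auto
      moreover have "x \<in> ?S" by (intro image_eqI[of _ _ 0]) auto
      moreover have "x + h \<in> ?S" by (intro image_eqI[of _ _ 1]) auto
      moreover have "x + s *\<^sub>R h \<in> ?S" using s(1) by auto
      ultimately have "?S \<inter> frontier \<Omega> \<noteq> {}"
        using True out by (intro connected_Int_frontier) auto
      then obtain t where t: "t \<in> {0..1}" "x + t *\<^sub>R h \<in> frontier \<Omega>" by blast
      have "dist x (x + t *\<^sub>R h) < \<epsilon>" using sh[OF t(1)] h by (simp add: dist_norm)
      moreover have "dist (x + h) (x + t *\<^sub>R h) < \<epsilon>"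
      proof -
        have "dist (x + h) (x + t *\<^sub>R h) = norm ((1 - t) *\<^sub>R h)" by (simp add: dist_norm algebra_simps)
        also have "\<dots> \<le> norm h" using t(1) by (intro sh) auto
        finally show ?thesis using h by simp
      qed
      ultimately have "x \<in> near (frontier \<Omega>) False \<epsilon>" "x + h \<in> near (frontier \<Omega>) False \<epsilon>"
        using t(2) unfolding near_def by blast+
      then show ?thesis using zero(2) by blast
    qed (use zero(1) in auto)
    then show "indicator (near (frontier \<Omega>) b \<rho>) x * ennreal \<bar>g (x + h) - g x\<bar>
      \<le> indicator (seg_core h V) x * ennreal \<bar>g (x + h) - g x\<bar>"
      by (auto simp: indicator_def)
  qed
  also have "\<dots> \<le> ennreal (c * norm h)" using g by (auto simp: bv_bound_def V_def)
  finally show "(\<integral>\<^sup>+x. indicator (near (frontier \<Omega>) b \<rho>) x * ennreal \<bar>g (x + h) - g x\<bar> \<partial>lborel) \<le> ennreal (c * norm h)" .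
qed (use assms in auto)

text \<open>The third hypothesis on \<open>g\<close> makes the induction work. Multiplication by
  \<open>1 - bump\<close> kills the function where the current bump is 1, so for the tail only the
  remaining balls need to be exempted. For the empty list the hypothesis says that \<open>g\<close>
  vanishes near the frontier; for a list whose balls cover the \<epsilon>-neighbourhood of the
  frontier it holds vacuously.\<close>

lemma extend_bound:
  fixes \<Omega> :: "'a::euclidean_space set"
  assumes "\<forall>P\<in>set Ps. is_patch \<Omega> W P" and \<Omega>: "open \<Omega>" and \<epsilon>: "0 < \<epsilon>"
  shows "\<exists>C K \<rho>\<^sub>0. 0 < C \<and> 0 \<le> K \<and> 0 < \<rho>\<^sub>0 \<and> (\<forall>g b \<rho> c m.
    bv_bound g (\<Omega> \<inter> near (frontier \<Omega>) b (C * \<rho>)) c m \<longrightarrow> (\<forall>x. x \<notin> \<Omega> \<longrightarrow> g x = 0) \<longrightarrow>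
    (\<forall>x\<in>near (frontier \<Omega>) False \<epsilon>. (\<forall>(e, \<gamma>, L, p, q)\<in>set Ps. q / 2 \<le> dist x p) \<longrightarrow> g x = 0) \<longrightarrow>
    0 < \<rho> \<longrightarrow> b \<or> \<rho> \<le> \<rho>\<^sub>0 \<longrightarrow>
    diff_bound (extend Ps g) (near (frontier \<Omega>) b \<rho>) (K * (c + m)) \<and>
    (\<integral>\<^sup>+x. indicator (near (frontier \<Omega>) b \<rho>) x * ennreal \<bar>extend Ps g x\<bar> \<partial>lborel) \<le> ennreal (K * m))"
  using assms(1)
proof (induction Ps)
  case Nil
  have "diff_bound g (near (frontier \<Omega>) b \<rho>) (1 * (c + m)) \<and>
    (\<integral>\<^sup>+x. indicator (near (frontier \<Omega>) b \<rho>) x * ennreal \<bar>g x\<bar> \<partial>lborel) \<le> ennreal (1 * m)"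
    if g: "bv_bound g (\<Omega> \<inter> near (frontier \<Omega>) b (2 * \<rho>)) c m" and zero: "\<forall>x. x \<notin> \<Omega> \<longrightarrow> g x = 0"
      "\<forall>x\<in>near (frontier \<Omega>) False \<epsilon>. g x = 0" and \<rho>: "0 < \<rho>" for g b \<rho> c m
  proof
    have "diff_bound g (near (frontier \<Omega>) b \<rho>) c"
      using zero by (intro diff_bound_of_zero_near_frontier[OF g \<rho> \<epsilon>]) auto
    then show "diff_bound g (near (frontier \<Omega>) b \<rho>) (1 * (c + m))"
      by (rule diff_bound_mono) (use g in \<open>simp add: bv_bound_def\<close>)
    have "(\<integral>\<^sup>+x. indicator (near (frontier \<Omega>) b \<rho>) x * ennreal \<bar>g x\<bar> \<partial>lborel)
      \<le> (\<integral>\<^sup>+x. indicator (\<Omega> \<inter> near (frontier \<Omega>) b (2 * \<rho>)) x * ennreal \<bar>g x\<bar> \<partial>lborel)"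
    proof (rule nn_integral_mono)
      fix x
      have "near (frontier \<Omega>) b \<rho> \<subseteq> near (frontier \<Omega>) b (2 * \<rho>)" using \<rho> by (intro near_mono) auto
      then show "indicator (near (frontier \<Omega>) b \<rho>) x * ennreal \<bar>g x\<bar>
        \<le> indicator (\<Omega> \<inter> near (frontier \<Omega>) b (2 * \<rho>)) x * ennreal \<bar>g x\<bar>"
        using zero by (auto simp: indicator_def)
    qed
    then show "(\<integral>\<^sup>+x. indicator (near (frontier \<Omega>) b \<rho>) x * ennreal \<bar>g x\<bar> \<partial>lborel) \<le> ennreal (1 * m)"
      using g by (auto simp: bv_bound_def)
  qed
  then show ?case
    by (intro exI[of _ 2] exI[of _ 1]) (auto simp del: mult_1)
next
  case (Cons P Ps)
  obtain e \<gamma> L p q where P: "P = (e, \<gamma>, L, p, q)" by (cases P)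
  interpret boundary_patch e \<gamma> L \<Omega> W p q using Cons.prems by (simp add: P is_patch_def)
  obtain C K \<rho>\<^sub>0 where CK: "0 < C" "0 \<le> K" "0 < \<rho>\<^sub>0" and IH: "\<And>g b \<rho> c m.
    bv_bound g (\<Omega> \<inter> near (frontier \<Omega>) b (C * \<rho>)) c m \<Longrightarrow> (\<forall>x. x \<notin> \<Omega> \<longrightarrow> g x = 0) \<Longrightarrow>
    (\<forall>x\<in>near (frontier \<Omega>) False \<epsilon>. (\<forall>(e, \<gamma>, L, p, q)\<in>set Ps. q / 2 \<le> dist x p) \<longrightarrow> g x = 0) \<Longrightarrow>
    0 < \<rho> \<Longrightarrow> b \<or> \<rho> \<le> \<rho>\<^sub>0 \<Longrightarrow>
    diff_bound (extend Ps g) (near (frontier \<Omega>) b \<rho>) (K * (c + m)) \<and>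
    (\<integral>\<^sup>+x. indicator (near (frontier \<Omega>) b \<rho>) x * ennreal \<bar>extend Ps g x\<bar> \<partial>lborel) \<le> ennreal (K * m)"
    using Cons by force
  \<comment> \<open>\<open>C'\<close> is wide enough for the head, which needs
    \<open>4 * L + 7\<close>, and for the tail. \<open>K'\<close> adds both bounds; the slope of the
    cut-off has raised the variation bound passed to the tail from \<open>c\<close> to
    \<open>c + 2 / q * m\<close>.\<close>
  define C' where "C' = max C (4 * L + 7)"
  define K' where "K' = (60 * L + 66) * (1 + 2 / q) + K * (2 + 2 / q)"
  define \<rho>' where "\<rho>' = min \<rho>\<^sub>0 (q / 2)"
  have "diff_bound (extend (P # Ps) g) (near (frontier \<Omega>) b \<rho>) (K' * (c + m)) \<and>
    (\<integral>\<^sup>+x. indicator (near (frontier \<Omega>) b \<rho>) x * ennreal \<bar>extend (P # Ps) g x\<bar> \<partial>lborel) \<le> ennreal (K' * m)"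
    if g: "bv_bound g (\<Omega> \<inter> near (frontier \<Omega>) b (C' * \<rho>)) c m" and zero: "\<forall>x. x \<notin> \<Omega> \<longrightarrow> g x = 0"
      "\<forall>x\<in>near (frontier \<Omega>) False \<epsilon>. (\<forall>(e, \<gamma>, L, p, q)\<in>set (P # Ps). q / 2 \<le> dist x p) \<longrightarrow> g x = 0"
      and \<rho>: "0 < \<rho>" "b \<or> \<rho> \<le> \<rho>'" for g b \<rho> c m
  proof -
    define g' where "g' y = (1 - bump p q y) * g y" for y
    have [measurable]: "g \<in> borel_measurable borel" and nonneg: "0 \<le> c" "0 \<le> m" using g by (auto simp: bv_bound_def)
    have [measurable]: "g' \<in> borel_measurable borel" unfolding g'_def by measurable
    have [measurable]: "extend Ps g' \<in> borel_measurable borel"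
      by (rule extend_measurable) (use Cons.prems in auto)
    have [measurable]: "near (frontier \<Omega>) b r \<in> sets borel" for r by (intro borel_open open_near)
    have sub: "\<Omega> \<inter> near (frontier \<Omega>) b (r * \<rho>) \<subseteq> \<Omega> \<inter> near (frontier \<Omega>) b (C' * \<rho>)" if "r \<le> C'" for r
      using that \<rho>(1) by (intro Int_mono near_mono mult_right_mono) auto
    have g1: "bv_bound g (\<Omega> \<inter> near (frontier \<Omega>) b ((4 * L + 7) * \<rho>)) c m"
      by (rule bv_bound_mono[OF g sub]) (simp add: C'_def)
    have g2: "bv_bound g' (\<Omega> \<inter> near (frontier \<Omega>) b (C * \<rho>)) (c + 2 / q * m) m"
      unfolding g'_def
      by (intro bv_bound_bump bv_bound_mono[OF g sub] open_Int \<Omega> open_near q) (simp add: C'_def)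
    have head: "diff_bound (piece g) (near (frontier \<Omega>) b \<rho>) ((60 * L + 66) * (c + 2 / q * m))"
      "(\<integral>\<^sup>+x. indicator (near (frontier \<Omega>) b \<rho>) x * ennreal \<bar>piece g x\<bar> \<partial>lborel) \<le> ennreal (2 * m)"
      using piece_bound[OF g1] zero(1) \<rho> by (auto simp: \<rho>'_def)
    have "\<forall>x\<in>near (frontier \<Omega>) False \<epsilon>. (\<forall>(e, \<gamma>, L, p, q)\<in>set Ps. q / 2 \<le> dist x p) \<longrightarrow> g' x = 0"
    proof (intro ballI impI)
      fix x assume x: "x \<in> near (frontier \<Omega>) False \<epsilon>" "\<forall>(e, \<gamma>, L, p, q)\<in>set Ps. q / 2 \<le> dist x p"
      show "g' x = 0"
      proof (cases "dist x p < q / 2")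
        case True
        then show ?thesis using bump_eq_1[OF q True] by (simp add: g'_def)
      next
        case False
        then have "\<forall>(e, \<gamma>, L, p, q)\<in>set (P # Ps). q / 2 \<le> dist x p" using x(2) by (simp add: P)
        then show ?thesis using zero(2) x(1) by (simp add: g'_def)
      qed
    qed
    then have tail: "diff_bound (extend Ps g') (near (frontier \<Omega>) b \<rho>) (K * (c + 2 / q * m + m))"
      "(\<integral>\<^sup>+x. indicator (near (frontier \<Omega>) b \<rho>) x * ennreal \<bar>extend Ps g' x\<bar> \<partial>lborel) \<le> ennreal (K * m)"
      using IH[OF g2] zero(1) \<rho> by (auto simp: g'_def \<rho>'_def)
    have ext: "extend (P # Ps) g = (\<lambda>x. piece g x + extend Ps g' x)"
      by (simp add: P g'_def[abs_def])
    have q2: "0 \<le> 2 / q" using q by simp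
    have cm: "c + 2 / q * m \<le> (1 + 2 / q) * (c + m)" "c + 2 / q * m + m \<le> (2 + 2 / q) * (c + m)"
      using nonneg mult_nonneg_nonneg[OF q2 nonneg(1)] by (simp_all add: distrib_left distrib_right)
    have "diff_bound (extend (P # Ps) g) (near (frontier \<Omega>) b \<rho>)
        ((60 * L + 66) * (c + 2 / q * m) + K * (c + 2 / q * m + m))"
      unfolding ext using head(1) tail(1) nonneg q2 L_nonneg CK(2)
      by (intro diff_bound_add mult_nonneg_nonneg add_nonneg_nonneg) auto
    moreover have "(60 * L + 66) * (c + 2 / q * m) + K * (c + 2 / q * m + m)
        \<le> (60 * L + 66) * ((1 + 2 / q) * (c + m)) + K * ((2 + 2 / q) * (c + m))"
      using cm L_nonneg CK(2) by (intro add_mono mult_left_mono) auto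
    moreover have "\<dots> = K' * (c + m)" by (simp add: K'_def algebra_simps)
    ultimately have 1: "diff_bound (extend (P # Ps) g) (near (frontier \<Omega>) b \<rho>) (K' * (c + m))"
      by (auto intro: diff_bound_mono)
    have "(\<integral>\<^sup>+x. indicator (near (frontier \<Omega>) b \<rho>) x * ennreal \<bar>extend (P # Ps) g x\<bar> \<partial>lborel)
      \<le> ennreal (2 * m + 1 * (K * m))"
    proof (rule nn_integral_combine)
      fix x
      have "ennreal \<bar>extend (P # Ps) g x\<bar> \<le> ennreal \<bar>piece g x\<bar> + ennreal \<bar>extend Ps g' x\<bar>"
        unfolding ext by (simp add: ennreal_plus[symmetric] ennreal_leI del: ennreal_plus)
      then show "indicator (near (frontier \<Omega>) b \<rho>) x * ennreal \<bar>extend (P # Ps) g x\<bar>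
        \<le> indicator (near (frontier \<Omega>) b \<rho>) x * ennreal \<bar>piece g x\<bar>
          + ennreal 1 * (indicator (near (frontier \<Omega>) b \<rho>) x * ennreal \<bar>extend Ps g' x\<bar>)"
        by (simp add: indicator_def)
    qed (use head(2) tail(2) nonneg CK(2) in auto)
    also have "\<dots> \<le> ennreal (K' * m)"
    proof (rule ennreal_leI)
      have "2 * m + K * m \<le> (60 * L + 66) * (1 + 2 / q) * m + K * (2 + 2 / q) * m"
      proof (intro add_mono mult_right_mono nonneg)
        have "2 * 1 \<le> (60 * L + 66) * (1 + 2 / q)" using L_nonneg q2 by (intro mult_mono) auto
        then show "2 \<le> (60 * L + 66) * (1 + 2 / q)" by simp
        show "K \<le> K * (2 + 2 / q)" using mult_left_mono[of 1 "2 + 2 / q" K] CK(2) q2 by simp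
      qed
      then show "2 * m + 1 * (K * m) \<le> K' * m" by (simp add: K'_def algebra_simps)
    qed
    finally show ?thesis using 1 by blast
  qed
  moreover have "0 < C'" "0 \<le> K'" "0 < \<rho>'"
    using CK q L_nonneg by (auto simp: C'_def K'_def \<rho>'_def)
  ultimately show ?case by (intro exI[of _ C'] exI[of _ K'] exI[of _ \<rho>']) blast
qed

section \<open>Covering the frontier by boundary patches\<close>

text \<open>The compact frontier is covered by balls of radius \<open>q / 2\<close> because that is
  where \<open>bump\<close> equals 1. Compactness also yields a whole \<epsilon>-neighbourhood
  inside the finite union.\<close>

lemma exists_patches:
  fixes \<Omega> :: "(real^'n) set"
  assumes \<Omega>: "open \<Omega>" "bounded \<Omega>" "lipschitz_boundary \<Omega>" and W: "open W" "closure \<Omega> \<subseteq> W"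
  obtains Ps \<epsilon> where "\<forall>P\<in>set Ps. is_patch \<Omega> W P" "0 < \<epsilon>"
    "\<And>x. x \<in> near (frontier \<Omega>) False \<epsilon> \<Longrightarrow> \<exists>(e, \<gamma>, L, p, q)\<in>set Ps. dist x p < q / 2"
proof -
  have "\<exists>e \<gamma> L q. boundary_patch e \<gamma> L \<Omega> W p q" if p: "p \<in> frontier \<Omega>" for p
  proof -
    obtain r e \<gamma> L where r: "0 < r" "norm e = 1" "L-lipschitz_on {y. y \<bullet> e = 0} \<gamma>"
      "\<Omega> \<inter> ball p r = {y \<in> ball p r. \<gamma> (y - (y \<bullet> e) *\<^sub>R e) < y \<bullet> e}"
      using \<Omega>(3) p unfolding lipschitz_boundary_def by blast
    have "p \<in> W" using p W(2) by (auto simp: frontier_def)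
    then obtain s where s: "0 < s" "ball p s \<subseteq> W" using W(1) open_contains_ball by blast
    have L: "0 \<le> L" using r(3) by (rule lipschitz_on_nonneg)
    \<comment> \<open>The enlarged ball of radius \<open>(2 * L + 5) * q\<close> then fits both into
      the chart and into \<open>W\<close>.\<close>
    define q where "q = min r s / (2 * L + 5)"
    have q: "0 < q" "(2 * L + 5) * q = min r s" using r(1) s(1) L by (auto simp: q_def)
    have "\<Omega> \<inter> ball p (min r s) = (\<Omega> \<inter> ball p r) \<inter> ball p (min r s)" by auto
    also have "\<dots> = {y \<in> ball p (min r s). \<gamma> (y - (y \<bullet> e) *\<^sub>R e) < y \<bullet> e}" unfolding r(4) by auto
    finally have "boundary_patch e \<gamma> L \<Omega> W p q"
      using r s q \<Omega>(1) p by unfold_locales auto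
    then show ?thesis by blast
  qed
  then obtain E G LL Q where pt: "\<And>p. p \<in> frontier \<Omega> \<Longrightarrow> boundary_patch (E p) (G p) (LL p) \<Omega> W p (Q p)"
    by metis
  have Q: "0 < Q p" if "p \<in> frontier \<Omega>" for p
    using pt[OF that] by (simp add: boundary_patch_def boundary_patch_axioms_def)
  have cf: "compact (frontier \<Omega>)" using \<Omega>(2) by (simp add: compact_frontier_bounded)
  have "frontier \<Omega> \<subseteq> (\<Union>p\<in>frontier \<Omega>. ball p (Q p / 2))" using Q by force
  then obtain D where D: "D \<subseteq> frontier \<Omega>" "finite D" "frontier \<Omega> \<subseteq> (\<Union>p\<in>D. ball p (Q p / 2))"
    using compactE_image[OF cf, of "frontier \<Omega>" "\<lambda>p. ball p (Q p / 2)"] by auto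
  obtain ds where ds: "set ds = D" using finite_list[OF D(2)] by blast
  obtain \<epsilon> where \<epsilon>: "0 < \<epsilon>" "(\<Union>x\<in>frontier \<Omega>. ball x \<epsilon>) \<subseteq> (\<Union>p\<in>D. ball p (Q p / 2))"
    by (rule compact_subset_open_imp_ball_epsilon_subset[OF cf _ D(3)]) auto
  define Ps where "Ps = map (\<lambda>p. (E p, G p, LL p, p, Q p)) ds"
  show ?thesis
  proof
    show "\<forall>P\<in>set Ps. is_patch \<Omega> W P" using pt D(1) by (auto simp: Ps_def is_patch_def ds)
    show "0 < \<epsilon>" by (rule \<epsilon>)
    fix x assume "x \<in> near (frontier \<Omega>) False \<epsilon>"
    then have "x \<in> (\<Union>x\<in>frontier \<Omega>. ball x \<epsilon>)" by (auto simp: near_def dist_commute)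
    then obtain p where "p \<in> D" "x \<in> ball p (Q p / 2)" using \<epsilon>(2) by blast
    then have "p \<in> D" "dist x p < Q p / 2" by (auto simp: dist_commute)
    then show "\<exists>(e, \<gamma>, L, p, q)\<in>set Ps. dist x p < q / 2"
      by (intro bexI[of _ "(E p, G p, LL p, p, Q p)"]) (auto simp: Ps_def ds)
  qed
qed

section \<open>The functionals \<open>C1\<close> and \<open>C2\<close> in terms of Borel
  functions\<close>

lemma Ck_vf_add:
  fixes \<phi> \<psi> :: "real^'n \<Rightarrow> real^'n"
  shows "Ck_vf k \<phi> \<Longrightarrow> Ck_vf k \<psi> \<Longrightarrow> Ck_vf k (\<lambda>x. \<phi> x + \<psi> x)"
proof (induction k arbitrary: \<phi> \<psi>)
  case (Suc k)
  have d: "((\<lambda>x. \<phi> x + \<psi> x) has_derivative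
      (\<lambda>h. frechet_derivative \<phi> (at x) h + frechet_derivative \<psi> (at x) h)) (at x)" for x
    using Suc.prems by (intro has_derivative_add) (auto simp: frechet_derivative_works[symmetric])
  show ?case
    using Suc.prems Suc.IH differentiableI[OF d] by (simp add: frechet_derivative_at[OF d, symmetric])
qed (simp add: continuous_on_add)

lemma divergence_add:
  fixes \<phi> \<psi> :: "real^'n \<Rightarrow> real^'n"
  assumes "\<phi> \<in> test_fields V" "\<psi> \<in> test_fields V'"
  shows "divergence (\<lambda>x. \<phi> x + \<psi> x) x = divergence \<phi> x + divergence \<psi> x"
proof -
  have "Ck_vf (Suc 0) \<phi>" "Ck_vf (Suc 0) \<psi>" using assms by (auto simp: test_fields_def)
  then have d: "((\<lambda>x. \<phi> x + \<psi> x) has_derivative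
      (\<lambda>h. frechet_derivative \<phi> (at x) h + frechet_derivative \<psi> (at x) h)) (at x)"
    by (intro has_derivative_add) (auto simp: frechet_derivative_works[symmetric])
  show ?thesis
    by (simp add: divergence_def frechet_derivative_at[OF d, symmetric] sum.distrib)
qed

lemma test_fields_add:
  fixes \<phi> \<psi> :: "real^'n \<Rightarrow> real^'n"
  assumes \<phi>: "\<phi> \<in> test_fields V" and \<psi>: "\<psi> \<in> test_fields V"
  shows "(\<lambda>x. \<phi> x + \<psi> x) \<in> test_fields V"
proof -
  have "closure {x. \<phi> x + \<psi> x \<noteq> 0} \<subseteq> closure ({x. \<phi> x \<noteq> 0} \<union> {x. \<psi> x \<noteq> 0})"
    by (intro closure_mono) auto
  then have sub: "closure {x. \<phi> x + \<psi> x \<noteq> 0} \<subseteq> closure {x. \<phi> x \<noteq> 0} \<union> closure {x. \<psi> x \<noteq> 0}" by simp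
  have c: "compact (closure {x. \<phi> x \<noteq> 0} \<union> closure {x. \<psi> x \<noteq> 0})"
    using assms by (auto simp: test_fields_def)
  have "compact (closure {x. \<phi> x + \<psi> x \<noteq> 0})"
    using compact_Int_closed[OF c closed_closure, of "{x. \<phi> x + \<psi> x \<noteq> 0}"] sub by (simp add: Int_absorb1)
  then show ?thesis using assms sub by (auto simp: test_fields_def intro: Ck_vf_add)
qed

lemma test_fields_mono: "V \<subseteq> V' \<Longrightarrow> test_fields V \<subseteq> test_fields V'"
  by (auto simp: test_fields_def)

text \<open>Multiplication by -i turns the imaginary part into the real part and the real part into
  minus the imaginary part. The basic estimates are therefore proved for \<open>C1\<close> and
  transferred to \<open>C2\<close>.\<close>

lemma C2_eq_C1: "C2 A u V = C1 A (\<lambda>x. - \<i> * u x) V"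
  by (simp add: C1_def C2_def)

lemma C1_nonneg:
  fixes A :: "real^'n \<Rightarrow> real^'n"
  shows "0 \<le> C1 A u V"
proof -
  have z: "Ck_vf k (\<lambda>x::real^'n. 0)" for k
    by (induction k) auto
  then have "(\<lambda>x. 0) \<in> test_fields V" by (simp add: test_fields_def)
  moreover have "divergence (\<lambda>x::real^'n. 0) x = 0" for x by (simp add: divergence_def)
  ultimately show ?thesis unfolding C1_def
    by (intro SUP_upper2[of "\<lambda>x. 0"]) (auto simp: set_lebesgue_integral_def)
qed

lemma measurable_inner_test_field:
  assumes "continuous_on UNIV A" "\<phi> \<in> test_fields V"
  shows "(\<lambda>x. A x \<bullet> \<phi> x) \<in> borel_measurable borel"
  by (intro borel_measurable_continuous_onI continuous_on_inner assms(1) test_field_continuous[OF assms(2)])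

lemma integrable_inner_test_field:
  fixes A \<phi> :: "real^'n \<Rightarrow> real^'n"
  assumes A: "continuous_on UNIV A" and \<phi>: "\<phi> \<in> test_fields V" and g: "integrable lborel g"
  shows "integrable lborel (\<lambda>x. g x * (A x \<bullet> \<phi> x))"
proof -
  have cs: "compact (closure {x. \<phi> x \<noteq> 0})" using \<phi> by (simp add: test_fields_def)
  have cont: "continuous_on UNIV (\<lambda>x. A x \<bullet> \<phi> x)"
    by (intro continuous_on_inner A test_field_continuous[OF \<phi>])
  have zero: "A x \<bullet> \<phi> x = 0" if "x \<notin> closure {x. \<phi> x \<noteq> 0}" for x
  proof -
    have "\<phi> x = 0" using that closure_subset[of "{x. \<phi> x \<noteq> 0}"] by blast
    then show ?thesis by simp
  qed
  obtain B where "\<And>x. \<bar>A x \<bullet> \<phi> x\<bar> \<le> B"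
    by (rule bounded_of_compact_support[OF cont cs zero]) blast+
  then show ?thesis
    using measurable_inner_test_field[OF A \<phi>] by (intro integrable_mult_bounded[OF g]) auto
qed

lemma integrable_divergence:
  assumes \<phi>: "\<phi> \<in> test_fields V" and f: "integrable lborel f"
  shows "integrable lborel (\<lambda>x. f x * divergence \<phi> x)"
proof -
  obtain B where B: "\<And>x. \<bar>divergence \<phi> x\<bar> \<le> B" using test_field_divergence(3)[OF \<phi>] by blast
  have "divergence \<phi> \<in> borel_measurable borel"
    by (rule borel_measurable_continuous_onI[OF test_field_divergence(1)[OF \<phi>]])
  then show ?thesis by (intro integrable_mult_bounded[OF f _ B]) simp
qed

text \<open>The test field and its divergence vanish off \<open>V\<close>, so the integral may be
  taken over the whole space whatever \<open>f\<close> and \<open>g\<close> do off \<open>V\<close>.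
  In \<open>lborel\<close> the tools for translation and folding of Borel functions apply.\<close>

lemma C1_integrand:
  fixes u :: "real^'n \<Rightarrow> complex"
  assumes A: "continuous_on UNIV A" and \<phi>: "\<phi> \<in> test_fields V"
    and f: "integrable lborel f" and g: "integrable lborel g"
    and u: "AE x in lborel. x \<in> V \<longrightarrow> Re (u x) = f x \<and> Im (u x) = g x"
  shows "(LINT x:V|lebesgue. Re (u x) * divergence \<phi> x - (A x \<bullet> \<phi> x) * Im (u x))
    = (\<integral>x. f x * divergence \<phi> x \<partial>lborel) - (\<integral>x. g x * (A x \<bullet> \<phi> x) \<partial>lborel)"
proof -
  let ?l = "\<lambda>x. indicator V x *\<^sub>R (Re (u x) * divergence \<phi> x - (A x \<bullet> \<phi> x) * Im (u x))"
  let ?r = "\<lambda>x. f x * divergence \<phi> x - g x * (A x \<bullet> \<phi> x)"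
  have "AE x in lborel. ?r x = ?l x"
    using u by eventually_elim
      (auto simp: indicator_def test_field_zero[OF \<phi>] test_field_divergence(2)[OF \<phi>])
  then have ae: "AE x in lebesgue. ?r x = ?l x" by (rule AE_completion)
  have r: "integrable lborel ?r"
    by (intro Bochner_Integration.integrable_diff integrable_divergence[OF \<phi> f] integrable_inner_test_field[OF A \<phi> g])
  then have m: "?r \<in> borel_measurable lborel" by (rule borel_measurable_integrable)
  then have ml: "?r \<in> borel_measurable lebesgue" by (rule measurable_completion)
  have "integral\<^sup>L lebesgue ?l = integral\<^sup>L lebesgue ?r"
    using borel_measurable_AE[OF ml ae] ml ae by (intro integral_cong_AE) (auto simp: eq_commute)
  also have "\<dots> = integral\<^sup>L lborel ?r" using m by (rule integral_completion)
  also have "\<dots> = (\<integral>x. f x * divergence \<phi> x \<partial>lborel) - (\<integral>x. g x * (A x \<bullet> \<phi> x) \<partial>lborel)"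
    by (intro Bochner_Integration.integral_diff integrable_divergence[OF \<phi> f] integrable_inner_test_field[OF A \<phi> g])
  finally show ?thesis by (simp add: set_lebesgue_integral_def)
qed

lemma C1_upper:
  fixes u :: "real^'n \<Rightarrow> complex"
  assumes A: "continuous_on UNIV A" and \<phi>: "\<phi> \<in> test_fields V" "\<And>x. norm (\<phi> x) \<le> 1"
    and f: "integrable lborel f" and g: "integrable lborel g"
    and u: "AE x in lborel. x \<in> V \<longrightarrow> Re (u x) = f x \<and> Im (u x) = g x"
  shows "ereal ((\<integral>x. f x * divergence \<phi> x \<partial>lborel) - (\<integral>x. g x * (A x \<bullet> \<phi> x) \<partial>lborel)) \<le> C1 A u V"
  unfolding C1_integrand[OF A \<phi>(1) f g u, symmetric] C1_def
  by (intro SUP_upper) (use \<phi> in auto)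

lemma C1_least:
  fixes u :: "real^'n \<Rightarrow> complex"
  assumes A: "continuous_on UNIV A" and f: "integrable lborel f" and g: "integrable lborel g"
    and u: "AE x in lborel. x \<in> V \<longrightarrow> Re (u x) = f x \<and> Im (u x) = g x"
    and le: "\<And>\<phi>. \<phi> \<in> test_fields V \<Longrightarrow> AE x in lborel. x \<in> V \<longrightarrow> norm (\<phi> x) \<le> 1 \<Longrightarrow>
      (\<integral>x. f x * divergence \<phi> x \<partial>lborel) - (\<integral>x. g x * (A x \<bullet> \<phi> x) \<partial>lborel) \<le> c"
  shows "C1 A u V \<le> ereal c"
  unfolding C1_def
proof (rule SUP_least)
  fix \<phi> assume "\<phi> \<in> {\<phi> \<in> test_fields V. AE x\<in>V in lebesgue. norm (\<phi> x) \<le> 1}"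
  then have \<phi>: "\<phi> \<in> test_fields V" "AE x in lborel. x \<in> V \<longrightarrow> norm (\<phi> x) \<le> 1"
    by (auto simp: AE_completion_iff)
  show "ereal (LINT x:V|lebesgue. Re (u x) * divergence \<phi> x - (A x \<bullet> \<phi> x) * Im (u x)) \<le> ereal c"
    unfolding C1_integrand[OF A \<phi>(1) f g u] using le[OF \<phi>] by simp
qed

text \<open>The term with \<open>A\<close> contains no derivative, so it costs only \<open>M\<close>
  times the mass of \<open>g\<close> in \<open>V\<close>.\<close>

lemma inner_test_field_integral_le:
  fixes A \<phi> :: "real^'n \<Rightarrow> real^'n"
  assumes A: "continuous_on UNIV A" and \<phi>: "\<phi> \<in> test_fields V" "AE x in lborel. x \<in> V \<longrightarrow> norm (\<phi> x) \<le> 1"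
    and V: "V \<in> sets borel" and g: "integrable lborel g"
    and M: "0 \<le> M" "\<And>x. g x \<noteq> 0 \<Longrightarrow> norm (A x) \<le> M"
  shows "\<bar>\<integral>x. g x * (A x \<bullet> \<phi> x) \<partial>lborel\<bar> \<le> M * (\<integral>x. indicator V x * \<bar>g x\<bar> \<partial>lborel)"
proof -
  have i: "integrable lborel (\<lambda>x. indicator V x * \<bar>g x\<bar>)" by (rule integrable_indicator_abs[OF g V])
  have "\<bar>\<integral>x. g x * (A x \<bullet> \<phi> x) \<partial>lborel\<bar> \<le> (\<integral>x. \<bar>g x * (A x \<bullet> \<phi> x)\<bar> \<partial>lborel)"
    by (rule integral_abs_bound)
  also have "\<dots> \<le> (\<integral>x. M * (indicator V x * \<bar>g x\<bar>) \<partial>lborel)"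
  proof (rule integral_mono_AE)
    show "integrable lborel (\<lambda>x. \<bar>g x * (A x \<bullet> \<phi> x)\<bar>)"
      by (intro integrable_abs integrable_inner_test_field[OF A \<phi>(1) g])
    show "integrable lborel (\<lambda>x. M * (indicator V x * \<bar>g x\<bar>))" using i by simp
    show "AE x in lborel. \<bar>g x * (A x \<bullet> \<phi> x)\<bar> \<le> M * (indicator V x * \<bar>g x\<bar>)"
      using \<phi>(2)
    proof eventually_elim
      case (elim x)
      show ?case
      proof (cases "x \<in> V \<and> g x \<noteq> 0")
        case True
        have "\<bar>A x \<bullet> \<phi> x\<bar> \<le> norm (A x) * norm (\<phi> x)" by (rule Cauchy_Schwarz_ineq2)
        also have "\<dots> \<le> M * 1" using elim True M by (intro mult_mono) auto
        finally have "\<bar>g x\<bar> * \<bar>A x \<bullet> \<phi> x\<bar> \<le> \<bar>g x\<bar> * M" by (intro mult_left_mono) auto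
        then show ?thesis using True by (simp add: abs_mult mult.commute)
      qed (use test_field_zero[OF \<phi>(1)] in auto)
    qed
  qed
  also have "\<dots> = M * (\<integral>x. indicator V x * \<bar>g x\<bar> \<partial>lborel)" by simp
  finally show ?thesis .
qed

lemma nn_integral_indicator_abs:
  fixes g :: "'a::euclidean_space \<Rightarrow> real"
  assumes "integrable lborel g" "V \<in> sets borel"
  shows "(\<integral>\<^sup>+y. indicator V y * ennreal \<bar>g y\<bar> \<partial>lborel) = ennreal (\<integral>x. indicator V x * \<bar>g x\<bar> \<partial>lborel)"
proof -
  have "(\<integral>\<^sup>+y. ennreal (indicator V y * \<bar>g y\<bar>) \<partial>lborel) = ennreal (\<integral>x. indicator V x * \<bar>g x\<bar> \<partial>lborel)"
    by (intro nn_integral_eq_integral integrable_indicator_abs assms) auto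
  moreover have "(\<integral>\<^sup>+y. ennreal (indicator V y * \<bar>g y\<bar>) \<partial>lborel) = (\<integral>\<^sup>+y. indicator V y * ennreal \<bar>g y\<bar> \<partial>lborel)"
    by (intro nn_integral_cong) (auto simp: indicator_def)
  ultimately show ?thesis by simp
qed

text \<open>In \<open>C1\<close> the variation of the real part is mixed with the
  \<open>A\<close>-term of the imaginary part. Moving the latter to the other side leaves a bound
  for the real variation, which \<open>difference_bound_of_variation\<close> turns into
  increments.\<close>

lemma bv_bound_of_C1:
  fixes u :: "real^'n \<Rightarrow> complex"
  assumes A: "continuous_on UNIV A" and V: "open V"
    and f: "integrable lborel f" and g: "integrable lborel g"
    and u: "AE x in lborel. x \<in> V \<longrightarrow> Re (u x) = f x \<and> Im (u x) = g x"
    and M: "0 \<le> M" "\<And>x. g x \<noteq> 0 \<Longrightarrow> norm (A x) \<le> M" and c: "C1 A u V \<le> ereal c"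
  shows "bv_bound f V (c + M * (\<integral>x. indicator V x * \<bar>g x\<bar> \<partial>lborel)) (\<integral>x. indicator V x * \<bar>f x\<bar> \<partial>lborel)"
  unfolding bv_bound_def
proof (intro conjI allI)
  have Vb: "V \<in> sets borel" using V by simp
  let ?m = "\<lambda>g. \<integral>x. indicator V x * \<bar>g x\<bar> \<partial>lborel"
  have "0 \<le> c" using order_trans[OF C1_nonneg c] by simp
  moreover have m: "0 \<le> ?m g" for g :: "real^'n \<Rightarrow> real" by (intro integral_nonneg_AE) auto
  ultimately show "0 \<le> c + M * ?m g" "0 \<le> ?m f" using M(1) by auto
  show [measurable]: "f \<in> borel_measurable borel" using borel_measurable_integrable[OF f] by simp
  show "(\<integral>\<^sup>+y. indicator V y * ennreal \<bar>f y\<bar> \<partial>lborel) \<le> ennreal (?m f)"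
    by (simp add: nn_integral_indicator_abs[OF f Vb])
  fix k
  have "(\<integral>x. indicator (seg_core k V) x * \<bar>f (x + k) - f x\<bar> \<partial>lborel) \<le> (c + M * ?m g) * norm k"
  proof (rule difference_bound_of_variation[OF f V])
    fix \<phi> :: "real^'n \<Rightarrow> real^'n" assume \<phi>: "\<phi> \<in> test_fields V" "\<And>x. norm (\<phi> x) \<le> 1"
    have "(\<integral>x. f x * divergence \<phi> x \<partial>lborel) - (\<integral>x. g x * (A x \<bullet> \<phi> x) \<partial>lborel) \<le> c"
      using order_trans[OF C1_upper[OF A \<phi> f g u] c] by simp
    moreover have "\<bar>\<integral>x. g x * (A x \<bullet> \<phi> x) \<partial>lborel\<bar> \<le> M * ?m g"
      using \<phi>(2) by (intro inner_test_field_integral_le[OF A \<phi>(1) _ Vb g M]) auto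
    ultimately show "(\<integral>x. f x * divergence \<phi> x \<partial>lborel) \<le> c + M * ?m g" by linarith
  qed
  then show "(\<integral>\<^sup>+y. indicator (seg_core k V) y * ennreal \<bar>f (y + k) - f y\<bar> \<partial>lborel)
      \<le> ennreal ((c + M * ?m g) * norm k)"
    using open_seg_core[OF V, of k]
    by (subst nn_integral_indicator_abs)
      (auto intro!: ennreal_leI Bochner_Integration.integrable_diff integrable_lborel_shift f)
qed

text \<open>The way back from increments to \<open>C1\<close>, used for the extended
  functions.\<close>

lemma C1_le_of_diff_bound:
  fixes w :: "real^'n \<Rightarrow> complex"
  assumes A: "continuous_on UNIV A" and X: "open X"
    and F: "integrable lborel F" and G: "integrable lborel G"
    and w: "AE x in lborel. x \<in> X \<longrightarrow> Re (w x) = F x \<and> Im (w x) = G x"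
    and M: "0 \<le> M" "\<And>x. G x \<noteq> 0 \<Longrightarrow> norm (A x) \<le> M"
    and c: "diff_bound F X c" "0 \<le> c"
    and m: "(\<integral>\<^sup>+y. indicator X y * ennreal \<bar>G y\<bar> \<partial>lborel) \<le> ennreal m" "0 \<le> m"
  shows "C1 A w X \<le> ereal (real CARD('n) * c + M * m)"
proof (rule C1_least[OF A F G w])
  fix \<phi> :: "real^'n \<Rightarrow> real^'n"
  assume \<phi>: "\<phi> \<in> test_fields X" "AE x in lborel. x \<in> X \<longrightarrow> norm (\<phi> x) \<le> 1"
  have Xb: "X \<in> sets borel" using X by simp
  obtain \<delta> where \<delta>: "0 < \<delta>" "\<And>h. norm h < \<delta> \<Longrightarrow>
      (\<integral>\<^sup>+x. indicator X x * ennreal \<bar>F (x + h) - F x\<bar> \<partial>lborel) \<le> ennreal (c * norm h)"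
    using c(1) unfolding diff_bound_def by blast
  have "(\<integral>x. F x * divergence \<phi> x \<partial>lborel) \<le> real CARD('n) * c"
  proof (rule integral_divergence_le[OF F \<phi>(1) Xb \<phi>(2) \<delta>(1)])
    fix h :: "real^'n" assume "norm h < \<delta>"
    then have "ennreal (\<integral>x. indicator X x * \<bar>F (x + h) - F x\<bar> \<partial>lborel) \<le> ennreal (c * norm h)"
      using \<delta>(2)[of h] by (subst (asm) nn_integral_indicator_abs)
        (auto intro!: Bochner_Integration.integrable_diff integrable_lborel_shift F Xb)
    then show "(\<integral>x. indicator X x * \<bar>F (x + h) - F x\<bar> \<partial>lborel) \<le> c * norm h"
      using c(2) by (simp add: ennreal_le_iff)
  qed
  moreover have "\<bar>\<integral>x. G x * (A x \<bullet> \<phi> x) \<partial>lborel\<bar> \<le> M * (\<integral>x. indicator X x * \<bar>G x\<bar> \<partial>lborel)"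
    by (rule inner_test_field_integral_le[OF A \<phi> Xb G M])
  moreover have "(\<integral>x. indicator X x * \<bar>G x\<bar> \<partial>lborel) \<le> m"
    using m by (simp add: nn_integral_indicator_abs[OF G Xb] ennreal_le_iff)
  then have "M * (\<integral>x. indicator X x * \<bar>G x\<bar> \<partial>lborel) \<le> M * m" using M(1) by (rule mult_left_mono)
  ultimately show "(\<integral>x. F x * divergence \<phi> x \<partial>lborel) - (\<integral>x. G x * (A x \<bullet> \<phi> x) \<partial>lborel)
      \<le> real CARD('n) * c + M * m" by linarith
qed

lemma C1_mono:
  fixes u :: "real^'n \<Rightarrow> complex"
  assumes A: "continuous_on UNIV A" and f: "integrable lborel f" and g: "integrable lborel g"
    and u: "AE x in lborel. x \<in> \<Omega> \<longrightarrow> Re (u x) = f x \<and> Im (u x) = g x" and V: "V \<subseteq> \<Omega>" "open V"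
  shows "C1 A u V \<le> C1 A u \<Omega>"
  unfolding C1_def[of A u V]
proof (rule SUP_least)
  fix \<phi> assume "\<phi> \<in> {\<phi> \<in> test_fields V. AE x\<in>V in lebesgue. norm (\<phi> x) \<le> 1}"
  then have \<phi>: "\<phi> \<in> test_fields V" "AE x in lebesgue. x \<in> V \<longrightarrow> norm (\<phi> x) \<le> 1" by auto
  have \<phi>': "\<phi> \<in> test_fields \<Omega>" using \<phi>(1) test_fields_mono[OF V(1)] by blast
  have "AE x in lebesgue. x \<in> \<Omega> \<longrightarrow> norm (\<phi> x) \<le> 1"
    using \<phi>(2)
  proof eventually_elim
    case (elim x)
    then show ?case using test_field_zero[OF \<phi>(1), of x] by (cases "x \<in> V") auto
  qed
  moreover have "AE x in lborel. x \<in> V \<longrightarrow> Re (u x) = f x \<and> Im (u x) = g x"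
    using u by eventually_elim (use V in auto)
  ultimately show "ereal (LINT x:V|lebesgue. Re (u x) * divergence \<phi> x - (A x \<bullet> \<phi> x) * Im (u x)) \<le> C1 A u \<Omega>"
    unfolding C1_integrand[OF A \<phi>(1) f g \<open>AE x in lborel. x \<in> V \<longrightarrow> _\<close>]
      C1_integrand[OF A \<phi>' f g u, symmetric] C1_def
    by (intro SUP_upper) (use \<phi>' in auto)
qed

text \<open>Variation is superadditive on disjoint open sets; a test field that almost attains the
  variation on \<open>\<Omega>\<close> has compact support and leaves little variation near the frontier.\<close>

lemma C1_small_near_frontier:
  fixes u :: "real^'n \<Rightarrow> complex"
  assumes A: "continuous_on UNIV A" and \<Omega>: "open \<Omega>"
    and f: "integrable lborel f" and g: "integrable lborel g"
    and u: "AE x in lborel. x \<in> \<Omega> \<longrightarrow> Re (u x) = f x \<and> Im (u x) = g x"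
    and fin: "C1 A u \<Omega> = ereal c" and \<eta>: "0 < \<eta>"
  obtains r where "0 < r" "C1 A u (\<Omega> \<inter> near (frontier \<Omega>) False r) \<le> ereal \<eta>"
proof -
  have "ereal (c - \<eta>) < C1 A u \<Omega>" using fin \<eta> by simp
  then obtain \<psi> where \<psi>: "\<psi> \<in> test_fields \<Omega>" "AE x in lborel. x \<in> \<Omega> \<longrightarrow> norm (\<psi> x) \<le> 1"
    and \<psi>_large: "c - \<eta> < (LINT x:\<Omega>|lebesgue. Re (u x) * divergence \<psi> x - (A x \<bullet> \<psi> x) * Im (u x))"
    unfolding C1_def less_SUP_iff by (auto simp: AE_completion_iff)
  have cl: "compact (closure {x. \<psi> x \<noteq> 0})" "closure {x. \<psi> x \<noteq> 0} \<subseteq> \<Omega>" using \<psi>(1) by (auto simp: test_fields_def)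
  obtain r where r: "0 < r" "(\<Union>x\<in>closure {x. \<psi> x \<noteq> 0}. ball x r) \<subseteq> \<Omega>"
    by (rule compact_subset_open_imp_ball_epsilon_subset[OF cl(1) \<Omega> cl(2)]) blast
  define V where "V = \<Omega> \<inter> near (frontier \<Omega>) False r"
  \<comment> \<open>The ball of radius \<open>r\<close> about a point of \<open>V\<close> contains a
    frontier point and so is not contained in the open set \<Omega>. Points of the support of \<psi>
    have their ball inside \<Omega>.\<close>
  have \<psi>0: "\<psi> x = 0" if "x \<in> V" for x
  proof (rule ccontr)
    assume "\<psi> x \<noteq> 0"
    then have "x \<in> closure {x. \<psi> x \<noteq> 0}" by (intro subsetD[OF closure_subset]) simp
    then have "ball x r \<subseteq> \<Omega>" using r(2) by blast
    moreover obtain p where "p \<in> frontier \<Omega>" "dist x p < r" using \<open>x \<in> V\<close> by (auto simp: V_def near_def)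
    ultimately show False using \<Omega> by (auto simp: frontier_def interior_open)
  qed
  let ?I = "\<lambda>\<phi>. (\<integral>x. f x * divergence \<phi> x \<partial>lborel) - (\<integral>x. g x * (A x \<bullet> \<phi> x) \<partial>lborel)"
  have "C1 A u V \<le> ereal \<eta>"
  proof (rule C1_least[OF A f g])
    show "AE x in lborel. x \<in> V \<longrightarrow> Re (u x) = f x \<and> Im (u x) = g x"
      using u by eventually_elim (auto simp: V_def)
    fix \<phi> :: "real^'n \<Rightarrow> real^'n"
    assume \<phi>: "\<phi> \<in> test_fields V" "AE x in lborel. x \<in> V \<longrightarrow> norm (\<phi> x) \<le> 1"
    have \<phi>': "\<phi> \<in> test_fields \<Omega>" using \<phi>(1) test_fields_mono[of V \<Omega>] by (auto simp: V_def)
    let ?s = "\<lambda>x. \<phi> x + \<psi> x"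
    have s: "?s \<in> test_fields \<Omega>" by (rule test_fields_add[OF \<phi>' \<psi>(1)])
    \<comment> \<open>Since \<phi> lives where \<psi> vanishes, the sum is admissible on \<Omega>.
      Its value is at most \<open>c\<close>, and \<psi> alone accounts for more than
      \<open>c - \<eta>\<close>.\<close>
    have "AE x in lborel. x \<in> \<Omega> \<longrightarrow> norm (?s x) \<le> 1"
      using \<phi>(2) \<psi>(2)
    proof eventually_elim
      case (elim x)
      then show ?case using \<psi>0[of x] test_field_zero[OF \<phi>(1), of x] by (cases "x \<in> V") auto
    qed
    then have "AE x in lebesgue. x \<in> \<Omega> \<longrightarrow> norm (?s x) \<le> 1" by (rule AE_completion)
    then have "ereal (LINT x:\<Omega>|lebesgue. Re (u x) * divergence ?s x - (A x \<bullet> ?s x) * Im (u x)) \<le> C1 A u \<Omega>"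
      unfolding C1_def by (intro SUP_upper) (use s in auto)
    then have "?I ?s \<le> c" unfolding C1_integrand[OF A s f g u] fin by simp
    moreover have "?I ?s = ?I \<phi> + ?I \<psi>"
      using integrable_divergence[OF \<phi>(1) f] integrable_divergence[OF \<psi>(1) f]
        integrable_inner_test_field[OF A \<phi>(1) g] integrable_inner_test_field[OF A \<psi>(1) g]
      by (simp add: divergence_add[OF \<phi>(1) \<psi>(1)] inner_add_right distrib_left)
    ultimately show "?I \<phi> \<le> \<eta>" using \<psi>_large unfolding C1_integrand[OF A \<psi>(1) f g u] by linarith
  qed
  then show ?thesis using that r(1) by (simp add: V_def)
qed

text \<open>A compact subset of \<Omega> carries all of the mass up to \<eta>, and it keeps a
  positive distance from the frontier.\<close>

lemma L1_small_near_frontier: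
  fixes f :: "'a::euclidean_space \<Rightarrow> real"
  assumes \<Omega>: "open \<Omega>" and f: "integrable lborel f" and \<eta>: "0 < \<eta>"
  obtains r where "0 < r" "(\<integral>x. indicator (\<Omega> \<inter> near (frontier \<Omega>) False r) x * \<bar>f x\<bar> \<partial>lborel) \<le> \<eta>"
proof -
  obtain K where K: "compact K" "K \<subseteq> \<Omega>" "(\<integral>x. indicator (\<Omega> - K) x * \<bar>f x\<bar> \<partial>lborel) \<le> \<eta>"
    using integrable_inner_compact[OF f _ \<eta>, of \<Omega>] \<Omega> by auto
  obtain r where r: "0 < r" "(\<Union>x\<in>K. ball x r) \<subseteq> \<Omega>"
    using compact_subset_open_imp_ball_epsilon_subset[OF K(1) \<Omega> K(2)] by metis
  have sub: "\<Omega> \<inter> near (frontier \<Omega>) False r \<subseteq> \<Omega> - K"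
  proof
    fix x assume x: "x \<in> \<Omega> \<inter> near (frontier \<Omega>) False r"
    then obtain p where "p \<in> frontier \<Omega>" "dist x p < r" by (auto simp: near_def)
    then have "\<not> ball x r \<subseteq> \<Omega>" using \<Omega> by (auto simp: frontier_def interior_open)
    then show "x \<in> \<Omega> - K" using r(2) x by blast
  qed
  note I = integrable_indicator_abs[OF f]
  have "(\<integral>x. indicator (\<Omega> \<inter> near (frontier \<Omega>) False r) x * \<bar>f x\<bar> \<partial>lborel) \<le> (\<integral>x. indicator (\<Omega> - K) x * \<bar>f x\<bar> \<partial>lborel)"
  proof (rule integral_mono)
    show "integrable lborel (\<lambda>x. indicator (\<Omega> \<inter> near (frontier \<Omega>) False r) x * \<bar>f x\<bar>)"
      by (intro I borel_open open_Int \<Omega> open_near)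
    show "integrable lborel (\<lambda>x. indicator (\<Omega> - K) x * \<bar>f x\<bar>)"
      by (intro I sets.Diff borel_open \<Omega> borel_compact K)
    show "indicator (\<Omega> \<inter> near (frontier \<Omega>) False r) x * \<bar>f x\<bar> \<le> indicator (\<Omega> - K) x * \<bar>f x\<bar>" for x
      using sub by (intro mult_right_mono) (auto simp: indicator_def)
  qed
  then show ?thesis using that[OF r(1)] K(3) by linarith
qed

section \<open>Borel representatives and the definition of the extension\<close>

definition L1_on :: "'a::euclidean_space set \<Rightarrow> ('a \<Rightarrow> real) \<Rightarrow> real" where
  "L1_on V f = (\<integral>x. indicator V x * \<bar>f x\<bar> \<partial>lborel)"

lemma L1_on_nonneg: "0 \<le> L1_on V f"
  unfolding L1_on_def by (intro integral_nonneg_AE) auto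

lemma L1_on_minus: "L1_on V (\<lambda>x. - f x) = L1_on V f"
  by (simp add: L1_on_def)

lemma L1_on_mono:
  assumes f: "integrable lborel f" and "V \<subseteq> V'" and [measurable]: "V \<in> sets borel" "V' \<in> sets borel"
  shows "L1_on V f \<le> L1_on V' f"
proof -
  note I = integrable_indicator_abs[OF f]
  show ?thesis unfolding L1_on_def
    using assms(2) by (intro integral_mono I mult_right_mono) (auto simp: indicator_def)
qed

text \<open>Elements of \<open>BV\<close> are only Lebesgue measurable, while translation and
  folding are treated for Borel functions. The representative vanishes at every point off \<Omega>,
  as the pointwise estimates for \<open>extend\<close> assume.\<close>

lemma borel_representative:
  fixes h :: "'a::euclidean_space \<Rightarrow> real"
  assumes h: "integrable lebesgue h" and zero: "\<And>x. x \<notin> \<Omega> \<Longrightarrow> h x = 0" and [measurable]: "\<Omega> \<in> sets borel"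
  obtains f where "integrable lborel f" "\<And>x. x \<notin> \<Omega> \<Longrightarrow> f x = 0" "AE x in lborel. h x = f x"
proof -
  obtain f' where f': "f' \<in> borel_measurable lborel" "AE x in lborel. h x = f' x"
    using completion_ex_borel_measurable_real[OF borel_measurable_integrable[OF h]] by blast
  then have [measurable]: "f' \<in> borel_measurable borel" by simp
  define f where "f x = indicator \<Omega> x * f' x" for x
  have m: "f \<in> borel_measurable lborel" unfolding f_def by measurable
  have ae: "AE x in lborel. h x = f x"
    using f'(2) by eventually_elim (use zero in \<open>auto simp: f_def indicator_def\<close>)
  have "integrable lebesgue f"
    using h measurable_completion[OF m] AE_completion[OF ae] by (rule integrable_cong_AE_imp)
  then have "integrable lborel f" using integrable_completion[OF m] by simp
  then show ?thesis by (rule that[OF _ _ ae]) (simp add: f_def)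
qed

text \<open>The construction is applied to \<open>u\<close> itself rather than to a chosen
  representative, so linearity holds at every point. Setting the function to 0 off \<Omega> discards
  its irrelevant values there.\<close>

definition extension :: "(real^'n) patch list \<Rightarrow> (real^'n) set \<Rightarrow> (real^'n \<Rightarrow> complex) \<Rightarrow> real^'n \<Rightarrow> complex" where
  "extension Ps \<Omega> u x = Complex (extend Ps (\<lambda>y. if y \<in> \<Omega> then Re (u y) else 0) x)
    (extend Ps (\<lambda>y. if y \<in> \<Omega> then Im (u y) else 0) x)"

text \<open>The notion serves both for \<open>u\<close> on \<Omega> and, with \<open>UNIV\<close> as
  the set, for its extension.\<close>

definition represents :: "(real^'n) set \<Rightarrow> (real^'n \<Rightarrow> complex) \<Rightarrow> (real^'n \<Rightarrow> real) \<Rightarrow> (real^'n \<Rightarrow> real) \<Rightarrow> bool" where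
  "represents \<Omega> u f g \<longleftrightarrow> integrable lborel f \<and> integrable lborel g \<and> (\<forall>x. x \<notin> \<Omega> \<longrightarrow> f x = 0 \<and> g x = 0) \<and>
    (AE x in lborel. x \<in> \<Omega> \<longrightarrow> Re (u x) = f x \<and> Im (u x) = g x)"

lemma represents_exists:
  fixes u :: "real^'n \<Rightarrow> complex"
  assumes u: "set_integrable lebesgue \<Omega> u" and \<Omega>: "open \<Omega>"
  obtains f g where "represents \<Omega> u f g"
proof -
  have i: "integrable lebesgue (\<lambda>x. indicator \<Omega> x *\<^sub>R u x)" using u by (simp add: set_integrable_def)
  have "\<Omega> \<in> sets borel" using \<Omega> by simp
  obtain f where f: "integrable lborel f" "\<And>x. x \<notin> \<Omega> \<Longrightarrow> f x = 0"
    "AE x in lborel. Re (indicator \<Omega> x *\<^sub>R u x) = f x"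
    by (rule borel_representative[OF integrable_Re[OF i] _ \<open>\<Omega> \<in> sets borel\<close>]) auto
  obtain g where g: "integrable lborel g" "\<And>x. x \<notin> \<Omega> \<Longrightarrow> g x = 0"
    "AE x in lborel. Im (indicator \<Omega> x *\<^sub>R u x) = g x"
    by (rule borel_representative[OF integrable_Im[OF i] _ \<open>\<Omega> \<in> sets borel\<close>]) auto
  have "AE x in lborel. x \<in> \<Omega> \<longrightarrow> Re (u x) = f x \<and> Im (u x) = g x"
    using f(3) g(3) by eventually_elim auto
  then have "represents \<Omega> u f g" using f g by (simp add: represents_def)
  then show ?thesis by (rule that)
qed

lemma represents_rotate: "represents \<Omega> u f g \<Longrightarrow> represents \<Omega> (\<lambda>x. - \<i> * u x) g (\<lambda>x. - f x)"
  by (auto simp: represents_def)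

lemma represents_set_integrable:
  assumes "represents \<Omega> u f g" "\<Omega> \<in> sets borel"
  shows "set_integrable lebesgue \<Omega> u"
proof -
  have r: "integrable lborel f" "integrable lborel g" "\<And>x. x \<notin> \<Omega> \<Longrightarrow> f x = 0 \<and> g x = 0"
    "AE x in lborel. x \<in> \<Omega> \<longrightarrow> Re (u x) = f x \<and> Im (u x) = g x"
    using assms by (auto simp: represents_def)
  let ?c = "\<lambda>x. complex_of_real (f x) + \<i> * complex_of_real (g x)"
  have c: "integrable lborel ?c" using r by (intro Bochner_Integration.integrable_add) auto
  then have m: "?c \<in> borel_measurable lborel" by (rule borel_measurable_integrable)
  then have cl: "integrable lebesgue ?c" using integrable_completion[OF m] c by simp
  have "AE x in lborel. ?c x = indicator \<Omega> x *\<^sub>R u x"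
    using r(4) by eventually_elim (use r(3) in \<open>auto simp: indicator_def complex_eq_iff\<close>)
  then have ae: "AE x in lebesgue. ?c x = indicator \<Omega> x *\<^sub>R u x" by (rule AE_completion)
  show ?thesis unfolding set_integrable_def
    by (rule integrable_cong_AE_imp[OF cl borel_measurable_AE[OF borel_measurable_integrable[OF cl] ae] ae])
qed

lemma represents_L1:
  assumes "represents \<Omega> u f g"
  shows "(LINT x:\<Omega>|lebesgue. \<bar>Re (u x)\<bar> + \<bar>Im (u x)\<bar>) = L1_on \<Omega> f + L1_on \<Omega> g"
proof -
  have r: "integrable lborel f" "integrable lborel g" "\<And>x. x \<notin> \<Omega> \<Longrightarrow> f x = 0 \<and> g x = 0"
    "AE x in lborel. x \<in> \<Omega> \<longrightarrow> Re (u x) = f x \<and> Im (u x) = g x"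
    using assms by (auto simp: represents_def)
  let ?l = "\<lambda>x. indicator \<Omega> x *\<^sub>R (\<bar>Re (u x)\<bar> + \<bar>Im (u x)\<bar>)"
  let ?r = "\<lambda>x. \<bar>f x\<bar> + \<bar>g x\<bar>"
  have "AE x in lborel. ?r x = ?l x"
    using r(4) by eventually_elim (use r(3) in \<open>auto simp: indicator_def\<close>)
  then have ae: "AE x in lebesgue. ?r x = ?l x" by (rule AE_completion)
  have i: "integrable lborel ?r" using r by simp
  then have m: "?r \<in> borel_measurable lborel" by (rule borel_measurable_integrable)
  then have ml: "?r \<in> borel_measurable lebesgue" by (rule measurable_completion)
  have "AE x in lebesgue. ?l x = ?r x" using ae by eventually_elim simp
  then have "integral\<^sup>L lebesgue ?l = integral\<^sup>L lebesgue ?r"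
    by (rule integral_cong_AE[OF borel_measurable_AE[OF ml ae] ml])
  also have "\<dots> = integral\<^sup>L lborel ?r" using m by (rule integral_completion)
  also have "\<dots> = (\<integral>x. \<bar>f x\<bar> \<partial>lborel) + (\<integral>x. \<bar>g x\<bar> \<partial>lborel)" using r by simp
  also have "(\<integral>x. \<bar>f x\<bar> \<partial>lborel) = L1_on \<Omega> f" unfolding L1_on_def
    by (intro Bochner_Integration.integral_cong) (use r(3) in \<open>auto simp: indicator_def\<close>)
  also have "(\<integral>x. \<bar>g x\<bar> \<partial>lborel) = L1_on \<Omega> g" unfolding L1_on_def
    by (intro Bochner_Integration.integral_cong) (use r(3) in \<open>auto simp: indicator_def\<close>)
  finally show ?thesis by (simp add: set_lebesgue_integral_def)
qed

section \<open>Norm and frontier estimates for the extension operator\<close>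

text \<open>The assumption \<open>bound\<close> is the conclusion of \<open>extend_bound\<close> for
  patches that cover the frontier. All extended functions vanish off \<open>W\<close>, where
  \<open>M\<close> bounds \<open>A\<close>.\<close>

locale extension_setup =
  fixes A :: "real^'n \<Rightarrow> real^'n" and \<Omega> W :: "(real^'n) set" and Ps :: "(real^'n) patch list"
    and C K \<rho>\<^sub>0 M :: real
  assumes A: "continuous_on UNIV A" and \<Omega>: "open \<Omega>" and sub: "\<Omega> \<subseteq> W"
    and patches: "\<forall>P\<in>set Ps. is_patch \<Omega> W P"
    and const_pos: "0 < C" "0 \<le> K" "0 < \<rho>\<^sub>0"
    and bound: "\<And>g b \<rho> c m. bv_bound g (\<Omega> \<inter> near (frontier \<Omega>) b (C * \<rho>)) c m \<Longrightarrow>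
      \<forall>x. x \<notin> \<Omega> \<longrightarrow> g x = 0 \<Longrightarrow> 0 < \<rho> \<Longrightarrow> b \<or> \<rho> \<le> \<rho>\<^sub>0 \<Longrightarrow>
      diff_bound (extend Ps g) (near (frontier \<Omega>) b \<rho>) (K * (c + m)) \<and>
      (\<integral>\<^sup>+x. indicator (near (frontier \<Omega>) b \<rho>) x * ennreal \<bar>extend Ps g x\<bar> \<partial>lborel) \<le> ennreal (K * m)"
    and M: "0 \<le> M" "\<And>x. x \<in> W \<Longrightarrow> norm (A x) \<le> M"
begin

abbreviation "T \<equiv> extension Ps \<Omega>"
abbreviation "source b \<rho> \<equiv> \<Omega> \<inter> near (frontier \<Omega>) b (C * \<rho>)"

text \<open>The first summand comes from the increments of the extended function and the second from
  the \<open>A\<close>-term. Together they bound \<open>C1\<close> and \<open>C2\<close> of the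
  extension by multiples of variation plus mass of the data.\<close>

definition B where "B = real CARD('n) * K * (1 + M) + M * K"

lemma B_nonneg: "0 \<le> B"
  using const_pos M by (simp add: B_def)

lemma source_True: "source True \<rho> = \<Omega>" "near (frontier \<Omega>) True \<rho> = UNIV"
  by (auto simp: near_def)

lemma open_source: "open (source b \<rho>)"
  by (intro open_Int \<Omega> open_near)

lemma extension_eq_AE:
  assumes "represents \<Omega> u f g"
  shows "AE x in lborel. Re (T u x) = extend Ps f x \<and> Im (T u x) = extend Ps g x"
proof -
  have r: "AE x in lborel. x \<in> \<Omega> \<longrightarrow> Re (u x) = f x \<and> Im (u x) = g x"
    and z: "\<And>x. x \<notin> \<Omega> \<Longrightarrow> f x = 0 \<and> g x = 0" using assms by (auto simp: represents_def)
  have "AE x in lborel. extend Ps (\<lambda>y. if y \<in> \<Omega> then Re (u y) else 0) x = extend Ps f x"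
    by (rule extend_AE[OF patches]) (use r in eventually_elim, use z in auto)
  moreover have "AE x in lborel. extend Ps (\<lambda>y. if y \<in> \<Omega> then Im (u y) else 0) x = extend Ps g x"
    by (rule extend_AE[OF patches]) (use r in eventually_elim, use z in auto)
  ultimately show ?thesis by eventually_elim (simp add: extension_def)
qed

lemma bound_of_C1:
  assumes r: "represents \<Omega> u f g" and c: "C1 A u (source b \<rho>) \<le> ereal c" and \<rho>: "0 < \<rho>" "b \<or> \<rho> \<le> \<rho>\<^sub>0"
  shows "diff_bound (extend Ps f) (near (frontier \<Omega>) b \<rho>)
      (K * (c + M * L1_on (source b \<rho>) g + L1_on (source b \<rho>) f))"
    and "(\<integral>\<^sup>+x. indicator (near (frontier \<Omega>) b \<rho>) x * ennreal \<bar>extend Ps f x\<bar> \<partial>lborel)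
      \<le> ennreal (K * L1_on (source b \<rho>) f)"
proof -
  have fg: "integrable lborel f" "integrable lborel g" "\<And>x. x \<notin> \<Omega> \<Longrightarrow> f x = 0 \<and> g x = 0"
    using r by (auto simp: represents_def)
  have u: "AE x in lborel. x \<in> \<Omega> \<longrightarrow> Re (u x) = f x \<and> Im (u x) = g x" using r by (simp add: represents_def)
  have "bv_bound f (source b \<rho>) (c + M * L1_on (source b \<rho>) g) (L1_on (source b \<rho>) f)"
    unfolding L1_on_def
  proof (rule bv_bound_of_C1[OF A open_source fg(1,2) _ M(1) _ c])
    show "AE x in lborel. x \<in> source b \<rho> \<longrightarrow> Re (u x) = f x \<and> Im (u x) = g x"
      using u by eventually_elim auto
    show "norm (A x) \<le> M" if "g x \<noteq> 0" for x using that fg(3) sub M(2) by blast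
  qed
  from bound[OF this _ \<rho>] fg(3)
  show "diff_bound (extend Ps f) (near (frontier \<Omega>) b \<rho>)
      (K * (c + M * L1_on (source b \<rho>) g + L1_on (source b \<rho>) f))"
    and "(\<integral>\<^sup>+x. indicator (near (frontier \<Omega>) b \<rho>) x * ennreal \<bar>extend Ps f x\<bar> \<partial>lborel)
      \<le> ennreal (K * L1_on (source b \<rho>) f)" by auto
qed

lemma extend_integrable:
  assumes r: "represents \<Omega> u f g" and c: "C1 A u \<Omega> \<le> ereal c"
  shows "integrable lborel (extend Ps f)" and "L1_on UNIV (extend Ps f) \<le> K * L1_on \<Omega> f"
proof -
  have "f \<in> borel_measurable borel" using r borel_measurable_integrable by (force simp: represents_def)
  then have m: "extend Ps f \<in> borel_measurable borel" by (rule extend_measurable[OF patches])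
  have le: "(\<integral>\<^sup>+x. ennreal \<bar>extend Ps f x\<bar> \<partial>lborel) \<le> ennreal (K * L1_on \<Omega> f)"
    using bound_of_C1(2)[OF r, of True \<rho>\<^sub>0 c] c const_pos by (simp add: source_True)
  show i: "integrable lborel (extend Ps f)"
    using m le by (intro integrableI_bounded) (auto intro: le_less_trans)
  show "L1_on UNIV (extend Ps f) \<le> K * L1_on \<Omega> f"
    unfolding L1_on_def using le const_pos L1_on_nonneg[of \<Omega> f]
    by (intro integral_real_bounded) (auto simp: L1_on_def)
qed

text \<open>With \<open>b\<close> true this bounds the total variation of the extension. With
  \<open>b\<close> false it bounds the variation near the frontier by data near the frontier. The
  bounds over all of \<Omega> in \<open>fin\<close> make the extended functions integrable.\<close>

lemma C1_extension_le:
  assumes r: "represents \<Omega> u f g" and fin: "C1 A u \<Omega> \<le> ereal c\<^sub>1" "C2 A u \<Omega> \<le> ereal c\<^sub>2"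
    and c: "C1 A u (source b \<rho>) \<le> ereal c" "C2 A u (source b \<rho>) \<le> ereal d" and \<rho>: "0 < \<rho>" "b \<or> \<rho> \<le> \<rho>\<^sub>0"
  shows "C1 A (T u) (near (frontier \<Omega>) b \<rho>) \<le> ereal (B * (c + L1_on (source b \<rho>) f + L1_on (source b \<rho>) g))"
    and "C2 A (T u) (near (frontier \<Omega>) b \<rho>) \<le> ereal (B * (d + L1_on (source b \<rho>) f + L1_on (source b \<rho>) g))"
proof -
  note r' = represents_rotate[OF r]
  let ?X = "near (frontier \<Omega>) b \<rho>"
  let ?mf = "L1_on (source b \<rho>) f" and ?mg = "L1_on (source b \<rho>) g"
  have z: "\<And>x. x \<notin> \<Omega> \<Longrightarrow> f x = 0 \<and> g x = 0" using r by (auto simp: represents_def)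
  have out: "norm (A x) \<le> M" if "extend Ps h x \<noteq> 0" "\<forall>x. x \<notin> \<Omega> \<longrightarrow> h x = 0" for h x
    using extend_outside[OF patches _ sub that(2)] that(1) M(2) by blast
  have nonneg: "0 \<le> c" "0 \<le> d" using order_trans[OF C1_nonneg c(1)] order_trans[OF C1_nonneg c(2)[unfolded C2_eq_C1]] by auto
  have F: "integrable lborel (extend Ps f)" "integrable lborel (extend Ps g)"
    using extend_integrable(1)[OF r fin(1)] extend_integrable(1)[OF r' fin(2)[unfolded C2_eq_C1]] by auto
  have df: "diff_bound (extend Ps f) ?X (K * (c + M * ?mg + ?mf))"
    and lf: "(\<integral>\<^sup>+x. indicator ?X x * ennreal \<bar>extend Ps f x\<bar> \<partial>lborel) \<le> ennreal (K * ?mf)"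
    by (rule bound_of_C1[OF r c(1) \<rho>])+
  have dg: "diff_bound (extend Ps g) ?X (K * (d + M * ?mf + ?mg))"
    and lg: "(\<integral>\<^sup>+x. indicator ?X x * ennreal \<bar>extend Ps g x\<bar> \<partial>lborel) \<le> ennreal (K * ?mg)"
    using bound_of_C1[OF r' c(2)[unfolded C2_eq_C1] \<rho>] by (simp_all add: L1_on_minus)
  have ae: "AE x in lborel. Re (T u x) = extend Ps f x \<and> Im (T u x) = extend Ps g x"
    by (rule extension_eq_AE[OF r])
  have arith: "real CARD('n) * (K * (a + M * p + q)) + M * (K * p) \<le> B * (a + q + p)"
    "real CARD('n) * (K * (a + M * p + q)) + M * (K * p) \<le> B * (a + p + q)"
    if "0 \<le> a" "0 \<le> p" "0 \<le> q" for a p q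
  proof -
    have "a + M * p + q \<le> (1 + M) * (a + q + p)"
      using that M(1) mult_nonneg_nonneg[OF M(1) that(1)] mult_nonneg_nonneg[OF M(1) that(3)]
      by (simp add: algebra_simps)
    then have "real CARD('n) * (K * (a + M * p + q)) \<le> real CARD('n) * (K * ((1 + M) * (a + q + p)))"
      using const_pos by (intro mult_left_mono) auto
    moreover have "M * (K * p) \<le> M * (K * (a + q + p))"
      using that const_pos M by (intro mult_left_mono) auto
    ultimately show "real CARD('n) * (K * (a + M * p + q)) + M * (K * p) \<le> B * (a + q + p)"
      by (simp add: B_def algebra_simps)
    then show "real CARD('n) * (K * (a + M * p + q)) + M * (K * p) \<le> B * (a + p + q)"
      by (simp add: add_ac)
  qed
  have "C1 A (T u) ?X \<le> ereal (real CARD('n) * (K * (c + M * ?mg + ?mf)) + M * (K * ?mg))"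
  proof (rule C1_le_of_diff_bound[OF A open_near F _ M(1) _ df _ lg])
    show "AE x in lborel. x \<in> ?X \<longrightarrow> Re (T u x) = extend Ps f x \<and> Im (T u x) = extend Ps g x"
      using ae by eventually_elim simp
    show "norm (A x) \<le> M" if "extend Ps g x \<noteq> 0" for x using out[OF that] z by blast
  qed (use nonneg const_pos M in \<open>auto intro!: mult_nonneg_nonneg add_nonneg_nonneg L1_on_nonneg\<close>)
  also have "\<dots> \<le> ereal (B * (c + ?mf + ?mg))" using arith(1)[OF nonneg(1) L1_on_nonneg L1_on_nonneg] by simp
  finally show "C1 A (T u) ?X \<le> ereal (B * (c + ?mf + ?mg))" .
  have "C1 A (\<lambda>x. - \<i> * T u x) ?X \<le> ereal (real CARD('n) * (K * (d + M * ?mf + ?mg)) + M * (K * ?mf))"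
  proof (rule C1_le_of_diff_bound[OF A open_near F(2) _ _ M(1) _ dg])
    show "integrable lborel (\<lambda>x. - extend Ps f x)" using F(1) by simp
    show "AE x in lborel. x \<in> ?X \<longrightarrow> Re (- \<i> * T u x) = extend Ps g x \<and> Im (- \<i> * T u x) = - extend Ps f x"
      using ae by eventually_elim simp
    show "norm (A x) \<le> M" if "- extend Ps f x \<noteq> 0" for x using out[of f x] that z by simp
  qed (use nonneg const_pos M lf in \<open>auto intro!: mult_nonneg_nonneg add_nonneg_nonneg L1_on_nonneg\<close>)
  also have "\<dots> \<le> ereal (B * (d + ?mf + ?mg))" using arith(2)[OF nonneg(2) L1_on_nonneg L1_on_nonneg] by simp
  finally show "C2 A (T u) ?X \<le> ereal (B * (d + ?mf + ?mg))" unfolding C2_eq_C1 .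
qed

lemma BV_represents:
  assumes u: "u \<in> BV A \<Omega>"
  obtains f g c\<^sub>1 c\<^sub>2 where "represents \<Omega> u f g" "C1 A u \<Omega> = ereal c\<^sub>1" "C2 A u \<Omega> = ereal c\<^sub>2" "0 \<le> c\<^sub>1" "0 \<le> c\<^sub>2"
proof -
  have "set_integrable lebesgue \<Omega> u" using u by (simp add: BV_def)
  then obtain f g where fg: "represents \<Omega> u f g" by (rule represents_exists[OF _ \<Omega>])
  have fin: "C1 A u \<Omega> + C2 A u \<Omega> < \<infinity>" using u by (simp add: BV_def total_var_def)
  have n: "0 \<le> C1 A u \<Omega>" "0 \<le> C2 A u \<Omega>" by (simp_all add: C1_nonneg C2_eq_C1)
  obtain c\<^sub>1 where c1: "C1 A u \<Omega> = ereal c\<^sub>1" using fin n by (cases "C1 A u \<Omega>"; cases "C2 A u \<Omega>") auto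
  obtain c\<^sub>2 where c2: "C2 A u \<Omega> = ereal c\<^sub>2" using fin n by (cases "C1 A u \<Omega>"; cases "C2 A u \<Omega>") auto
  show ?thesis using that[OF fg c1 c2] n c1 c2 by simp
qed

lemma extension_represents:
  assumes r: "represents \<Omega> u f g" and c: "C1 A u \<Omega> = ereal c\<^sub>1" "C2 A u \<Omega> = ereal c\<^sub>2"
  shows "represents UNIV (T u) (extend Ps f) (extend Ps g)"
    and "L1_on UNIV (extend Ps f) \<le> K * L1_on \<Omega> f" "L1_on UNIV (extend Ps g) \<le> K * L1_on \<Omega> g"
proof -
  have c1: "C1 A u \<Omega> \<le> ereal c\<^sub>1" and c2: "C1 A (\<lambda>x. - \<i> * u x) \<Omega> \<le> ereal c\<^sub>2"
    using c by (simp_all add: C2_eq_C1)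
  note 1 = extend_integrable[OF r c1] and 2 = extend_integrable[OF represents_rotate[OF r] c2]
  show "represents UNIV (T u) (extend Ps f) (extend Ps g)"
    unfolding represents_def using 1(1) 2(1) extension_eq_AE[OF r] by simp
  show "L1_on UNIV (extend Ps f) \<le> K * L1_on \<Omega> f" "L1_on UNIV (extend Ps g) \<le> K * L1_on \<Omega> g"
    using 1(2) 2(2) by auto
qed

text \<open>The mass contributes \<open>K\<close>. Each of the two functionals contributes
  \<open>B\<close> times its own variation plus the whole mass, whence \<open>2 * B\<close>.\<close>

lemma extension_bounded:
  assumes u: "u \<in> BV A \<Omega>"
  shows "T u \<in> BV A UNIV" and "BV_norm A UNIV (T u) \<le> (K + 2 * B) * BV_norm A \<Omega> u"
proof -
  obtain f g c\<^sub>1 c\<^sub>2 where r: "represents \<Omega> u f g" and c: "C1 A u \<Omega> = ereal c\<^sub>1" "C2 A u \<Omega> = ereal c\<^sub>2" "0 \<le> c\<^sub>1" "0 \<le> c\<^sub>2"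
    by (rule BV_represents[OF u])
  let ?m = "L1_on \<Omega> f + L1_on \<Omega> g"
  note R = extension_represents[OF r c(1,2)]
  have v: "C1 A (T u) UNIV \<le> ereal (B * (c\<^sub>1 + L1_on \<Omega> f + L1_on \<Omega> g))"
    "C2 A (T u) UNIV \<le> ereal (B * (c\<^sub>2 + L1_on \<Omega> f + L1_on \<Omega> g))"
    using C1_extension_le[OF r, of c\<^sub>1 c\<^sub>2 True \<rho>\<^sub>0 c\<^sub>1 c\<^sub>2] c const_pos by (auto simp: source_True)
  have tv: "total_var A (T u) UNIV \<le> ereal (B * (c\<^sub>1 + c\<^sub>2 + 2 * ?m))"
    unfolding total_var_def using add_mono[OF v] by (simp add: algebra_simps)
  show "T u \<in> BV A UNIV"
    unfolding BV_def using represents_set_integrable[OF R(1)] tv by (auto intro: le_less_trans)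
  have "0 \<le> total_var A (T u) UNIV" unfolding total_var_def by (simp add: C1_nonneg C2_eq_C1)
  then have "real_of_ereal (total_var A (T u) UNIV) \<le> B * (c\<^sub>1 + c\<^sub>2 + 2 * ?m)"
    using tv by (cases "total_var A (T u) UNIV") auto
  then have "BV_norm A UNIV (T u) \<le> K * ?m + B * (c\<^sub>1 + c\<^sub>2 + 2 * ?m)"
    unfolding BV_norm_def represents_L1[OF R(1)] using R(2,3) by (simp add: distrib_left)
  also have "\<dots> \<le> K * (?m + (c\<^sub>1 + c\<^sub>2)) + B * (2 * (?m + (c\<^sub>1 + c\<^sub>2)))"
    by (rule add_mono[OF mult_left_mono mult_left_mono]) (use const_pos(2) B_nonneg c(3,4) L1_on_nonneg in \<open>auto\<close>)
  also have "\<dots> = (K + 2 * B) * BV_norm A \<Omega> u"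
    unfolding BV_norm_def represents_L1[OF r] total_var_def c by (simp add: algebra_simps)
  finally show "BV_norm A UNIV (T u) \<le> (K + 2 * B) * BV_norm A \<Omega> u" .
qed

lemma extension_small_near_frontier:
  assumes u: "u \<in> BV A \<Omega>" and \<eta>: "0 < \<eta>"
  obtains \<rho> where "0 < \<rho>" "C1 A (T u) (near (frontier \<Omega>) False \<rho>) \<le> ereal \<eta>"
    "C2 A (T u) (near (frontier \<Omega>) False \<rho>) \<le> ereal \<eta>"
proof -
  obtain f g c\<^sub>1 c\<^sub>2 where r: "represents \<Omega> u f g" and c: "C1 A u \<Omega> = ereal c\<^sub>1" "C2 A u \<Omega> = ereal c\<^sub>2" "0 \<le> c\<^sub>1" "0 \<le> c\<^sub>2"
    by (rule BV_represents[OF u])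
  note r' = represents_rotate[OF r]
  have fg: "integrable lborel f" "integrable lborel g"
    and uf: "AE x in lborel. x \<in> \<Omega> \<longrightarrow> Re (u x) = f x \<and> Im (u x) = g x" using r by (auto simp: represents_def)
  have fg': "integrable lborel (\<lambda>x. - f x)"
    and uf': "AE x in lborel. x \<in> \<Omega> \<longrightarrow> Re (- \<i> * u x) = g x \<and> Im (- \<i> * u x) = - f x"
    using r' by (auto simp: represents_def)
  \<comment> \<open>Three quantities, each at most \<zeta>, get multiplied by \<open>B\<close>; the
    divisor \<open>B + 1\<close> is positive even when \<open>B = 0\<close>.\<close>
  define \<zeta> where "\<zeta> = \<eta> / 3 / (B + 1)"
  have \<zeta>: "0 < \<zeta>" using \<eta> B_nonneg by (simp add: \<zeta>_def)
  obtain r1 where r1: "0 < r1" "C1 A u (\<Omega> \<inter> near (frontier \<Omega>) False r1) \<le> ereal \<zeta>"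
    by (rule C1_small_near_frontier[OF A \<Omega> fg uf c(1) \<zeta>])
  obtain r2 where r2: "0 < r2" "C1 A (\<lambda>x. - \<i> * u x) (\<Omega> \<inter> near (frontier \<Omega>) False r2) \<le> ereal \<zeta>"
    by (rule C1_small_near_frontier[OF A \<Omega> fg(2) fg' uf' c(2)[unfolded C2_eq_C1] \<zeta>])
  obtain r3 where r3: "0 < r3" "L1_on (\<Omega> \<inter> near (frontier \<Omega>) False r3) f \<le> \<zeta>"
    unfolding L1_on_def by (rule L1_small_near_frontier[OF \<Omega> fg(1) \<zeta>])
  obtain r4 where r4: "0 < r4" "L1_on (\<Omega> \<inter> near (frontier \<Omega>) False r4) g \<le> \<zeta>"
    unfolding L1_on_def by (rule L1_small_near_frontier[OF \<Omega> fg(2) \<zeta>])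
  \<comment> \<open>The data are needed on a neighbourhood \<open>C\<close> times as wide as the one
    where the extension is estimated, hence the division by \<open>C\<close>.\<close>
  define \<rho> where "\<rho> = min \<rho>\<^sub>0 (min (min r1 r2) (min r3 r4) / C)"
  have \<rho>: "0 < \<rho>" "\<rho> \<le> \<rho>\<^sub>0" using r1 r2 r3 r4 const_pos by (auto simp: \<rho>_def)
  have "C * \<rho> \<le> C * (min (min r1 r2) (min r3 r4) / C)"
    using const_pos by (intro mult_left_mono) (auto simp: \<rho>_def)
  then have "C * \<rho> \<le> min (min r1 r2) (min r3 r4)" using const_pos by simp
  then have sb: "source False \<rho> \<subseteq> \<Omega> \<inter> near (frontier \<Omega>) False r'" if "r' \<in> {r1, r2, r3, r4}" for r'
    using that by (intro Int_mono near_mono) auto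
  have op: "open (\<Omega> \<inter> near (frontier \<Omega>) False r')" for r' by (intro open_Int \<Omega> open_near)
  have "C1 A u (source False \<rho>) \<le> C1 A u (\<Omega> \<inter> near (frontier \<Omega>) False r1)"
    by (rule C1_mono[OF A fg _ sb open_source]) (use uf in \<open>auto elim: eventually_mono\<close>)
  then have s1: "C1 A u (source False \<rho>) \<le> ereal \<zeta>" using r1(2) by (rule order_trans)
  have "C1 A (\<lambda>x. - \<i> * u x) (source False \<rho>) \<le> C1 A (\<lambda>x. - \<i> * u x) (\<Omega> \<inter> near (frontier \<Omega>) False r2)"
    by (rule C1_mono[OF A fg(2) fg' _ sb open_source]) (use uf' in \<open>auto elim: eventually_mono\<close>)
  then have s2: "C2 A u (source False \<rho>) \<le> ereal \<zeta>" unfolding C2_eq_C1 using r2(2) by (rule order_trans)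
  have "L1_on (source False \<rho>) f \<le> L1_on (\<Omega> \<inter> near (frontier \<Omega>) False r3) f"
    by (intro L1_on_mono fg sb borel_open open_source op) simp
  moreover have "L1_on (source False \<rho>) g \<le> L1_on (\<Omega> \<inter> near (frontier \<Omega>) False r4) g"
    by (intro L1_on_mono fg sb borel_open open_source op) simp
  ultimately have "\<zeta> + L1_on (source False \<rho>) f + L1_on (source False \<rho>) g \<le> 3 * \<zeta>"
    using r3(2) r4(2) by linarith
  then have "B * (\<zeta> + L1_on (source False \<rho>) f + L1_on (source False \<rho>) g) \<le> B * (3 * \<zeta>)"
    using B_nonneg by (rule mult_left_mono)
  also have "\<dots> \<le> (B + 1) * (3 * \<zeta>)" using \<zeta> by (intro mult_right_mono) auto
  also have "\<dots> = \<eta>"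
  proof -
    have *: "D * (3 * (\<eta> / 3 / D)) = \<eta>" if "D \<noteq> 0" for D :: real using that by simp
    have "B + 1 \<noteq> 0" using B_nonneg by linarith
    from *[OF this] show ?thesis by (simp only: \<zeta>_def)
  qed
  finally have le: "ereal (B * (\<zeta> + L1_on (source False \<rho>) f + L1_on (source False \<rho>) g)) \<le> ereal \<eta>" by simp
  have "C1 A (T u) (near (frontier \<Omega>) False \<rho>) \<le> ereal \<eta>" "C2 A (T u) (near (frontier \<Omega>) False \<rho>) \<le> ereal \<eta>"
    using order_trans[OF C1_extension_le(1)[OF r eq_refl[OF c(1)] eq_refl[OF c(2)] s1 s2 \<rho>(1)] le]
      order_trans[OF C1_extension_le(2)[OF r eq_refl[OF c(1)] eq_refl[OF c(2)] s1 s2 \<rho>(1)] le] \<rho>(2) by auto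
  then show ?thesis by (rule that[OF \<rho>(1)])
qed

lemma extension_var_measure_frontier:
  assumes u: "u \<in> BV A \<Omega>"
  shows "var_measure A UNIV (T u) (frontier \<Omega>) = 0"
proof -
  let ?U = "{U. open U \<and> frontier \<Omega> \<subseteq> U \<and> U \<subseteq> UNIV}"
  have mem: "near (frontier \<Omega>) False \<rho> \<in> ?U" if "0 < \<rho>" for \<rho>
  proof -
    have "x \<in> near (frontier \<Omega>) False \<rho>" if "x \<in> frontier \<Omega>" for x
      using that \<open>0 < \<rho>\<close> unfolding near_def by (intro CollectI disjI2 bexI[of _ x]) auto
    then show ?thesis by (auto simp: open_near)
  qed
  have 1: "(INF U\<in>?U. C1 A (T u) U) \<le> 0"
  proof (rule ereal_le_epsilon2)
    fix \<eta> :: real assume "0 < \<eta>"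
    then obtain \<rho> where "0 < \<rho>" "C1 A (T u) (near (frontier \<Omega>) False \<rho>) \<le> ereal \<eta>"
      by (rule extension_small_near_frontier[OF u]) blast
    then show "(INF U\<in>?U. C1 A (T u) U) \<le> 0 + ereal \<eta>" using mem by (auto intro: INF_lower2)
  qed
  have 2: "(INF U\<in>?U. C2 A (T u) U) \<le> 0"
  proof (rule ereal_le_epsilon2)
    fix \<eta> :: real assume "0 < \<eta>"
    then obtain \<rho> where "0 < \<rho>" "C2 A (T u) (near (frontier \<Omega>) False \<rho>) \<le> ereal \<eta>"
      by (rule extension_small_near_frontier[OF u]) blast
    then show "(INF U\<in>?U. C2 A (T u) U) \<le> 0 + ereal \<eta>" using mem by (auto intro: INF_lower2)
  qed
  have 3: "0 \<le> (INF U\<in>?U. C1 A (T u) U)" "0 \<le> (INF U\<in>?U. C2 A (T u) U)"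
    by (auto intro!: INF_greatest simp: C1_nonneg C2_eq_C1)
  show ?thesis unfolding var_measure_def antisym[OF 1 3(1)] antisym[OF 2 3(2)] by simp
qed

lemma extension_cong_AE:
  assumes "AE x\<in>\<Omega> in lebesgue. u x = v x"
  shows "AE x in lebesgue. T u x = T v x"
proof -
  have ae: "AE x in lborel. x \<in> \<Omega> \<longrightarrow> u x = v x" using assms by (simp add: AE_completion_iff)
  have "AE x in lborel. extend Ps (\<lambda>y. if y \<in> \<Omega> then Re (u y) else 0) x
      = extend Ps (\<lambda>y. if y \<in> \<Omega> then Re (v y) else 0) x"
    by (rule extend_AE[OF patches]) (use ae in eventually_elim, auto)
  moreover have "AE x in lborel. extend Ps (\<lambda>y. if y \<in> \<Omega> then Im (u y) else 0) x
      = extend Ps (\<lambda>y. if y \<in> \<Omega> then Im (v y) else 0) x"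
    by (rule extend_AE[OF patches]) (use ae in eventually_elim, auto)
  ultimately have "AE x in lborel. T u x = T v x" by eventually_elim (simp add: extension_def)
  then show ?thesis by (rule AE_completion)
qed

lemma extension_add: "T (\<lambda>y. u y + v y) x = T u x + T v x"
proof -
  have "(\<lambda>y. if y \<in> \<Omega> then h (u y + v y) else 0) = (\<lambda>y. (if y \<in> \<Omega> then h (u y) else 0) + (if y \<in> \<Omega> then h (v y) else 0))"
    if "\<And>a b. h (a + b) = h a + h b" for h :: "complex \<Rightarrow> real" using that by auto
  from this[of Re] this[of Im] show ?thesis
    by (simp only: extension_def plus_complex.sel extend_add[OF patches]) (simp add: complex_eq_iff)
qed

lemma extension_scaleR: "T (\<lambda>y. c *\<^sub>R u y) x = c *\<^sub>R T u x"
proof -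
  have "(\<lambda>y. if y \<in> \<Omega> then h (c *\<^sub>R u y) else 0) = (\<lambda>y. c * (if y \<in> \<Omega> then h (u y) else 0))"
    if "\<And>a. h (c *\<^sub>R a) = c * h a" for h :: "complex \<Rightarrow> real" using that by auto
  from this[of Re] this[of Im] show ?thesis
    by (simp only: extension_def scaleR_complex.sel extend_cmult[OF patches]) (simp add: complex_eq_iff)
qed

lemma extension_outside: "x \<notin> W \<Longrightarrow> T u x = 0"
  using extend_outside[OF patches _ sub] by (simp add: extension_def complex_eq_iff)

lemma extension_inside: "x \<in> \<Omega> \<Longrightarrow> T u x = u x"
  using extend_inside[OF patches] by (simp add: extension_def complex_eq_iff)

lemma extension_operator_extension: "extension_operator A \<Omega> T"
  unfolding extension_operator_def
proof (intro conjI ballI allI impI)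
  show "\<exists>K. \<forall>u\<in>BV A \<Omega>. BV_norm A UNIV (T u) \<le> K * BV_norm A \<Omega> u"
    using extension_bounded(2) by blast
qed (auto simp: extension_bounded(1) extension_add extension_scaleR extension_inside extension_cong_AE)

end

section \<open>Existence of the constants and conclusion\<close>

lemma extension_setup_exists:
  fixes A :: "real^'n \<Rightarrow> real^'n" and \<Omega> W :: "(real^'n) set"
  assumes \<Omega>: "open \<Omega>" "bounded \<Omega>" "lipschitz_boundary \<Omega>" and A: "locally_lipschitz A"
    and W: "open W" "closure \<Omega> \<subseteq> W" "bounded W"
  obtains Ps C K \<rho>\<^sub>0 M where "extension_setup A \<Omega> W Ps C K \<rho>\<^sub>0 M"
proof -
  have cA: "continuous_on UNIV A"
  proof (rule continuous_at_imp_continuous_on, rule ballI)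
    fix x
    obtain r L where "0 < r" "L-lipschitz_on (ball x r) A" using A unfolding locally_lipschitz_def by blast
    then have "continuous_on (ball x r) A" by (intro lipschitz_on_continuous_on)
    then show "isCont A x" using \<open>0 < r\<close> by (simp add: continuous_on_eq_continuous_at)
  qed
  obtain Ps \<epsilon> where Ps: "\<forall>P\<in>set Ps. is_patch \<Omega> W P" and \<epsilon>: "0 < \<epsilon>"
    and cover: "\<And>x. x \<in> near (frontier \<Omega>) False \<epsilon> \<Longrightarrow> \<exists>(e, \<gamma>, L, p, q)\<in>set Ps. dist x p < q / 2"
    by (rule exists_patches[OF \<Omega> W(1,2)]) blast
  \<comment> \<open>The balls of radius \<open>q / 2\<close> cover the \<epsilon>-neighbourhood of
    the frontier, so the third hypothesis on \<open>g\<close> in \<open>extend_bound\<close> holds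
    for every function.\<close>
  have vac: "\<not> (\<forall>(e, \<gamma>, L, p, q)\<in>set Ps. q / 2 \<le> dist x p)" if "x \<in> near (frontier \<Omega>) False \<epsilon>" for x
    using cover[OF that] by force
  obtain C K \<rho>\<^sub>0 where CK: "0 < C" "0 \<le> K" "0 < \<rho>\<^sub>0" and bound: "\<forall>g b \<rho> c m.
    bv_bound g (\<Omega> \<inter> near (frontier \<Omega>) b (C * \<rho>)) c m \<longrightarrow> (\<forall>x. x \<notin> \<Omega> \<longrightarrow> g x = 0) \<longrightarrow>
    (\<forall>x\<in>near (frontier \<Omega>) False \<epsilon>. (\<forall>(e, \<gamma>, L, p, q)\<in>set Ps. q / 2 \<le> dist x p) \<longrightarrow> g x = 0) \<longrightarrow>
    0 < \<rho> \<longrightarrow> b \<or> \<rho> \<le> \<rho>\<^sub>0 \<longrightarrow>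
    diff_bound (extend Ps g) (near (frontier \<Omega>) b \<rho>) (K * (c + m)) \<and>
    (\<integral>\<^sup>+x. indicator (near (frontier \<Omega>) b \<rho>) x * ennreal \<bar>extend Ps g x\<bar> \<partial>lborel) \<le> ennreal (K * m)"
    using extend_bound[OF Ps \<Omega>(1) \<epsilon>] by (elim exE conjE) (rule that)
  \<comment> \<open>Local Lipschitz continuity bounds \<open>A\<close> only on bounded sets; this is
    where boundedness of \<open>W\<close> enters.\<close>
  have "compact (A ` closure W)"
    using W(3) cA by (intro compact_continuous_image) (auto intro: continuous_on_subset)
  then obtain M where M: "0 < M" "\<And>y. y \<in> A ` closure W \<Longrightarrow> norm y \<le> M"
    using compact_imp_bounded bounded_pos by metis
  have "extension_setup A \<Omega> W Ps C K \<rho>\<^sub>0 M"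
  proof
    show "\<Omega> \<subseteq> W" using W(2) closure_subset by blast
    show "norm (A x) \<le> M" if "x \<in> W" for x using M(2) that closure_subset by blast
    show "diff_bound (extend Ps g) (near (frontier \<Omega>) b \<rho>) (K * (c + m)) \<and>
      (\<integral>\<^sup>+x. indicator (near (frontier \<Omega>) b \<rho>) x * ennreal \<bar>extend Ps g x\<bar> \<partial>lborel) \<le> ennreal (K * m)"
      if "bv_bound g (\<Omega> \<inter> near (frontier \<Omega>) b (C * \<rho>)) c m" "\<forall>x. x \<notin> \<Omega> \<longrightarrow> g x = 0" "0 < \<rho>" "b \<or> \<rho> \<le> \<rho>\<^sub>0"
      for g b \<rho> c m
      using bound that vac by blast
  qed (use cA \<Omega> Ps CK M(1) in auto)
  then show ?thesis by (rule that)
qed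

theorem lemma3p12:
  fixes A :: "real^'n \<Rightarrow> real^'n" and \<Omega> :: "(real^'n) set"
  assumes "open \<Omega>" and "bounded \<Omega>" and "lipschitz_boundary \<Omega>"
    and "locally_lipschitz A"
  shows "extension_domain A \<Omega>"
  unfolding extension_domain_def
proof (intro conjI allI impI)
  show "open \<Omega>" by (rule assms)
  show "bounded (frontier \<Omega>)" by (intro compact_imp_bounded compact_frontier_bounded[OF assms(2)])
  fix W assume W: "open W" "closure \<Omega> \<subseteq> W"
  \<comment> \<open>The given \<open>W\<close> may be unbounded, so it is intersected with a ball
    containing the closure of \<Omega>. Vanishing off the smaller set implies vanishing off
    \<open>W\<close>.\<close>
  obtain r where r: "closure \<Omega> \<subseteq> ball 0 r"
    using bounded_subset_ballD[of "closure \<Omega>" 0] assms(2) by (auto simp: bounded_closure)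
  obtain Ps C K \<rho>\<^sub>0 M where "extension_setup A \<Omega> (W \<inter> ball 0 r) Ps C K \<rho>\<^sub>0 M"
    by (rule extension_setup_exists[OF assms(1-4), of "W \<inter> ball 0 r"]) (use W r in \<open>auto simp: bounded_Int\<close>)
  then interpret extension_setup A \<Omega> "W \<inter> ball 0 r" Ps C K \<rho>\<^sub>0 M .
  show "\<exists>T. extension_operator A \<Omega> T \<and>
      (\<forall>u\<in>BV A \<Omega>. (AE x in lebesgue. x \<notin> W \<longrightarrow> T u x = 0) \<and> var_measure A UNIV (T u) (frontier \<Omega>) = 0)"
    using extension_operator_extension extension_outside extension_var_measure_frontier by auto
qed

end
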